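(* Let $\mathcal{A}$ and $\mathcal{B}$ be $C^*$-algebras. An $\mathcal{A}$-$\mathcal{B}$-correspondence $M$ is a Morita equivalence if and only if $M$ is full and the left action of $\mathcal{A}$ on $M$ defines an isomorphism $\mathcal{A}\to\mathscr{K}(M)$.
   Context: A correspondence from $\mathcal{A}$ to $\mathcal{B}$ ($\mathcal{A}$-$\mathcal{B}$-correspondence) is a Hilbert $\mathcal{B}$-module $M$ with a left action of $\mathcal{A}$ given by a nondegenerate representation of $\mathcal{A}$ by adjointable operators on $M$. $M$ is full if $\overline{\mathrm{span}}\,\langle M,M\rangle=\mathcal{B}$. $\mathscr{K}(M)$ is the norm closed span of the rank-one operators $xy^*\colon z\mapsto x\langle y,z\rangle$, $x,y\in M$. $\odot$ denotes the interior tensor product of correspondences, and $\mathcal{B}$ is a correspondence over itself with its natural bimodule structure and $\langle b,b'\rangle=b^*b'$. A Morita equivalence from $\mathcal{A}$ to $\mathcal{B}$ is an $\mathcal{A}$-$\mathcal{B}$-correspondence $M$ for which there exists a $\mathcal{B}$-$\mathcal{A}$-correspondence $N$ such that $N\odot M\cong\mathcal{B}$ and $M\odot N\cong\mathcal{A}$ as correspondences (i.e. via bilinear unitaries) over $\mathcal{B}$ and over $\mathcal{A}$, respectively. *)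

theory Defs
  imports "HOL-Analysis.Analysis" "HOL-Algebra.Group"
begin

section \<open>C*-algebras\<close>

text \<open>
  C*-algebras are complex, complete and not necessarily unital. The distribution has no class of
  complex vector spaces, so complex scalar multiplication is part of the class and has to extend
  the real one.
\<close>

class c_star_algebra = real_normed_algebra + complete_space +
  fixes scaleC :: "complex \<Rightarrow> 'a \<Rightarrow> 'a"
    and star :: "'a \<Rightarrow> 'a"
  assumes scaleC_add_right: "scaleC c (x + y) = scaleC c x + scaleC c y"
    and scaleC_add_left: "scaleC (c + d) x = scaleC c x + scaleC d x"
    and scaleC_scaleC: "scaleC c (scaleC d x) = scaleC (c * d) x"
    and scaleC_of_real: "scaleC (complex_of_real r) x = scaleR r x"
    and norm_scaleC: "norm (scaleC c x) = cmod c * norm x"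
    and mult_scaleC_left: "scaleC c x * y = scaleC c (x * y)"
    and mult_scaleC_right: "x * scaleC c y = scaleC c (x * y)"
    and star_star: "star (star x) = x"
    and star_add: "star (x + y) = star x + star y"
    and star_scaleC: "star (scaleC c x) = scaleC (cnj c) (star x)"
    and star_mult: "star (x * y) = star y * star x"
    and c_star_identity: "norm (star x * x) = (norm x)\<^sup>2"

global_interpretation complex_vector:
  vector_space "scaleC :: complex \<Rightarrow> 'a \<Rightarrow> 'a::c_star_algebra"
proof
  fix x :: 'a
  show "scaleC 1 x = x"
    using scaleC_of_real[of 1 x] by simp
qed (simp_all add: scaleC_add_right scaleC_add_left scaleC_scaleC)

definition positive :: "'a::c_star_algebra \<Rightarrow> bool" where
  "positive b \<longleftrightarrow> (\<exists>c. b = star c * c)"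

section \<open>Complex vector spaces on carrier sets\<close>

text \<open>
  Modules live on carrier sets because being a Morita equivalence quantifies existentially over
  modules.
\<close>

record 'v cvec = "'v partial_object" +
  vzero :: 'v
  vadd :: "'v \<Rightarrow> 'v \<Rightarrow> 'v"
  vscale :: "complex \<Rightarrow> 'v \<Rightarrow> 'v"

locale complex_space =
  fixes V :: "('v, 'z) cvec_scheme"
  assumes add_group: "comm_group \<lparr>carrier = carrier V, mult = vadd V, one = vzero V\<rparr>"
    and vscale_closed: "x \<in> carrier V \<Longrightarrow> vscale V c x \<in> carrier V"
    and vscale_add_right: "x \<in> carrier V \<Longrightarrow> y \<in> carrier V \<Longrightarrow>
      vscale V c (vadd V x y) = vadd V (vscale V c x) (vscale V c y)"
    and vscale_add_left: "x \<in> carrier V \<Longrightarrow>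
      vscale V (c + d) x = vadd V (vscale V c x) (vscale V d x)"
    and vscale_vscale: "x \<in> carrier V \<Longrightarrow> vscale V c (vscale V d x) = vscale V (c * d) x"
    and vscale_one: "x \<in> carrier V \<Longrightarrow> vscale V 1 x = x"

definition vdiff :: "('v, 'z) cvec_scheme \<Rightarrow> 'v \<Rightarrow> 'v \<Rightarrow> 'v" where
  "vdiff V x y = vadd V x (vscale V (- 1) y)"

inductive_set vspan :: "('v, 'z) cvec_scheme \<Rightarrow> 'v set \<Rightarrow> 'v set"
  for V X where
  vspan_zero: "vzero V \<in> vspan V X"
| vspan_base: "x \<in> X \<Longrightarrow> x \<in> vspan V X"
| vspan_add: "x \<in> vspan V X \<Longrightarrow> y \<in> vspan V X \<Longrightarrow> vadd V x y \<in> vspan V X"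
| vspan_scale: "x \<in> vspan V X \<Longrightarrow> vscale V c x \<in> vspan V X"

definition closed_vspan ::
  "('v, 'z) cvec_scheme \<Rightarrow> ('v \<Rightarrow> real) \<Rightarrow> 'v set \<Rightarrow> 'v set" where
  "closed_vspan V nrm X =
    {v \<in> carrier V. \<forall>e>0. \<exists>w\<in>vspan V X. nrm (vdiff V v w) < e}"

section \<open>Hilbert modules\<close>

record ('b, 'm) hilbert_mod = "'m cvec" +
  ract :: "'m \<Rightarrow> 'b \<Rightarrow> 'm"
  ip :: "'m \<Rightarrow> 'm \<Rightarrow> 'b"

definition mnorm :: "('b::c_star_algebra, 'm, 'z) hilbert_mod_scheme \<Rightarrow> 'm \<Rightarrow> real" where
  "mnorm M x = sqrt (norm (ip M x x))"

locale hilbert_module = complex_space M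
  for M :: "('b::c_star_algebra, 'm, 'z) hilbert_mod_scheme" +
  assumes ract_closed: "x \<in> carrier M \<Longrightarrow> ract M x b \<in> carrier M"
    and ract_add_left: "x \<in> carrier M \<Longrightarrow> y \<in> carrier M \<Longrightarrow>
      ract M (vadd M x y) b = vadd M (ract M x b) (ract M y b)"
    and ract_add_right: "x \<in> carrier M \<Longrightarrow>
      ract M x (b + b') = vadd M (ract M x b) (ract M x b')"
    and ract_ract: "x \<in> carrier M \<Longrightarrow> ract M (ract M x b) b' = ract M x (b * b')"
    and ract_vscale: "x \<in> carrier M \<Longrightarrow> ract M (vscale M c x) b = vscale M c (ract M x b)"
    and ract_scaleC: "x \<in> carrier M \<Longrightarrow> ract M x (scaleC c b) = vscale M c (ract M x b)"
    and ip_add_right: "x \<in> carrier M \<Longrightarrow> y \<in> carrier M \<Longrightarrow> z \<in> carrier M \<Longrightarrow>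
      ip M x (vadd M y z) = ip M x y + ip M x z"
    and ip_vscale_right: "x \<in> carrier M \<Longrightarrow> y \<in> carrier M \<Longrightarrow>
      ip M x (vscale M c y) = scaleC c (ip M x y)"
    and ip_ract_right: "x \<in> carrier M \<Longrightarrow> y \<in> carrier M \<Longrightarrow>
      ip M x (ract M y b) = ip M x y * b"
    and star_ip: "x \<in> carrier M \<Longrightarrow> y \<in> carrier M \<Longrightarrow> star (ip M x y) = ip M y x"
    and ip_positive: "x \<in> carrier M \<Longrightarrow> positive (ip M x x)"
    and ip_definite: "x \<in> carrier M \<Longrightarrow> ip M x x = 0 \<Longrightarrow> x = vzero M"
    and complete: "\<forall>n::nat. s n \<in> carrier M \<Longrightarrow>
      \<forall>e>0. \<exists>N. \<forall>m\<ge>N. \<forall>n\<ge>N. mnorm M (vdiff M (s m) (s n)) < e \<Longrightarrow>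
      \<exists>x\<in>carrier M. (\<lambda>n. mnorm M (vdiff M (s n) x)) \<longlonglongrightarrow> 0"

definition full :: "('b::c_star_algebra, 'm, 'z) hilbert_mod_scheme \<Rightarrow> bool" where
  "full M \<longleftrightarrow>
    closure (complex_vector.span {ip M x y | x y. x \<in> carrier M \<and> y \<in> carrier M}) = UNIV"

section \<open>Adjointable and compact operators\<close>

text \<open>
  Operators on a module are extensional functions on its carrier, so that equality of functions
  is equality of operators.
\<close>

definition is_adjoint ::
  "('b::c_star_algebra, 'm, 'z) hilbert_mod_scheme \<Rightarrow> ('m \<Rightarrow> 'm) \<Rightarrow> ('m \<Rightarrow> 'm) \<Rightarrow> bool" where
  "is_adjoint M T S \<longleftrightarrow>
    T \<in> carrier M \<rightarrow>\<^sub>E carrier M \<and> S \<in> carrier M \<rightarrow>\<^sub>E carrier M \<and>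
    (\<forall>x\<in>carrier M. \<forall>y\<in>carrier M. ip M (T x) y = ip M x (S y))"

definition adjointable_ops ::
  "('b::c_star_algebra, 'm, 'z) hilbert_mod_scheme \<Rightarrow> ('m \<Rightarrow> 'm) cvec" where
  "adjointable_ops M =
    \<lparr>carrier = {T. \<exists>S. is_adjoint M T S},
     vzero = (\<lambda>x\<in>carrier M. vzero M),
     vadd = (\<lambda>S T. \<lambda>x\<in>carrier M. vadd M (S x) (T x)),
     vscale = (\<lambda>c T. \<lambda>x\<in>carrier M. vscale M c (T x))\<rparr>"

definition opnorm ::
  "('b::c_star_algebra, 'm, 'z) hilbert_mod_scheme \<Rightarrow> ('m \<Rightarrow> 'm) \<Rightarrow> real" where
  "opnorm M T = (SUP x\<in>{x \<in> carrier M. mnorm M x \<le> 1}. mnorm M (T x))"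

definition rank_one ::
  "('b::c_star_algebra, 'm, 'z) hilbert_mod_scheme \<Rightarrow> 'm \<Rightarrow> 'm \<Rightarrow> 'm \<Rightarrow> 'm" where
  "rank_one M x y = (\<lambda>z\<in>carrier M. ract M x (ip M y z))"

definition compact_ops ::
  "('b::c_star_algebra, 'm, 'z) hilbert_mod_scheme \<Rightarrow> ('m \<Rightarrow> 'm) set" where
  "compact_ops M = closed_vspan (adjointable_ops M) (opnorm M)
    {rank_one M x y | x y. x \<in> carrier M \<and> y \<in> carrier M}"

definition star_representation ::
  "('b::c_star_algebra, 'm, 'z) hilbert_mod_scheme \<Rightarrow>
    ('a::c_star_algebra \<Rightarrow> 'm \<Rightarrow> 'm) \<Rightarrow> bool" where
  "star_representation M \<phi> \<longleftrightarrow>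
    (\<forall>a. is_adjoint M (\<phi> a) (\<phi> (star a))) \<and>
    (\<forall>a a'. \<phi> (a + a') = vadd (adjointable_ops M) (\<phi> a) (\<phi> a')) \<and>
    (\<forall>c a. \<phi> (scaleC c a) = vscale (adjointable_ops M) c (\<phi> a)) \<and>
    (\<forall>a a'. \<phi> (a * a') = compose (carrier M) (\<phi> a) (\<phi> a'))"

section \<open>Correspondences\<close>

text \<open>An \<open>\<A>\<close>-\<open>\<B>\<close>-correspondence has type \<open>('a, 'b, 'm) corresp\<close>.\<close>

record ('a, 'b, 'm) corresp = "('b, 'm) hilbert_mod" +
  lact :: "'a \<Rightarrow> 'm \<Rightarrow> 'm"

definition left_mult :: "('a, 'b, 'm) corresp \<Rightarrow> 'a \<Rightarrow> 'm \<Rightarrow> 'm" where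
  "left_mult M a = (\<lambda>x\<in>carrier M. lact M a x)"

locale correspondence = hilbert_module M
  for M :: "('a::c_star_algebra, 'b::c_star_algebra, 'm) corresp" +
  assumes representation: "star_representation M (left_mult M)"
    and nondegenerate:
      "closed_vspan M (mnorm M) {lact M a x | a x. x \<in> carrier M} = carrier M"

definition left_action_iso_compacts ::
  "('a::c_star_algebra, 'b::c_star_algebra, 'm) corresp \<Rightarrow> bool" where
  "left_action_iso_compacts M \<longleftrightarrow>
    star_representation M (left_mult M) \<and> bij_betw (left_mult M) UNIV (compact_ops M)"

definition self_corresp :: "('b::c_star_algebra, 'b, 'b) corresp" where
  "self_corresp =
    \<lparr>carrier = UNIV, vzero = 0, vadd = (+), vscale = scaleC,
     ract = (*), ip = (\<lambda>b b'. star b * b'), lact = (*)\<rparr>"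

definition bilinear_unitary ::
  "('a::c_star_algebra, 'b::c_star_algebra, 'm) corresp \<Rightarrow> ('a, 'b, 'n) corresp \<Rightarrow>
    ('m \<Rightarrow> 'n) \<Rightarrow> bool" where
  "bilinear_unitary M N u \<longleftrightarrow>
    bij_betw u (carrier M) (carrier N) \<and>
    (\<forall>x\<in>carrier M. \<forall>y\<in>carrier M. u (vadd M x y) = vadd N (u x) (u y)) \<and>
    (\<forall>c. \<forall>x\<in>carrier M. u (vscale M c x) = vscale N c (u x)) \<and>
    (\<forall>x\<in>carrier M. \<forall>b. u (ract M x b) = ract N (u x) b) \<and>
    (\<forall>a. \<forall>x\<in>carrier M. u (lact M a x) = lact N a (u x)) \<and>
    (\<forall>x\<in>carrier M. \<forall>y\<in>carrier M. ip N (u x) (u y) = ip M x y)"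

definition corresp_iso ::
  "('a::c_star_algebra, 'b::c_star_algebra, 'm) corresp \<Rightarrow> ('a, 'b, 'n) corresp \<Rightarrow> bool"
  where "corresp_iso M N \<longleftrightarrow> (\<exists>u. bilinear_unitary M N u)"

section \<open>Interior tensor product\<close>

text \<open>
  A formal sum \<open>x\<^sub>1 \<odot> y\<^sub>1 + \<dots> + x\<^sub>n \<odot> y\<^sub>n\<close> of elementary tensors is the list of the pairs
  \<open>(x\<^sub>i, y\<^sub>i)\<close>; appending lists is addition, and scalars are absorbed into the first factor.
  The semi-inner product of formal sums is determined by
  \<open>\<langle>x \<odot> y, x' \<odot> y'\<rangle> = \<langle>y, \<langle>x, x'\<rangle>y'\<rangle>\<close>. The interior tensor product is the quotient by the vectors
  of length zero, completed. Both are done at once: its elements are the classes of Cauchy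
  sequences of formal sums whose difference tends to zero in seminorm. The relations of the
  algebraic tensor product (bilinearity, \<open>xb \<odot> y = x \<odot> by\<close>) hold in the quotient, because the
  corresponding differences have length zero.
\<close>

definition tensor_ip ::
  "('a, 'b::c_star_algebra, 'm) corresp \<Rightarrow> ('b, 'c::c_star_algebra, 'n) corresp \<Rightarrow>
    ('m \<times> 'n) list \<Rightarrow> ('m \<times> 'n) list \<Rightarrow> 'c" where
  "tensor_ip E F f g =
    (\<Sum>(x, y)\<leftarrow>f. \<Sum>(x', y')\<leftarrow>g. ip F y (lact F (ip E x x') y'))"

definition tensor_scale ::
  "('a, 'b, 'm) corresp \<Rightarrow> complex \<Rightarrow> ('m \<times> 'n) list \<Rightarrow> ('m \<times> 'n) list" where
  "tensor_scale E c f = map (\<lambda>(x, y). (vscale E c x, y)) f"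

definition tensor_dist ::
  "('a, 'b::c_star_algebra, 'm) corresp \<Rightarrow> ('b, 'c::c_star_algebra, 'n) corresp \<Rightarrow>
    ('m \<times> 'n) list \<Rightarrow> ('m \<times> 'n) list \<Rightarrow> real" where
  "tensor_dist E F f g =
    (let h = f @ tensor_scale E (- 1) g in sqrt (norm (tensor_ip E F h h)))"

definition tensor_cauchy ::
  "('a, 'b::c_star_algebra, 'm) corresp \<Rightarrow> ('b, 'c::c_star_algebra, 'n) corresp \<Rightarrow>
    (nat \<Rightarrow> ('m \<times> 'n) list) set" where
  "tensor_cauchy E F =
    {s. (\<forall>n. set (s n) \<subseteq> carrier E \<times> carrier F) \<and>
        (\<forall>e>0. \<exists>N. \<forall>m\<ge>N. \<forall>n\<ge>N. tensor_dist E F (s m) (s n) < e)}"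

definition tensor_rel ::
  "('a, 'b::c_star_algebra, 'm) corresp \<Rightarrow> ('b, 'c::c_star_algebra, 'n) corresp \<Rightarrow>
    ((nat \<Rightarrow> ('m \<times> 'n) list) \<times> (nat \<Rightarrow> ('m \<times> 'n) list)) set" where
  "tensor_rel E F =
    {(s, t). s \<in> tensor_cauchy E F \<and> t \<in> tensor_cauchy E F \<and>
      (\<lambda>n. tensor_dist E F (s n) (t n)) \<longlonglongrightarrow> 0}"

definition interior_tensor ::
  "('a::c_star_algebra, 'b::c_star_algebra, 'm) corresp \<Rightarrow>
    ('b, 'c::c_star_algebra, 'n) corresp \<Rightarrow>
    ('a, 'c, (nat \<Rightarrow> ('m \<times> 'n) list) set) corresp" (infixl "\<odot>" 70) where
  "E \<odot> F =
    \<lparr>carrier = tensor_cauchy E F // tensor_rel E F,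
     vzero = tensor_rel E F `` {\<lambda>n. []},
     vadd = (\<lambda>X Y. \<Union>s\<in>X. \<Union>t\<in>Y. tensor_rel E F `` {\<lambda>n. s n @ t n}),
     vscale = (\<lambda>c X. \<Union>s\<in>X. tensor_rel E F `` {\<lambda>n. tensor_scale E c (s n)}),
     ract = (\<lambda>X d. \<Union>s\<in>X. tensor_rel E F `` {\<lambda>n. map (\<lambda>(x, y). (x, ract F y d)) (s n)}),
     ip = (\<lambda>X Y. THE d. \<exists>s\<in>X. \<exists>t\<in>Y. (\<lambda>n. tensor_ip E F (s n) (t n)) \<longlonglongrightarrow> d),
     lact = (\<lambda>a X. \<Union>s\<in>X. tensor_rel E F `` {\<lambda>n. map (\<lambda>(x, y). (lact E a x, y)) (s n)})\<rparr>"

section \<open>Morita equivalences\<close>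

text \<open>
  HOL cannot quantify existentially over types, so the type in which the carrier of the inverse
  correspondence \<open>N\<close> lies is a parameter.
\<close>

definition morita_equivalence ::
  "'n itself \<Rightarrow> ('a::c_star_algebra, 'b::c_star_algebra, 'm) corresp \<Rightarrow> bool" where
  "morita_equivalence T M \<longleftrightarrow>
    correspondence M \<and>
    (\<exists>N :: ('b, 'a, 'n) corresp. correspondence N \<and>
      corresp_iso (N \<odot> M) self_corresp \<and> corresp_iso (M \<odot> N) self_corresp)"

end

theory Submission
  imports Defs
begin

text \<open>
  If \<open>M\<close> is full and \<open>\<A>\<close> acts as the compact operators, then the conjugate module \<open>M\<^sup>*\<close>, with
  \<open>\<langle>x\<^sup>*, y\<^sup>*\<rangle>\<close> the element of \<open>\<A>\<close> acting as \<open>xy\<^sup>*\<close>, is inverse to \<open>M\<close>: the unitaries are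
  \<open>x\<^sup>* \<odot> y \<mapsto> \<langle>x, y\<rangle>\<close> and \<open>x \<odot> y\<^sup>* \<mapsto> xy\<^sup>*\<close>.

  Conversely, a unitary of \<open>N \<odot> M\<close> onto \<open>\<B>\<close> is given by a pairing \<open>w\<close> with dense span and
  \<open>w(n, m)\<^sup>* w(n', m') = \<langle>m, \<langle>n, n'\<rangle>m'\<rangle>\<close>. Products are dense in a C*-algebra, so \<open>M\<close> is full, and
  likewise \<open>N\<close>. For \<open>b = w(n', m')\<^sup>*\<close> one gets \<open>w(bn, z) = b w(n, z) = \<langle>\<langle>n, n'\<rangle>m', z\<rangle>\<close>. Hence
  \<open>\<langle>b\<^sub>1n\<^sub>1, b\<^sub>2n\<^sub>2\<rangle>\<close> acts on \<open>M\<close> as a rank-one operator; such elements span \<open>\<A>\<close> densely, and these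
  rank-one operators span the compact ones densely. The action is injective, because \<open>M \<odot> N\<close> is
  \<open>\<A>\<close>, and therefore isometric.

  Positivity is handled without spectral theory, through the inequality \<open>\<parallel>t - b\<parallel> \<le> t\<close> in the
  unitization and the binomial series of the square root.
\<close>

section \<open>Positive elements of unital C*-algebras\<close>

text \<open>\<open>positive\<close> only asserts the form \<open>star c * c\<close>, so even closure
  under addition has to be proved, and it is needed early: Cauchy-Schwarz in a Hilbert module rests
  on it, and so does the positivity of \<open>tensor_ip\<close>, without which vectors of length
  zero could not be divided out. Roots such as that of \<open>t - b\<close> exist only once a unit
  is adjoined; positivity is therefore developed for unital algebras and pulled back along
  \<open>emb\<close>. A second obstacle is that \<open>opnorm\<close> is a supremum of reals, which
  says nothing about an operator not known to be bounded. Boundedness has to come out of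
  adjointability and completeness alone. Finally, lists of pairs obey the laws of a vector space
  only up to length zero. Identities are therefore checked on inner products, and a unitary from
  \<open>E \<odot> F\<close> onto the algebra is exchanged at once for a pairing on \<open>E\<close>
  and \<open>F\<close>, so that the proof works with elements of the modules and not with the
  completed quotient.\<close>

instance c_star_algebra \<subseteq> banach ..

class unital_c_star_algebra = c_star_algebra + real_normed_algebra_1

section \<open>Elementary properties of the involution\<close>

lemma star_zero [simp]: "star (0 :: 'a::c_star_algebra) = 0"
  using star_add[of 0 "0::'a"] by simp

lemma star_minus [simp]: "star (- x) = - star (x :: 'a::c_star_algebra)"
  using star_add[of x "- x"] by (simp add: add_eq_0_iff)

lemma star_diff: "star (x - y) = star x - star (y :: 'a::c_star_algebra)"
  using star_add[of x "- y"] by simp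

lemma star_scaleR: "star (r *\<^sub>R x) = r *\<^sub>R star (x :: 'a::c_star_algebra)"
  by (simp flip: scaleC_of_real add: star_scaleC)

declare star_star [simp]

lemma norm_star [simp]: "norm (star x) = norm (x :: 'a::c_star_algebra)"
proof -
  have le: "norm y \<le> norm (star y)" for y :: 'a
  proof (cases "y = 0")
    case False
    have "norm y * norm y \<le> norm (star y) * norm y"
      using c_star_identity[of y] norm_mult_ineq[of "star y" y] by (simp add: power2_eq_square)
    then show ?thesis using False by simp
  qed simp
  from le[of x] le[of "star x"] show ?thesis by simp
qed

lemma bounded_linear_star: "bounded_linear (star :: 'a::c_star_algebra \<Rightarrow> 'a)"
  by (rule bounded_linear_intro[of _ 1]) (simp_all add: star_add star_scaleR)

lemmas tendsto_star [tendsto_intros] = bounded_linear.tendsto[OF bounded_linear_star]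

lemma norm_mult_self: "star x = x \<Longrightarrow> norm (x * x) = (norm (x :: 'a::c_star_algebra))\<^sup>2"
  using c_star_identity[of x] by simp

lemma star_sum: "star (sum f A) = (\<Sum>i\<in>A. star (f i :: 'a::c_star_algebra))"
  by (rule linear_sum[OF bounded_linear.linear[OF bounded_linear_star]])

lemma star_one [simp]: "star (1 :: 'a::unital_c_star_algebra) = 1"
  by (metis mult.right_neutral star_mult star_star)

lemma star_of_real [simp]: "star (of_real r :: 'a::unital_c_star_algebra) = of_real r"
  by (simp add: of_real_def star_scaleR)

lemma star_power: "star (x ^ n) = star (x :: 'a::unital_c_star_algebra) ^ n"
  by (induction n) (simp_all add: star_mult power_commutes)

text \<open>The C*-identity controls squares of self-adjoint elements. Iterating it reaches only the
  exponents \<open>2 ^ n\<close>, which suffice for comparing growth rates.\<close>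

lemma norm_power_of_2:
  fixes x :: "'a::unital_c_star_algebra"
  assumes "star x = x"
  shows "norm (x ^ (2 ^ n)) = norm x ^ (2 ^ n)"
proof (induction n)
  case (Suc n)
  have "norm (x ^ (2 ^ n) * x ^ (2 ^ n)) = (norm (x ^ (2 ^ n)))\<^sup>2"
    by (rule norm_mult_self) (simp add: star_power assms)
  then show ?case using Suc
    by (simp add: power_add[symmetric] power_mult[symmetric] mult.commute mult_2)
qed simp

text \<open>This replaces the spectral radius formula: the powers of \<open>x\<close> grow at most like \<open>n t\<^sup>n\<close>.\<close>

lemma norm_le_if_slow_growth:
  fixes x :: "'a::unital_c_star_algebra"
  assumes sa: "star x = x" and t: "t > 0"
    and bound: "\<And>n. norm (x ^ n * (x - of_real t)) \<le> C * t ^ n"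
  shows "norm x \<le> t"
proof (rule ccontr)
  assume "\<not> norm x \<le> t"
  define q where "q = t / norm x"
  from \<open>\<not> norm x \<le> t\<close> t have x: "norm x > 0" and q: "norm q < 1" "q > 0"
    by (auto simp: q_def divide_simps)
  \<comment> \<open>By \<open>x ^ Suc n = x ^ n * (x - t) + t x ^ n\<close> the quotient
    \<open>norm (x ^ n) / t ^ n\<close> grows by at most \<open>C / t\<close> per step. The factor
    \<open>t\<close> on the left avoids the exponent \<open>n - 1\<close>.\<close>
  have pow: "t * norm (x ^ n) \<le> t ^ n * (t + real n * C)" for n
  proof (induction n)
    case (Suc n)
    have "norm (x ^ Suc n) \<le> norm (x ^ n * (x - of_real t)) + norm (t *\<^sub>R x ^ n)"
    proof -
      have "x ^ Suc n = x ^ n * (x - of_real t) + t *\<^sub>R x ^ n"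
        by (simp add: algebra_simps power_commutes of_real_def)
      then show ?thesis by (metis norm_triangle_ineq)
    qed
    also have "\<dots> \<le> C * t ^ n + t * norm (x ^ n)"
      using bound[of n] t by simp
    finally have "norm (x ^ Suc n) \<le> C * t ^ n + t ^ n * (t + real n * C)"
      using Suc by simp
    then have "t * norm (x ^ Suc n) \<le> t * (C * t ^ n + t ^ n * (t + real n * C))"
      using t by (intro mult_left_mono) auto
    then show ?case by (simp add: algebra_simps)
  qed (use t in simp)
  \<comment> \<open>Along the exponents \<open>2 ^ n\<close> the norm of the power is the power of
    the norm. Division by it bounds \<open>t\<close> by a sequence that tends to 0, because
    \<open>q < 1\<close>.\<close>
  have le: "t \<le> q ^ (2 ^ n) * t + real (2 ^ n) * q ^ (2 ^ n) * C" for n :: nat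
  proof -
    have "t * norm x ^ (2 ^ n) \<le> t ^ (2 ^ n) * (t + real (2 ^ n) * C)"
      using pow[of "2 ^ n"] norm_power_of_2[OF sa, of n] by simp
    then have "t \<le> t ^ (2 ^ n) * (t + real (2 ^ n) * C) / norm x ^ (2 ^ n)"
      using x by (simp add: pos_le_divide_eq)
    then show ?thesis by (simp add: q_def power_divide algebra_simps add_divide_distrib)
  qed
  have sub: "strict_mono (\<lambda>n. 2 ^ n :: nat)" by (simp add: strict_mono_def)
  have "(\<lambda>n. q ^ n * t + real n * q ^ n * C) \<longlonglongrightarrow> 0 * t + 0 * C"
    using q by (intro tendsto_intros LIMSEQ_power_zero powser_times_n_limit_0) auto
  from LIMSEQ_subseq_LIMSEQ[OF this sub]
  have "(\<lambda>n. q ^ (2 ^ n) * t + real (2 ^ n) * q ^ (2 ^ n) * C) \<longlonglongrightarrow> 0"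
    by (simp add: o_def)
  from LIMSEQ_le_const[OF this] le have "t \<le> 0" by blast
  with t show False by simp
qed

subsection \<open>The binomial series of the square root\<close>

text \<open>The Taylor coefficients of \<open>sqrt (1 - x)\<close> at 0.\<close>

definition sqrt_coeff :: "nat \<Rightarrow> real" where
  "sqrt_coeff k = ((1 / 2) gchoose k) * (- 1) ^ k"

lemma sqrt_coeff_0 [simp]: "sqrt_coeff 0 = 1"
  by (simp add: sqrt_coeff_def)

lemma sqrt_coeff_Suc_nonpos: "sqrt_coeff (Suc k) \<le> 0"
proof -
  have "sqrt_coeff (Suc k) = pochhammer (- 1 / 2) (Suc k) / fact (Suc k)"
    by (simp add: sqrt_coeff_def gbinomial_pochhammer flip: power_mult_distrib)
  also have "pochhammer (- 1 / 2 :: real) (Suc k) = - 1 / 2 * pochhammer (1 / 2) k"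
    by (simp add: pochhammer_rec)
  finally show ?thesis
    using pochhammer_nonneg[of "1 / 2 :: real" k] by (simp add: divide_nonpos_pos)
qed

text \<open>The partial sums have the closed form \<open>(- 1) ^ m * (- 1 / 2 gchoose m)\<close>,
  which is non-negative. All coefficients after the leading 1 are non-positive, so their absolute
  values add up to at most 1, and the series converges absolutely even on the boundary
  \<open>norm h = 1\<close>.\<close>

lemma sum_abs_sqrt_coeff_le: "(\<Sum>k<m. \<bar>sqrt_coeff (Suc k)\<bar>) \<le> 1"
proof -
  have "(\<Sum>k\<le>m. sqrt_coeff k) = (- 1) ^ m * (- 1 / 2 gchoose m)"
    unfolding sqrt_coeff_def by (subst gbinomial_sum_lower_neg) simp
  also have "\<dots> = pochhammer (1 / 2) m / fact m"
    by (simp add: gbinomial_pochhammer flip: power_mult_distrib)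
  finally have "(\<Sum>k\<le>m. sqrt_coeff k) \<ge> 0"
    using pochhammer_nonneg[of "1 / 2 :: real" m] by simp
  moreover have "(\<Sum>k\<le>m. sqrt_coeff k) = 1 + (\<Sum>k<m. sqrt_coeff (Suc k))"
    by (simp add: sum.lessThan_Suc_shift lessThan_Suc_atMost[symmetric] del: sum.lessThan_Suc)
  moreover have "(\<Sum>k<m. \<bar>sqrt_coeff (Suc k)\<bar>) = - (\<Sum>k<m. sqrt_coeff (Suc k))"
    by (simp add: abs_of_nonpos sqrt_coeff_Suc_nonpos sum_negf)
  ultimately show ?thesis by simp
qed

lemma summable_abs_sqrt_coeff_Suc: "summable (\<lambda>k. \<bar>sqrt_coeff (Suc k)\<bar>)"
  by (rule summableI_nonneg_bounded[OF _ sum_abs_sqrt_coeff_le]) simp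

text \<open>The square of the series of \<open>sqrt (1 - x)\<close> is \<open>1 - x\<close>,
  coefficient by coefficient; this is Vandermonde's identity.\<close>

lemma sqrt_coeff_convolution:
  "(\<Sum>i\<le>n. sqrt_coeff i * sqrt_coeff (n - i)) = (if n = 0 then 1 else if n = 1 then - 1 else 0)"
proof -
  have "(\<Sum>i\<le>n. sqrt_coeff i * sqrt_coeff (n - i)) =
      (\<Sum>i\<in>{0..n}. (1 / 2 gchoose i) * (1 / 2 gchoose (n - i))) * (- 1) ^ n"
    unfolding sqrt_coeff_def sum_distrib_right atMost_atLeast0
    by (intro sum.cong) (auto simp flip: power_add)
  also have "\<dots> = (1 gchoose n) * (- 1) ^ n"
    by (subst gbinomial_Vandermonde) simp
  also have "(1 gchoose n :: real) = of_nat (1 choose n)"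
    by (metis binomial_gbinomial of_nat_1)
  finally show ?thesis by (auto simp: binomial_eq_0)
qed

text \<open>The last two conclusions stand in for functional calculus:
  \<open>norm (1 - r) \<le> 1\<close> makes the root non-negative, and the root commutes with
  everything that commutes with \<open>h\<close>.\<close>

lemma sqrt_one_minus:
  fixes h :: "'a::unital_c_star_algebra"
  assumes sa: "star h = h" and h: "norm h \<le> 1"
  obtains r where "star r = r" "r * r = 1 - h" "norm (1 - r) \<le> 1"
    "\<And>x. x * h = h * x \<Longrightarrow> x * r = r * x"
proof -
  define a where "a k = sqrt_coeff k *\<^sub>R h ^ k" for k
  have hk: "norm (h ^ k) \<le> 1" for k
    using norm_power_ineq[of h k] power_le_one[OF norm_ge_zero h, of k] by linarith
  have na: "norm (a k) \<le> \<bar>sqrt_coeff k\<bar>" for k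
    using mult_left_mono[OF hk[of k], of "\<bar>sqrt_coeff k\<bar>"] by (simp add: a_def)
  have sn: "summable (\<lambda>k. norm (a (Suc k)))"
    by (rule summable_comparison_test'[OF summable_abs_sqrt_coeff_Suc, of 0]) (simp add: na)
  then have sna: "summable (\<lambda>k. norm (a k))" using summable_Suc_iff[of "\<lambda>k. norm (a k)"] by simp
  then have sa': "summable a" by (rule summable_norm_cancel)
  define r where "r = suminf a"
  have r1: "1 - r = - (\<Sum>k. a (Suc k))"
    using suminf_split_head[OF sa'] by (simp add: r_def a_def)
  have "norm (1 - r) \<le> (\<Sum>k. norm (a (Suc k)))"
    unfolding r1 norm_minus_cancel by (rule summable_norm[OF sn])
  also have "\<dots> \<le> 1"
  proof (rule suminf_le_const[OF sn])
    fix n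
    have "(\<Sum>k<n. norm (a (Suc k))) \<le> (\<Sum>k<n. \<bar>sqrt_coeff (Suc k)\<bar>)"
      by (intro sum_mono na)
    with sum_abs_sqrt_coeff_le[of n] show "(\<Sum>k<n. norm (a (Suc k))) \<le> 1" by simp
  qed
  finally have n1: "norm (1 - r) \<le> 1" .
  have conv: "(\<Sum>i\<le>k. a i * a (k - i)) = (if k = 0 then 1 else if k = 1 then - h else 0)" for k
  proof -
    have "(\<Sum>i\<le>k. a i * a (k - i)) = (\<Sum>i\<le>k. sqrt_coeff i * sqrt_coeff (k - i)) *\<^sub>R h ^ k"
      unfolding a_def scaleR_left.sum by (intro sum.cong) (auto simp flip: power_add)
    then show ?thesis by (auto simp: sqrt_coeff_convolution)
  qed
  have "(\<lambda>k. \<Sum>i\<le>k. a i * a (k - i)) sums (r * r)"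
    unfolding r_def by (rule Cauchy_product_sums[OF sna sna])
  moreover have "(\<lambda>k. \<Sum>i\<le>k. a i * a (k - i)) sums (\<Sum>k\<in>{0, 1 :: nat}. if k = 0 then 1 else if k = 1 then - h else 0)"
    unfolding conv by (rule sums_finite) auto
  ultimately have "r * r = (\<Sum>k\<in>{0, 1 :: nat}. if k = 0 then 1 else if k = 1 then - h else 0)"
    by (rule sums_unique2)
  then have rr: "r * r = 1 - h" by simp
  have "star r = r"
  proof -
    have "(\<lambda>k. star (a k)) sums star r"
      unfolding r_def by (rule bounded_linear.sums[OF bounded_linear_star summable_sums[OF sa']])
    moreover have "star (a k) = a k" for k
      by (simp add: a_def star_scaleR star_power sa)
    ultimately have "a sums star r" by simp
    then show ?thesis unfolding r_def by (simp add: sums_iff)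
  qed
  moreover have "x * r = r * x" if "x * h = h * x" for x
  proof -
    have "x * h ^ k = h ^ k * x" for k
      using power_commuting_commutes[of h x k] that by simp
    then have "x * a k = a k * x" for k by (simp add: a_def)
    then have "(\<Sum>k. x * a k) = (\<Sum>k. a k * x)" by (simp only:)
    then show ?thesis
      by (simp only: r_def suminf_mult[OF sa'] suminf_mult2[OF sa'])
  qed
  ultimately show ?thesis using that rr n1 by blast
qed

subsection \<open>Non-negative elements\<close>

text \<open>
  Positivity of the spectrum of a self-adjoint \<open>b\<close> is expressed by the norm: it means
  \<open>\<parallel>t - b\<parallel> \<le> t\<close> for large \<open>t\<close>.
\<close>

definition nonneg :: "'a::unital_c_star_algebra \<Rightarrow> bool" where
  "nonneg b \<longleftrightarrow> star b = b \<and> (\<exists>t. norm (of_real t - b) \<le> t)"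

lemma nonnegI: "star b = b \<Longrightarrow> norm (of_real t - b) \<le> t \<Longrightarrow> nonneg b"
  by (auto simp: nonneg_def)

lemma norm_of_real_diff_mono:
  fixes b :: "'a::unital_c_star_algebra"
  assumes "norm (of_real t - b) \<le> t" "t \<le> s"
  shows "norm (of_real s - b) \<le> s"
proof -
  have "norm (of_real (s - t) + (of_real t - b)) \<le> (s - t) + t"
    using assms by (intro norm_triangle_le) (simp del: of_real_diff)
  then show ?thesis by simp
qed

lemma nonneg_obtain_bound:
  assumes "nonneg b"
  obtains t where "t > 0" "norm (of_real t - b) \<le> t"
proof -
  from assms obtain t where t: "norm (of_real t - b) \<le> t" by (auto simp: nonneg_def)
  with norm_ge_zero[of "of_real t - b"] have "t \<ge> 0" by linarith
  with norm_of_real_diff_mono[OF t, of "t + 1"] that[of "t + 1"] show ?thesis by auto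
qed

lemma nonnegD: "nonneg b \<Longrightarrow> star b = b"
  by (simp add: nonneg_def)

lemma nonneg_of_real [simp]: "t \<ge> 0 \<Longrightarrow> nonneg (of_real t)"
  by (auto simp: nonneg_def intro!: exI[of _ t])

lemma nonneg_zero [simp]: "nonneg 0"
  using nonneg_of_real[of 0] by simp

lemma nonneg_add:
  assumes "nonneg b" "nonneg c"
  shows "nonneg (b + c)"
proof -
  obtain s t where "norm (of_real t - b) \<le> t" "norm (of_real s - c) \<le> s"
    using assms by (auto simp: nonneg_def)
  then have "norm ((of_real t - b) + (of_real s - c)) \<le> t + s"
    by (intro norm_triangle_le) simp
  then have "norm (of_real (t + s) - (b + c)) \<le> t + s"
    by (simp add: algebra_simps)
  then show ?thesis
    by (rule nonnegI[rotated]) (use assms in \<open>simp add: star_add nonneg_def\<close>)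
qed

lemma nonneg_scaleR:
  assumes "nonneg b" "r \<ge> 0"
  shows "nonneg (r *\<^sub>R b)"
proof -
  obtain t where "norm (of_real t - b) \<le> t" using assms by (auto simp: nonneg_def)
  then have "norm (r *\<^sub>R (of_real t - b)) \<le> r * t"
    using assms(2) by (simp add: mult_left_mono)
  then have "norm (of_real (r * t) - r *\<^sub>R b) \<le> r * t"
    by (simp add: algebra_simps of_real_def)
  then show ?thesis
    by (rule nonnegI[rotated]) (use assms in \<open>simp add: star_scaleR nonneg_def\<close>)
qed

lemma nonneg_of_real_diff:
  fixes b :: "'a::unital_c_star_algebra"
  assumes "star b = b" "norm b \<le> t"
  shows "nonneg (of_real t - b)"
  using assms by (auto simp: nonneg_def star_diff intro!: exI[of _ t])

text \<open>The bound \<open>norm (t - b) \<le> t\<close> says that \<open>b = t (1 - h)\<close>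
  with \<open>norm h \<le> 1\<close>, so \<open>sqrt t\<close> times the binomial series at
  \<open>h\<close> is a root.\<close>

lemma nonneg_sqrt:
  fixes b :: "'a::unital_c_star_algebra"
  assumes "nonneg b"
  obtains r where "nonneg r" "r * r = b" "\<And>x. x * b = b * x \<Longrightarrow> x * r = r * x"
proof -
  obtain t where t: "t > 0" "norm (of_real t - b) \<le> t"
    using nonneg_obtain_bound[OF assms] .
  define h where "h = 1 - inverse t *\<^sub>R b"
  have "h = inverse t *\<^sub>R (of_real t - b)"
    using t by (simp add: h_def of_real_def scaleR_right_diff_distrib)
  then have "norm h = norm (of_real t - b) / t"
    using t by (simp add: divide_inverse mult.commute)
  then have nh: "norm h \<le> 1" using t by simp
  have sh: "star h = h" using nonnegD[OF assms] by (simp add: h_def star_diff star_scaleR)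
  from sqrt_one_minus[OF sh nh] obtain r where r: "star r = r" "r * r = 1 - h" "norm (1 - r) \<le> 1"
      "\<And>x. x * h = h * x \<Longrightarrow> x * r = r * x" by blast
  show ?thesis
  proof
    have "norm (of_real (sqrt t) - sqrt t *\<^sub>R r) = sqrt t * norm (1 - r)"
      using t by (simp add: of_real_def flip: scaleR_right_diff_distrib)
    also have "\<dots> \<le> sqrt t" using r(3) t by (simp add: mult_left_le)
    finally show "nonneg (sqrt t *\<^sub>R r)"
      using r(1) by (auto simp: nonneg_def star_scaleR)
    show "(sqrt t *\<^sub>R r) * (sqrt t *\<^sub>R r) = b"
      using r(2) t by (simp add: h_def field_simps flip: mult.assoc)
    show "x * (sqrt t *\<^sub>R r) = sqrt t *\<^sub>R r * x" if "x * b = b * x" for x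
      using r(4)[of x] that by (simp add: h_def algebra_simps)
  qed
qed

text \<open>
  For \<open>\<parallel>h\<parallel> \<le> 1\<close> the element \<open>u = h + i \<surd>(1 - h\<^sup>2)\<close> is unitary, and \<open>2h\<^sup>2 - 1\<close> is the real
  part of its square.
\<close>

lemma norm_one_minus_square:
  fixes h :: "'a::unital_c_star_algebra"
  assumes sh: "star h = h" and nh: "norm h \<le> 1"
  shows "norm (1 - 2 *\<^sub>R (h * h)) \<le> 1"
proof -
  have "norm (h * h) \<le> 1"
    using nh by (simp add: norm_mult_self[OF sh] power_le_one)
  from sqrt_one_minus[OF _ this] obtain k
    where k: "star k = k" "k * k = 1 - h * h" and comm: "\<And>x. x * (h * h) = h * h * x \<Longrightarrow> x * k = k * x"
    using sh star_mult by metis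
  have hk: "h * k = k * h" by (rule comm) (simp add: mult.assoc)
  define u where "u = h + scaleC \<i> k"
  have su: "star u = h - scaleC \<i> k"
    by (simp add: u_def star_add star_scaleC sh k complex_vector.scale_minus_left)
  have ik: "scaleC \<i> k * scaleC \<i> k = h * h - 1"
    by (simp add: mult_scaleC_left mult_scaleC_right scaleC_scaleC k complex_vector.scale_minus_left)
  have hik: "h * scaleC \<i> k = scaleC \<i> k * h"
    by (simp add: mult_scaleC_left mult_scaleC_right hk)
  have "star u * u = 1"
    by (simp add: su) (simp add: u_def algebra_simps ik hik)
  then have "(norm u)\<^sup>2 = 1"
    using c_star_identity[of u] by simp
  then have nu: "norm u = 1" using norm_ge_zero[of u] by (simp add: power2_eq_1_iff del: norm_ge_zero)
  have "norm (u * u + star u * star u) \<le> 1 + 1"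
    using norm_mult_ineq[of u u] norm_mult_ineq[of "star u" "star u"] nu
    by (intro norm_triangle_le add_mono) auto
  moreover have "u * u + star u * star u = - (2 *\<^sub>R (1 - 2 *\<^sub>R (h * h)))"
    by (simp add: su) (simp add: u_def algebra_simps ik hik scaleR_2)
  ultimately show ?thesis by (simp only: norm_minus_cancel norm_scaleR)
qed

text \<open>The spectrum of \<open>h * h\<close> lies in the interval from 0 to
  \<open>(norm h)\<^sup>2\<close>, whose centre and radius are both
  \<open>(norm h)\<^sup>2 / 2\<close>. For norm one this is half of
  \<open>norm_one_minus_square\<close>.\<close>

lemma norm_half_minus_square:
  fixes h :: "'a::unital_c_star_algebra"
  assumes sh: "star h = h"
  shows "norm (of_real ((norm h)\<^sup>2 / 2) - h * h) \<le> (norm h)\<^sup>2 / 2"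
proof (cases "h = 0")
  case False
  define n where "n = norm h"
  have n: "n > 0" using False by (simp add: n_def)
  have "norm (1 - 2 *\<^sub>R (inverse n *\<^sub>R h * inverse n *\<^sub>R h)) \<le> 1"
    by (rule norm_one_minus_square) (use n in \<open>simp_all add: star_scaleR sh n_def\<close>)
  then have "(n\<^sup>2 / 2) * norm (1 - 2 *\<^sub>R (inverse n *\<^sub>R h * inverse n *\<^sub>R h)) \<le> n\<^sup>2 / 2"
    by (simp add: mult_left_le)
  also have "(n\<^sup>2 / 2) * norm (1 - 2 *\<^sub>R (inverse n *\<^sub>R h * inverse n *\<^sub>R h)) =
      norm ((n\<^sup>2 / 2) *\<^sub>R (1 - 2 *\<^sub>R (inverse n *\<^sub>R h * inverse n *\<^sub>R h)))"
    by simp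
  also have "(n\<^sup>2 / 2) *\<^sub>R (1 - 2 *\<^sub>R (inverse n *\<^sub>R h * inverse n *\<^sub>R h)) = of_real (n\<^sup>2 / 2) - h * h"
    using n by (simp add: scaleR_right_diff_distrib of_real_def power2_eq_square field_simps)
  finally show ?thesis by (simp add: n_def)
qed simp

lemma nonneg_square: "star h = h \<Longrightarrow> nonneg (h * h)"
  using nonnegI[OF _ norm_half_minus_square[of h]] by (simp add: star_mult)

text \<open>The unspecified \<open>t\<close> of \<open>nonneg\<close> can always be
  \<open>norm b / 2\<close>, since \<open>b\<close> is the square of its root. Antisymmetry and
  closedness under limits need such a controlled value.\<close>

lemma nonneg_norm_half:
  assumes "nonneg b"
  shows "norm (of_real (norm b / 2) - b) \<le> norm b / 2"
proof -
  from nonneg_sqrt[OF assms] obtain r where "nonneg r" "r * r = b" by blast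
  with norm_half_minus_square[of r] norm_mult_self[of r] nonnegD[of r] show ?thesis by simp
qed

lemma nonneg_norm_diff_le: "nonneg b \<Longrightarrow> norm b / 2 \<le> t \<Longrightarrow> norm (of_real t - b) \<le> t"
  using norm_of_real_diff_mono[OF nonneg_norm_half] .

lemma nonneg_antisym:
  assumes "nonneg b" "nonneg (- b)"
  shows "b = 0"
proof -
  have 1: "norm (of_real (norm b / 2) - b) \<le> norm b / 2"
    and 2: "norm (of_real (norm b / 2) - - b) \<le> norm b / 2"
    using nonneg_norm_half[OF assms(1)] nonneg_norm_half[OF assms(2)] by simp_all
  \<comment> \<open>Subtracting \<open>norm b / 2 - b\<close> from \<open>norm b / 2 + b\<close>
    leaves \<open>2 b\<close>, so \<open>2 * norm b \<le> norm b\<close>.\<close>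
  have "2 * norm b = norm ((of_real (norm b / 2) - - b) - (of_real (norm b / 2) - b))"
    by (simp flip: scaleR_2)
  also have "\<dots> \<le> norm b / 2 + norm b / 2"
    using norm_triangle_le_diff[OF add_mono[OF 2 1]] .
  finally show ?thesis by simp
qed

text \<open>\<open>nonneg_norm_diff_le\<close> is applied twice at \<open>s\<close>, first to
  \<open>p\<close> and then to \<open>s - p\<close>, which gives \<open>norm p \<le> s\<close>. The
  maximum in \<open>s\<close> allows the first application; if it equals \<open>norm p / 2\<close>,
  then \<open>p\<close> is zero.\<close>

lemma norm_le_if_nonneg:
  assumes p: "nonneg p" and tp: "nonneg (of_real t - p)" and t: "t \<ge> 0"
  shows "norm p \<le> t"
proof -
  define s where "s = max t (norm p / 2)"
  have s: "t \<le> s" "norm p / 2 \<le> s" by (auto simp: s_def)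
  have "nonneg (of_real (s - t) + (of_real t - p))"
    using s by (intro nonneg_add tp nonneg_of_real) simp
  then have q: "nonneg (of_real s - p)" by simp
  have "norm (of_real s - p) \<le> s" by (rule nonneg_norm_diff_le[OF p s(2)])
  moreover from this norm_ge_zero[of "of_real s - p"] have "s \<ge> 0" by linarith
  ultimately have "norm (of_real s - (of_real s - p)) \<le> s"
    by (intro nonneg_norm_diff_le[OF q]) simp
  then show ?thesis using t by (auto simp: s_def max_def split: if_splits)
qed

lemma nonneg_norm_mono:
  assumes "nonneg p" "nonneg (q - p)"
  shows "norm p \<le> norm q"
proof -
  have "nonneg (p + (q - p))" by (rule nonneg_add[OF assms])
  then have "star q = q" using nonnegD by fastforce
  then have "nonneg (of_real (norm q) - q)" by (rule nonneg_of_real_diff) simp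
  from nonneg_add[OF this assms(2)] show ?thesis
    by (intro norm_le_if_nonneg assms) simp_all
qed

lemma nonneg_limit:
  fixes b :: "'a::unital_c_star_algebra"
  assumes "\<And>n. nonneg (X n)" "X \<longlonglongrightarrow> b"
  shows "nonneg b"
proof -
  from assms(2) have "Bseq X" by (intro convergent_imp_Bseq) (auto simp: convergent_def)
  then obtain T where T: "\<And>n. norm (X n) \<le> T" by (auto simp: Bseq_def)
  have "norm (of_real T - X n) \<le> T" for n
    using nonneg_norm_diff_le[OF assms(1)[of n], of T] T[of n] norm_ge_zero[of "X n"] by simp
  moreover have "(\<lambda>n. norm (of_real T - X n)) \<longlonglongrightarrow> norm (of_real T - b)"
    by (intro tendsto_intros assms)
  ultimately have "norm (of_real T - b) \<le> T" by (intro LIMSEQ_le_const2) auto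
  moreover have "star b = b"
    using tendsto_star[OF assms(2)] nonnegD[OF assms(1)] assms(2) LIMSEQ_unique by auto
  ultimately show ?thesis by (auto simp: nonneg_def)
qed

text \<open>The powers of \<open>t - x\<close> and of \<open>t - (x + y)\<close> agree after
  multiplication by \<open>x\<close>, because \<open>x\<close> annihilates \<open>y\<close>. Hence
  \<open>f ^ n * (f - t)\<close> equals \<open>- w ^ n * x\<close>, of norm at most
  \<open>norm x * t ^ n\<close>, and \<open>norm_le_if_slow_growth\<close> applies to
  \<open>f\<close>.\<close>

lemma nonneg_if_orthogonal:
  fixes x y :: "'a::unital_c_star_algebra"
  assumes sx: "star x = x" and xy: "x * y = 0" "y * x = 0" and "nonneg (x + y)"
  shows "nonneg x"
proof -
  obtain t where t: "t > 0" "norm (of_real t - (x + y)) \<le> t"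
    using nonneg_obtain_bound[OF assms(4)] .
  define f where "f = of_real t - x"
  define w where "w = of_real t - (x + y)"
  have comm: "w * x = x * w" and fx: "f * x = w * x"
    by (simp_all add: f_def w_def algebra_simps xy of_real_def)
  have pow: "f ^ n * x = w ^ n * x" for n
  proof (induction n)
    case (Suc n)
    have "f ^ Suc n * x = f * (w ^ n * x)" using Suc by (simp add: mult.assoc)
    also have "w ^ n * x = x * w ^ n" by (rule power_commuting_commutes[OF comm])
    also have "f * (x * w ^ n) = w * (x * w ^ n)" by (simp add: fx flip: mult.assoc)
    also have "\<dots> = w ^ Suc n * x" by (simp add: power_commuting_commutes[OF comm] mult.assoc)
    finally show ?case .
  qed simp
  have "norm f \<le> t"
  proof (rule norm_le_if_slow_growth[OF _ t(1)])
    show "star f = f" by (simp add: f_def star_diff sx)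
    show "norm (f ^ n * (f - of_real t)) \<le> norm x * t ^ n" for n
    proof -
      have "f ^ n * (f - of_real t) = - (w ^ n * x)" using pow by (simp add: f_def)
      then have "norm (f ^ n * (f - of_real t)) \<le> norm w ^ n * norm x"
        using norm_mult_ineq[of "w ^ n" x] mult_right_mono[OF norm_power_ineq[of w n] norm_ge_zero[of x]]
        by simp
      also have "\<dots> \<le> t ^ n * norm x"
        using t(2) by (intro mult_right_mono power_mono) (simp_all add: w_def)
      finally show ?thesis by (simp add: mult.commute)
    qed
  qed
  then show ?thesis using sx by (auto simp: nonneg_def f_def)
qed

text \<open>The Jordan decomposition, with \<open>m\<close> the modulus of \<open>b\<close>: the
  parts are orthogonal because \<open>m\<close> commutes with \<open>b\<close> and has the same
  square. The modulus is part of the conclusion because its square shows, in the unitization, that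
  the parts of an element of the original algebra stay there.\<close>

lemma pos_neg_parts:
  fixes b :: "'a::unital_c_star_algebra"
  assumes sb: "star b = b"
  obtains m p q where "nonneg m" "m * m = b * b" "p = (1/2) *\<^sub>R (m + b)" "q = (1/2) *\<^sub>R (m - b)"
    "nonneg p" "nonneg q" "b = p - q" "p * q = 0" "q * p = 0"
proof -
  from nonneg_sqrt[OF nonneg_square[OF sb]] obtain m
    where m: "nonneg m" "m * m = b * b" and "\<And>x. x * (b * b) = b * b * x \<Longrightarrow> x * m = m * x" by blast
  then have comm: "b * m = m * b" by (simp add: mult.assoc)
  define p where "p = (1/2) *\<^sub>R (m + b)"
  define q where "q = (1/2) *\<^sub>R (m - b)"
  have ortho: "p * q = 0" "q * p = 0"
    by (simp_all add: p_def q_def algebra_simps m comm)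
  have "p + q = m" "b = p - q"
    by (simp_all add: p_def q_def flip: scaleR_add_right scaleR_diff_right scaleR_2)
  moreover have "star p = p" "star q = q"
    by (simp_all add: p_def q_def star_scaleR star_add star_diff sb nonnegD[OF m(1)])
  ultimately have "nonneg p" "nonneg q"
    using nonneg_if_orthogonal[of p q] nonneg_if_orthogonal[of q p] ortho m(1)
    by (simp_all add: add.commute)
  with that[OF m p_def q_def] ortho \<open>b = p - q\<close> show ?thesis by blast
qed

lemma nonneg_cube:
  assumes "nonneg q"
  obtains s where "star s = s" "s * s = q * q * q"
proof -
  from nonneg_sqrt[OF assms] obtain r where r: "nonneg r" "r * r = q" by blast
  show ?thesis
  proof
    show "star (r * r * r) = r * r * r"
      using nonnegD[OF r(1)] by (simp add: star_mult mult.assoc)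
    show "r * r * r * (r * r * r) = q * q * q"
      by (simp add: mult.assoc flip: r(2))
  qed
qed

lemma cube_eq_zero:
  fixes q :: "'a::unital_c_star_algebra"
  assumes "star q = q" "q * q * q = 0"
  shows "q = 0"
proof -
  have "norm ((q * q) * (q * q)) = (norm (q * q))\<^sup>2"
    by (rule norm_mult_self) (simp add: star_mult assms)
  also have "(q * q) * (q * q) = 0" using assms(2) by (simp flip: mult.assoc)
  finally have "norm (q * q) = 0" by simp
  then show ?thesis using norm_mult_self[OF assms(1)] by simp
qed

text \<open>
  The theorem of Kelley and Vaught: with \<open>c\<^sup>*c = p - q\<close> and \<open>d = cq\<close> one has \<open>d\<^sup>*d = - q\<^sup>3\<close>, while
  \<open>dd\<^sup>* + d\<^sup>*d\<close> is a sum of squares; \<open>d\<^sup>*(t - dd\<^sup>*)\<^sup>nd = (t - d\<^sup>*d)\<^sup>nd\<^sup>*d\<close> moves positivity from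
  \<open>dd\<^sup>*\<close> to \<open>d\<^sup>*d\<close>.
\<close>

lemma nonneg_star_mult_self:
  fixes c :: "'a::unital_c_star_algebra"
  shows "nonneg (star c * c)"
proof -
  have sb: "star (star c * c) = star c * c" by (simp add: star_mult)
  obtain p q where pq: "nonneg p" "nonneg q" "star c * c = p - q" "p * q = 0" "q * p = 0"
    using pos_neg_parts[OF sb] by metis
  define d where "d = c * q"
  have sq: "star q = q" by (rule nonnegD[OF pq(2)])
  have "star d * d = q * (star c * c) * q" by (simp add: d_def star_mult sq mult.assoc)
  then have dd: "star d * d = - (q * q * q)" by (simp add: pq algebra_simps)
  define x where "x = d + star d"
  define y where "y = scaleC \<i> (d - star d)"
  have "y * y = - ((d - star d) * (d - star d))"
    by (simp add: y_def mult_scaleC_left mult_scaleC_right scaleC_scaleC complex_vector.scale_minus_left)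
  then have "x * x + y * y = 2 *\<^sub>R (d * star d) + 2 *\<^sub>R (star d * d)"
    by (simp add: x_def algebra_simps scaleR_2)
  then have "d * star d = (1/2) *\<^sub>R (x * x + y * y) + q * q * q"
    by (simp add: dd scaleR_right_diff_distrib)
  moreover have "nonneg (x * x)" "nonneg (y * y)"
    by (rule nonneg_square; simp add: x_def y_def star_add star_diff star_scaleC
        complex_vector.scale_minus_left complex_vector.scale_right_diff_distrib add.commute)+
  moreover have "nonneg (q * q * q)"
    using nonneg_cube[OF pq(2)] nonneg_square by metis
  ultimately have "nonneg (d * star d)"
    by (metis nonneg_add nonneg_scaleR half_gt_zero_iff less_eq_real_def zero_less_one)
  then obtain t where t: "t > 0" "norm (of_real t - d * star d) \<le> t"
    using nonneg_obtain_bound by blast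
  define w where "w = of_real t - d * star d"
  define z where "z = of_real t - star d * d"
  have move: "star d * w ^ n * d = z ^ n * (star d * d)" for n
  proof (induction n)
    case (Suc n)
    have "star d * w = z * star d" by (simp add: w_def z_def algebra_simps of_real_def)
    then have "star d * w ^ Suc n * d = z * (star d * w ^ n * d)" by (simp flip: mult.assoc)
    then show ?case using Suc by (simp add: mult.assoc)
  qed simp
  have "norm z \<le> t"
  proof (rule norm_le_if_slow_growth[OF _ t(1)])
    show "star z = z" by (simp add: z_def star_diff star_mult)
    show "norm (z ^ n * (z - of_real t)) \<le> (norm d)\<^sup>2 * t ^ n" for n
    proof -
      have "norm (z ^ n * (z - of_real t)) = norm (star d * w ^ n * d)"
        by (simp add: move z_def)
      also have "\<dots> \<le> norm (star d) * norm (w ^ n) * norm d"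
        by (meson norm_mult_ineq order_trans mult_right_mono norm_ge_zero)
      also have "\<dots> \<le> norm d * t ^ n * norm d"
        using t(2) norm_power_ineq[of w n] power_mono[of "norm w" t n]
        by (intro mult_right_mono mult_mono) (auto simp: w_def)
      finally show ?thesis by (simp add: power2_eq_square mult_ac)
    qed
  qed
  \<comment> \<open>Since \<open>z = t + q * q * q\<close>, the bound \<open>norm z \<le> t\<close>
    expresses that the negative of \<open>q * q * q\<close> is non-negative.\<close>
  then have "nonneg (- (q * q * q))"
    using nonnegD[OF \<open>nonneg (q * q * q)\<close>] by (auto simp: nonneg_def z_def dd)
  with \<open>nonneg (q * q * q)\<close> have "q * q * q = 0" by (rule nonneg_antisym)
  then have "q = 0" by (rule cube_eq_zero[OF sq])
  with pq show ?thesis by simp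
qed

text \<open>A Neumann series: with \<open>m = k + e\<close> and \<open>T = norm k + e\<close> the
  element \<open>h = 1 - m / T\<close> has norm at most \<open>1 - e / T\<close>, and the same
  number bounds the inverse of \<open>m\<close> by \<open>1 / e\<close>. The elements
  \<open>g\<close> and \<open>s\<close> are a root of \<open>m\<close> and the inverse of that
  root.\<close>

lemma nonneg_inverse:
  fixes k :: "'a::unital_c_star_algebra"
  assumes k: "nonneg k" and e: "e > 0"
  obtains g s where "star g = g" "star s = s" "g * g = k + of_real e" "s * g = 1" "g * s = 1"
    "norm (s * s) \<le> 1 / e"
proof -
  define T where "T = norm k + e"
  have T: "T > 0" using e by (simp add: T_def add_nonneg_pos)
  define m where "m = k + of_real e"
  define h where "h = 1 - inverse T *\<^sub>R m"
  have "h = inverse T *\<^sub>R (of_real T - m)"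
    using T by (simp add: h_def of_real_def scaleR_right_diff_distrib)
  also have "of_real T - m = of_real (norm k) - k" by (simp add: T_def m_def)
  finally have "norm h = norm (of_real (norm k) - k) / T"
    using T by (simp add: divide_inverse mult.commute)
  also have "\<dots> \<le> norm k / T"
    using nonneg_norm_diff_le[OF k, of "norm k"] T by (intro divide_right_mono) auto
  finally have nh: "norm h \<le> norm k / T" .
  also have "\<dots> = 1 - e / T" using T by (simp add: T_def field_simps)
  finally have nh1: "norm h \<le> 1 - e / T" .
  then have "norm h < 1" using e T by (smt (verit) divide_pos_pos)
  have sn: "summable (\<lambda>n. h ^ n)" by (rule complete_algebra_summable_geometric[OF \<open>norm h < 1\<close>])
  define S where "S = (\<Sum>n. h ^ n)"
  have "S = 1 + (\<Sum>n. h ^ Suc n)" using suminf_split_head[OF sn] by (simp add: S_def)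
  moreover have "(\<Sum>n. h ^ Suc n) = h * S" "(\<Sum>n. h ^ Suc n) = S * h"
    using suminf_mult[OF sn, of h] suminf_mult2[OF sn, of h] by (simp_all add: S_def power_commutes)
  ultimately have S: "S = 1 + h * S" "S = 1 + S * h" by simp_all
  then have S': "(1 - h) * S = 1" "S * (1 - h) = 1" by (simp_all add: algebra_simps)
  define r where "r = inverse T *\<^sub>R S"
  have mr: "m * r = 1" "r * m = 1"
    using S' by (simp_all add: h_def r_def algebra_simps)
  have "norm S \<le> 1 + norm S * norm h"
    using S(2) norm_triangle_ineq[of 1 "S * h"] norm_mult_ineq[of S h] by simp
  also have "\<dots> \<le> 1 + norm S * (1 - e / T)" by (intro add_left_mono mult_left_mono nh1) simp
  finally have "norm S * (e / T) \<le> 1" by (simp add: algebra_simps)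
  then have nr: "norm r \<le> 1 / e" using T e by (simp add: r_def field_simps)
  have nm: "nonneg m" unfolding m_def using e by (intro nonneg_add k nonneg_of_real) simp
  from nonneg_sqrt[OF this] obtain g where g: "nonneg g" "g * g = m" by blast
  have sm: "star m = m" by (rule nonnegD[OF nm])
  have "star r * m = 1" using mr(1) star_mult[of m r] sm by simp
  then have sr: "star r = r" by (metis mr(1) mult.assoc mult.left_neutral mult.right_neutral)
  have "g * m = m * g" by (simp add: mult.assoc flip: g(2))
  then have gr: "g * r = r * g" by (metis mr mult.assoc mult.left_neutral mult.right_neutral)
  show ?thesis
  proof
    show "star g = g" by (rule nonnegD[OF g(1)])
    then show "star (g * r) = g * r" using sr gr by (simp add: star_mult)
    show "g * g = k + of_real e" using g(2) by (simp add: m_def)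
    show "g * r * g = 1" by (simp add: gr mult.assoc g(2) mr)
    show "g * (g * r) = 1" using mr by (simp add: g(2) flip: mult.assoc)
    have "g * r * (g * r) = r * (g * g) * r" by (simp add: gr mult.assoc)
    also have "\<dots> = r" using g(2) mr by simp
    finally show "norm (g * r * (g * r)) \<le> 1 / e" using nr by simp
  qed
qed

section \<open>Unitization\<close>

datatype 'a unitization = Unitization (base: 'a) (scal: complex)

lemma unitization_eq_iff: "x = y \<longleftrightarrow> base x = base y \<and> scal x = scal y"
  by (cases x; cases y) auto

text \<open>The unitization acts on its ideal \<open>'a\<close> by left multiplication. The operator
  norm of this action is what makes the C*-identity hold in the unitization.\<close>

definition lmult :: "'a::c_star_algebra unitization \<Rightarrow> 'a \<Rightarrow> 'a" where
  "lmult c x = base c * x + scaleC (scal c) x"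

lemma bounded_linear_scaleC: "bounded_linear (scaleC c :: 'a::c_star_algebra \<Rightarrow> 'a)"
proof (rule bounded_linear_intro[of _ "cmod c"])
  show "scaleC c (r *\<^sub>R x) = r *\<^sub>R scaleC c x" for r and x :: 'a
    by (simp add: scaleC_scaleC mult.commute flip: scaleC_of_real)
qed (simp_all add: scaleC_add_right norm_scaleC mult.commute)

lemma bounded_linear_lmult: "bounded_linear (lmult c)"
  unfolding lmult_def
  by (intro bounded_linear_add bounded_linear_mult_right bounded_linear_scaleC)

lemma onorm_lmult_pos_le: "onorm (lmult c) \<ge> 0"
  by (rule onorm_pos_le[OF bounded_linear_lmult])

text \<open>The bound is attained at \<open>star a\<close>, by the C*-identity; so
  \<open>emb\<close> will be isometric.\<close>

lemma onorm_lmult_base: "onorm (lmult (Unitization a 0)) = norm a"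
proof (rule antisym)
  show "onorm (lmult (Unitization a 0)) \<le> norm a"
    by (intro onorm_bound) (simp_all add: lmult_def norm_mult_ineq)
  show "norm a \<le> onorm (lmult (Unitization a 0))"
  proof (cases "a = 0")
    case False
    have "norm a * norm a = norm (lmult (Unitization a 0) (star a))"
      using c_star_identity[of "star a"] by (simp add: lmult_def power2_eq_square)
    also have "\<dots> \<le> onorm (lmult (Unitization a 0)) * norm a"
      using onorm[OF bounded_linear_lmult, of "Unitization a 0" "star a"] by simp
    finally show ?thesis using False by simp
  qed (simp add: onorm_lmult_pos_le)
qed

instantiation unitization :: (c_star_algebra) real_normed_algebra_1
begin

definition "0 = Unitization 0 0"
definition "1 = Unitization 0 1"
definition "x + y = Unitization (base x + base y) (scal x + scal y)"
definition "- x = Unitization (- base x) (- scal x)" for x :: "'a unitization"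
definition "x - y = Unitization (base x - base y) (scal x - scal y)"
definition "x * y =
  Unitization (base x * base y + scaleC (scal y) (base x) + scaleC (scal x) (base y)) (scal x * scal y)"
definition "scaleR r x = Unitization (scaleR r (base x)) (scaleR r (scal x))"

text \<open>
  The operator norm of left multiplication alone degenerates when the algebra already has a unit;
  the maximum with the modulus of the character \<open>scal\<close> repairs this.
\<close>

definition "norm x = max (cmod (scal x)) (onorm (lmult x))"
definition "dist x y = norm (x - y :: 'a unitization)"
definition "sgn x = inverse (norm x) *\<^sub>R (x :: 'a unitization)"
definition "uniformity = (INF e\<in>{0<..}. principal {(x, y :: 'a unitization). dist x y < e})"
definition "open (U :: 'a unitization set) \<longleftrightarrow>
  (\<forall>x\<in>U. \<forall>\<^sub>F (x', y) in uniformity. x' = x \<longrightarrow> y \<in> U)"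

lemma unitization_simps [simp]:
  "base (0 :: 'a unitization) = 0" "scal (0 :: 'a unitization) = 0"
  "base (1 :: 'a unitization) = 0" "scal (1 :: 'a unitization) = 1"
  "base (x + y) = base x + base y" "scal (x + y) = scal x + scal y"
  "base (- x) = - base x" "scal (- x) = - scal x"
  "base (x - y) = base x - base y" "scal (x - y) = scal x - scal y"
  "base (x * y) = base x * base y + scaleC (scal y) (base x) + scaleC (scal x) (base y)"
  "scal (x * y) = scal x * scal y"
  "base (r *\<^sub>R x) = r *\<^sub>R base x" "scal (r *\<^sub>R x) = r *\<^sub>R scal x"
  for x y :: "'a unitization"
  by (simp_all add: zero_unitization_def one_unitization_def plus_unitization_def
    uminus_unitization_def minus_unitization_def times_unitization_def scaleR_unitization_def)

lemma lmult_simps: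
  "lmult 0 = (\<lambda>y. 0)" "lmult (x + y) = (\<lambda>z. lmult x z + lmult y z)"
  "lmult (x * y) = lmult x \<circ> lmult y" "lmult (r *\<^sub>R x) = (\<lambda>z. r *\<^sub>R lmult x z)"
  for x y :: "'a unitization"
  by (auto simp: fun_eq_iff lmult_def algebra_simps scaleC_add_left scaleC_add_right
      mult_scaleC_left mult_scaleC_right scaleC_scaleC scaleR_conv_of_real simp flip: scaleC_of_real)

lemma onorm_lmult_mult: "onorm (lmult (x * y)) \<le> onorm (lmult x) * onorm (lmult y)" for x y :: "'a unitization"
  unfolding lmult_simps by (rule onorm_compose[OF bounded_linear_lmult bounded_linear_lmult])

instance
proof
  fix x y z :: "'a unitization" and r s :: real
  show "x + y + z = x + (y + z)" "x + y = y + x" "0 + x = x" "- x + x = 0" "x - y = x + - y"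
    "r *\<^sub>R (x + y) = r *\<^sub>R x + r *\<^sub>R y" "(r + s) *\<^sub>R x = r *\<^sub>R x + s *\<^sub>R x" "r *\<^sub>R s *\<^sub>R x = (r * s) *\<^sub>R x"
    "1 *\<^sub>R x = x"
    by (simp_all add: unitization_eq_iff algebra_simps)
  show "1 * x = x" "x * 1 = x" "(0 :: 'a unitization) \<noteq> 1"
    by (simp_all add: unitization_eq_iff)
  show "x * y * z = x * (y * z)" "(x + y) * z = x * z + y * z" "x * (y + z) = x * y + x * z"
    "r *\<^sub>R x * y = r *\<^sub>R (x * y)" "x * r *\<^sub>R y = r *\<^sub>R (x * y)"
    by (simp_all add: unitization_eq_iff algebra_simps scaleC_add_left scaleC_add_right
      mult_scaleC_left mult_scaleC_right scaleC_scaleC scaleR_conv_of_real flip: scaleC_of_real)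
  show "dist x y = norm (x - y)" "sgn x = inverse (norm x) *\<^sub>R x"
    "uniformity = (INF e\<in>{0<..}. principal {(x, y :: 'a unitization). dist x y < e})"
    "open U \<longleftrightarrow> (\<forall>x\<in>U. \<forall>\<^sub>F (x', y) in uniformity. x' = x \<longrightarrow> y \<in> U)" for U :: "'a unitization set"
    by (rule dist_unitization_def sgn_unitization_def uniformity_unitization_def open_unitization_def)+
  show "norm x = 0 \<longleftrightarrow> x = 0"
  proof
    assume "norm x = 0"
    then have "scal x = 0" "onorm (lmult x) = 0"
      using onorm_lmult_pos_le[of x] unfolding norm_unitization_def by (auto simp: max_def split: if_splits)
    moreover from this(1) have "x = Unitization (base x) 0" by (simp add: unitization_eq_iff)
    ultimately show "x = 0" using onorm_lmult_base[of "base x"] by (simp add: zero_unitization_def)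
  next
    assume "x = 0"
    then show "norm x = 0"
      by (simp add: norm_unitization_def lmult_simps onorm_zero)
  qed
  show "norm (x + y) \<le> norm x + norm y"
    using norm_triangle_ineq[of "scal x" "scal y"]
      onorm_triangle[OF bounded_linear_lmult[of x] bounded_linear_lmult[of y]]
    unfolding norm_unitization_def lmult_simps by (simp add: max_def)
  show "norm (r *\<^sub>R x) = \<bar>r\<bar> * norm x"
    by (simp add: norm_unitization_def lmult_simps onorm_scaleR[OF bounded_linear_lmult] max_mult_distrib_left)
  show "norm (x * y) \<le> norm x * norm y"
  proof -
    have "cmod (scal x) * cmod (scal y) \<le> norm x * norm y" "onorm (lmult x) * onorm (lmult y) \<le> norm x * norm y"
      unfolding norm_unitization_def by (intro mult_mono; simp add: onorm_lmult_pos_le max.coboundedI1)+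
    with onorm_lmult_mult[of x y] show ?thesis
      by (simp add: norm_unitization_def[of "x * y"] norm_mult)
  qed
  show "norm (1 :: 'a unitization) = 1"
  proof -
    have "onorm (lmult (1 :: 'a unitization)) \<le> 1"
      by (rule onorm_bound) (simp_all add: lmult_def)
    then show ?thesis by (simp add: norm_unitization_def)
  qed
qed

end

definition emb :: "'a::c_star_algebra \<Rightarrow> 'a unitization" where
  "emb a = Unitization a 0"

lemma emb_sel [simp]: "base (emb a) = a" "scal (emb a) = 0"
  by (simp_all add: emb_def)

lemma norm_emb [simp]: "norm (emb a) = norm a"
  by (simp add: emb_def norm_unitization_def onorm_lmult_base)

lemma emb_of_scal_zero: "scal x = 0 \<Longrightarrow> emb (base x) = x"
  by (simp add: unitization_eq_iff)

lemma norm_scal_le: "cmod (scal x) \<le> norm x"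
  by (simp add: norm_unitization_def)

text \<open>The maximum in the norm controls the scalar part, and therefore, with a factor 2, the
  base part as well. Cauchy sequences thus converge coordinatewise.\<close>

instance unitization :: (c_star_algebra) complete_space
proof
  fix X :: "nat \<Rightarrow> 'a unitization"
  assume X: "Cauchy X"
  define E where "E l = Unitization (0 :: 'a) l" for l
  have E: "norm (E l) \<le> cmod l" for l
  proof -
    have "onorm (lmult (E l)) \<le> cmod l"
      by (rule onorm_bound) (simp_all add: lmult_def E_def norm_scaleC)
    then show ?thesis by (simp add: norm_unitization_def E_def)
  qed
  have split: "x = emb (base x) + E (scal x)" for x :: "'a unitization"
    by (simp add: unitization_eq_iff E_def)
  have nb: "norm (base x) \<le> 2 * norm x" for x :: "'a unitization"
  proof -
    have "emb (base x) = x - E (scal x)" by (simp add: unitization_eq_iff E_def)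
    then have "norm (base x) \<le> norm x + norm (E (scal x))"
      by (metis norm_emb norm_triangle_ineq4)
    with E[of "scal x"] norm_scal_le[of x] show ?thesis by simp
  qed
  have "Cauchy (\<lambda>n. scal (X n))"
  proof (rule CauchyI)
    fix e :: real assume "e > 0"
    with X obtain N where "\<forall>m\<ge>N. \<forall>n\<ge>N. norm (X m - X n) < e" by (auto dest: CauchyD)
    then show "\<exists>N. \<forall>m\<ge>N. \<forall>n\<ge>N. norm (scal (X m) - scal (X n)) < e"
      by (metis norm_scal_le order_le_less_trans unitization_simps(10))
  qed
  then obtain l where l: "(\<lambda>n. scal (X n)) \<longlonglongrightarrow> l" by (auto simp: Cauchy_convergent_iff convergent_def)
  have "Cauchy (\<lambda>n. base (X n))"
  proof (rule CauchyI)
    fix e :: real assume "e > 0"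
    with X obtain N where N: "\<forall>m\<ge>N. \<forall>n\<ge>N. norm (X m - X n) < e / 2"
      using CauchyD[OF X, of "e / 2"] by auto
    show "\<exists>N. \<forall>m\<ge>N. \<forall>n\<ge>N. norm (base (X m) - base (X n)) < e"
    proof (intro exI[of _ N] allI impI)
      fix m n assume "N \<le> m" "N \<le> n"
      with N have "norm (X m - X n) < e / 2" by blast
      with nb[of "X m - X n"] show "norm (base (X m) - base (X n)) < e" by simp
    qed
  qed
  then obtain a where a: "(\<lambda>n. base (X n)) \<longlonglongrightarrow> a" by (auto simp: Cauchy_convergent_iff convergent_def)
  have "X \<longlonglongrightarrow> Unitization a l"
  proof (rule Lim_transform_bound[THEN Lim_null[THEN iffD2]])
    show "(\<lambda>n. norm (base (X n) - a) + cmod (scal (X n) - l)) \<longlonglongrightarrow> 0"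
      using tendsto_add[OF tendsto_norm[OF LIM_zero[OF a]] tendsto_norm[OF LIM_zero[OF l]]] by simp
    show "\<forall>\<^sub>F n in sequentially. norm (X n - Unitization a l) \<le> norm (norm (base (X n) - a) + cmod (scal (X n) - l))"
    proof (intro always_eventually allI)
      fix n
      have "norm (X n - Unitization a l) \<le> norm (emb (base (X n) - a)) + norm (E (scal (X n) - l))"
        using split[of "X n - Unitization a l"] by (metis norm_triangle_ineq unitization.sel unitization_simps(9,10))
      with E[of "scal (X n) - l"]
      show "norm (X n - Unitization a l) \<le> norm (norm (base (X n) - a) + cmod (scal (X n) - l))" by simp
    qed
  qed
  then show "convergent X" by (auto simp: convergent_def)
qed

lemma unitization_of_real_simps [simp]:
  "base (of_real r) = 0" "scal (of_real r) = of_real r"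
  by (simp_all add: of_real_def)

instantiation unitization :: (c_star_algebra) unital_c_star_algebra
begin

definition "scaleC c x = Unitization (scaleC c (base x)) (c * scal x)"
definition "star x = Unitization (star (base x)) (cnj (scal x))"

lemma unitization_C_simps [simp]:
  "base (scaleC c x) = scaleC c (base x)" "scal (scaleC c x) = c * scal x"
  "base (star x) = star (base x)" "scal (star x) = cnj (scal x)"
  for x y :: "'a unitization"
  by (simp_all add: scaleC_unitization_def star_unitization_def)

lemma lmult_scaleC: "lmult (scaleC c x) z = scaleC c (lmult x z)" for x :: "'a unitization"
  by (simp add: lmult_def mult_scaleC_left scaleC_scaleC scaleC_add_right)

lemma star_lmult: "star (lmult x y) * z = star y * lmult (star x) z" for x :: "'a unitization"
  by (simp add: lmult_def star_add star_mult star_scaleC algebra_simps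
      mult_scaleC_left mult_scaleC_right)

text \<open>The C*-identity of the algebra, applied to \<open>lmult x y\<close> for each
  \<open>y\<close>, carries over to the operator norm.\<close>

lemma onorm_lmult_square: "(onorm (lmult x))\<^sup>2 \<le> onorm (lmult (star x * x))" for x :: "'a unitization"
proof -
  have *: "norm (lmult x y) \<le> sqrt (onorm (lmult (star x * x))) * norm y" for y
  proof -
    have "(norm (lmult x y))\<^sup>2 = norm (star (lmult x y) * lmult x y)"
      by (simp add: c_star_identity)
    also have "\<dots> = norm (star y * lmult (star x * x) y)" by (simp add: star_lmult lmult_simps)
    also have "\<dots> \<le> norm y * (onorm (lmult (star x * x)) * norm y)"
      by (rule order_trans[OF norm_mult_ineq])
        (simp add: mult_left_mono onorm[OF bounded_linear_lmult])
    finally have "(norm (lmult x y))\<^sup>2 \<le> onorm (lmult (star x * x)) * (norm y)\<^sup>2"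
      by (simp add: power2_eq_square mult_ac)
    from real_sqrt_le_mono[OF this] show ?thesis by (simp add: real_sqrt_mult)
  qed
  have "onorm (lmult x) \<le> sqrt (onorm (lmult (star x * x)))"
    by (intro onorm_bound *) (simp add: onorm_lmult_pos_le)
  from power_mono[OF this onorm_lmult_pos_le, of 2] show ?thesis by (simp add: onorm_lmult_pos_le)
qed

lemma onorm_lmult_star: "onorm (lmult (star x)) = onorm (lmult x)" for x :: "'a unitization"
proof -
  have le: "onorm (lmult x) \<le> onorm (lmult (star x))" for x :: "'a unitization"
  proof (cases "onorm (lmult x) = 0")
    case False
    with onorm_lmult_pos_le[of x] have "onorm (lmult x) > 0" by simp
    moreover have "onorm (lmult x) * onorm (lmult x) \<le> onorm (lmult (star x)) * onorm (lmult x)"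
      using onorm_lmult_square[of x] onorm_lmult_mult[of "star x" x] by (simp add: power2_eq_square)
    ultimately show ?thesis by simp
  qed (simp add: onorm_lmult_pos_le)
  have "star (star x) = x" by (simp add: unitization_eq_iff)
  with le[of x] le[of "star x"] show ?thesis by simp
qed

instance
proof
  fix x y z :: "'a unitization" and c d :: complex and r s :: real
  show "scaleC c (x + y) = scaleC c x + scaleC c y" "scaleC (c + d) x = scaleC c x + scaleC d x"
    "scaleC c (scaleC d x) = scaleC (c * d) x"
    "scaleC c x * y = scaleC c (x * y)" "x * scaleC c y = scaleC c (x * y)"
    "star (star x) = x" "star (x + y) = star x + star y" "star (scaleC c x) = scaleC (cnj c) (star x)"
    "star (x * y) = star y * star x"
    by (simp_all add: unitization_eq_iff algebra_simps scaleC_add_left scaleC_add_right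
      mult_scaleC_left mult_scaleC_right scaleC_scaleC star_add star_mult star_scaleC)
  show "scaleC (complex_of_real r) x = scaleR r x"
    by (simp add: unitization_eq_iff scaleC_of_real) (simp add: scaleR_conv_of_real)
  show "norm (scaleC c x) = cmod c * norm x"
  proof -
    have le: "norm (scaleC c x) \<le> cmod c * norm x" for c and x :: "'a unitization"
    proof -
      have "onorm (lmult (scaleC c x)) \<le> cmod c * onorm (lmult x)"
        using onorm[OF bounded_linear_lmult[of x]]
        by (intro onorm_bound) (auto simp: lmult_scaleC norm_scaleC mult.assoc mult_left_mono onorm_lmult_pos_le)
      then show ?thesis
        by (simp add: norm_unitization_def norm_mult max_mult_distrib_left max.coboundedI2)
    qed
    show ?thesis
    proof (cases "c = 0")
      case True
      then show ?thesis using le[of 0 x] by simp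
    next
      case False
      have "scaleC (inverse c) (scaleC c x) = x"
        using False by (simp add: unitization_eq_iff scaleC_scaleC flip: mult.assoc)
      with le[of "inverse c" "scaleC c x"] have "norm x \<le> norm (scaleC c x) / cmod c"
        by (simp add: norm_inverse divide_inverse mult.commute)
      with False le[of c x] show ?thesis by (simp add: field_simps)
    qed
  qed
  show "norm (star x * x) = (norm x)\<^sup>2"
  proof -
    have "onorm (lmult (star x * x)) = (onorm (lmult x))\<^sup>2"
      using onorm_lmult_square[of x] onorm_lmult_mult[of "star x" x]
      by (simp add: onorm_lmult_star power2_eq_square)
    moreover have "max (a\<^sup>2) (b\<^sup>2) = (max a b)\<^sup>2" if "a \<ge> 0" "b \<ge> 0" for a b :: real
      using that power_mono[of a b 2] power_mono[of b a 2] by (auto simp: max_def)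
    ultimately show ?thesis
      using onorm_lmult_pos_le[of x] unfolding norm_unitization_def
      by (simp add: norm_mult power2_eq_square)
  qed
qed

end

section \<open>Positive elements of algebras without unit\<close>

lemma emb_simps [simp]:
  "emb 0 = 0" "emb (a + b) = emb a + emb b" "emb (a - b) = emb a - emb b" "emb (- a) = - emb a"
  "emb (a * b) = emb a * emb b" "emb (scaleC c a) = scaleC c (emb a)" "emb (r *\<^sub>R a) = r *\<^sub>R emb a"
  "emb (star a) = star (emb a)"
  by (simp_all add: unitization_eq_iff)

lemma emb_inj [simp]: "emb a = emb b \<longleftrightarrow> a = b"
  by (simp add: unitization_eq_iff)

lemma bounded_linear_emb: "bounded_linear emb"
  by (rule bounded_linear_intro[of _ 1]) simp_all

lemmas tendsto_emb [tendsto_intros] = bounded_linear.tendsto[OF bounded_linear_emb]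

text \<open>A root of \<open>emb a\<close> has a scalar part of square zero, so it lies in the
  algebra itself. The converse is the theorem of Kelley and Vaught in the unitization.\<close>

lemma positive_iff_nonneg_emb: "positive a \<longleftrightarrow> nonneg (emb a)"
proof
  assume "nonneg (emb a)"
  then obtain r where r: "nonneg r" "r * r = emb a" using nonneg_sqrt by blast
  then have "scal r * scal r = 0" by (metis emb_sel(2) unitization_simps(12))
  then have "emb (base r) = r" by (simp add: emb_of_scal_zero)
  then have "emb (star (base r) * base r) = emb a" using r nonnegD by force
  then show "positive a" unfolding positive_def by (metis emb_inj)
next
  assume "positive a"
  then obtain c where "a = star c * c" by (auto simp: positive_def)
  then show "nonneg (emb a)" by (simp add: nonneg_star_mult_self)
qed

lemma star_positive: "positive a \<Longrightarrow> star a = a"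
  unfolding positive_def by (elim exE) (simp add: star_mult)

lemma positive_zero [simp]: "positive 0"
  by (simp add: positive_iff_nonneg_emb)

lemma positive_add: "positive a \<Longrightarrow> positive b \<Longrightarrow> positive (a + b)"
  by (simp add: positive_iff_nonneg_emb nonneg_add)

lemma positive_scaleR: "positive a \<Longrightarrow> r \<ge> 0 \<Longrightarrow> positive (r *\<^sub>R a)"
  by (simp add: positive_iff_nonneg_emb nonneg_scaleR)

lemma positive_antisym: "positive a \<Longrightarrow> positive (- a) \<Longrightarrow> a = 0"
  using nonneg_antisym[of "emb a"] by (simp add: positive_iff_nonneg_emb unitization_eq_iff)

lemma positive_norm_mono: "positive a \<Longrightarrow> positive (b - a) \<Longrightarrow> norm a \<le> norm b"
  using nonneg_norm_mono[of "emb a" "emb b"] by (simp add: positive_iff_nonneg_emb)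

lemma positive_limit: "(\<And>n. positive (X n)) \<Longrightarrow> X \<longlonglongrightarrow> a \<Longrightarrow> positive a"
  using nonneg_limit[of "\<lambda>n. emb (X n)"] tendsto_emb[of X] by (simp add: positive_iff_nonneg_emb)

lemma positive_star_mult_self [simp]: "positive (star a * a)"
  by (auto simp: positive_def)

text \<open>Turns a norm bound into an algebraic identity. Under a representation it becomes an
  inequality between inner products, without any further functional calculus.\<close>

lemma norm_square_diff_sqrt:
  fixes a :: "'a::c_star_algebra unitization"
  assumes "norm a \<le> t"
  obtains s where "star s = s" "s * s = of_real (t\<^sup>2) - star a * a"
proof -
  have "norm (star a * a) \<le> t\<^sup>2"
    using assms by (simp add: c_star_identity power_mono)
  then have "nonneg (of_real (t\<^sup>2) - star a * a)"
    by (intro nonneg_of_real_diff) (simp_all add: star_mult)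
  then obtain s where "nonneg s" "s * s = of_real (t\<^sup>2) - star a * a" using nonneg_sqrt by blast
  with that nonnegD show ?thesis by blast
qed

lemma positive_norm_conjugate_diff:
  assumes "positive a" "norm a \<le> t"
  shows "positive (t *\<^sub>R (star c * c) - star c * a * c)"
proof -
  have "nonneg (of_real t - emb a)"
    using assms by (intro nonneg_of_real_diff) (simp_all add: star_positive flip: emb_simps(8))
  then obtain r where r: "nonneg r" "r * r = of_real t - emb a" using nonneg_sqrt by blast
  have "emb (t *\<^sub>R (star c * c) - star c * a * c) = star (emb c) * (of_real t - emb a) * emb c"
    by (simp add: algebra_simps of_real_def)
  also have "\<dots> = star (r * emb c) * (r * emb c)"
    by (simp add: star_mult nonnegD[OF r(1)] mult.assoc flip: r(2))
  finally show ?thesis by (simp add: positive_iff_nonneg_emb nonneg_star_mult_self)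
qed

lemma span_positive: "complex_vector.span {a :: 'a::c_star_algebra. positive a} = UNIV"
proof -
  let ?S = "complex_vector.span {a :: 'a. positive a}"
  have sa: "h \<in> ?S" if "star h = h" for h
  proof -
    have "star (emb h) = emb h" using that by (simp flip: emb_simps(8))
    then obtain m p q where m: "nonneg m" "m * m = emb h * emb h" "p = (1/2) *\<^sub>R (m + emb h)"
        "q = (1/2) *\<^sub>R (m - emb h)" "nonneg p" "nonneg q" "emb h = p - q"
      by (rule pos_neg_parts)
    \<comment> \<open>The square of \<open>m\<close> lies in the ideal, so \<open>m\<close> does
      too, and with it both parts.\<close>
    from arg_cong[OF m(2), of scal] have "scal m * scal m = 0" by simp
    then have "emb (base p) = p" "emb (base q) = q"
      using m(3,4) by (auto intro!: emb_of_scal_zero)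
    then have "positive (base p)" "positive (base q)"
      using m(5,6) by (simp_all add: positive_iff_nonneg_emb)
    moreover have "h = base p - base q"
      using m(7) by (simp add: unitization_eq_iff)
    ultimately show ?thesis by (auto intro: complex_vector.span_diff complex_vector.span_base)
  qed
  have "a \<in> ?S" for a :: 'a
  proof -
    have "star (a + star a) = a + star a" by (simp add: star_add add.commute)
    moreover have "star (scaleC \<i> (a - star a)) = scaleC \<i> (a - star a)"
      by (simp add: star_scaleC star_diff complex_vector.scale_minus_left complex_vector.scale_right_diff_distrib)
    ultimately have "scaleC (1/2) (a + star a) + scaleC (- \<i>/2) (scaleC \<i> (a - star a)) \<in> ?S"
      by (intro complex_vector.span_add complex_vector.span_scale sa)
    also have "scaleC (1/2) (a + star a) + scaleC (- \<i>/2) (scaleC \<i> (a - star a)) =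
        scaleC (1/2) a + scaleC (1/2) a"
      by (simp add: scaleC_scaleC complex_vector.scale_right_diff_distrib complex_vector.scale_right_distrib)
    also have "\<dots> = a" by (simp flip: scaleC_add_left)
    finally show ?thesis .
  qed
  then show ?thesis by blast
qed

section \<open>Semi-inner products\<close>

text \<open>Treats Hilbert modules and formal sums of tensors alike. Vector space laws are left out
  because lists obey them only up to vectors of length zero.\<close>

locale semi_inner =
  fixes S :: "'v set" and add :: "'v \<Rightarrow> 'v \<Rightarrow> 'v" and scale :: "complex \<Rightarrow> 'v \<Rightarrow> 'v"
    and act :: "'v \<Rightarrow> 'b::c_star_algebra \<Rightarrow> 'v" and inn :: "'v \<Rightarrow> 'v \<Rightarrow> 'b"
  assumes add_closed [simp]: "x \<in> S \<Longrightarrow> y \<in> S \<Longrightarrow> add x y \<in> S"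
    and scale_closed [simp]: "x \<in> S \<Longrightarrow> scale c x \<in> S"
    and act_closed [simp]: "x \<in> S \<Longrightarrow> act x b \<in> S"
    and inn_add [simp]: "x \<in> S \<Longrightarrow> y \<in> S \<Longrightarrow> z \<in> S \<Longrightarrow> inn x (add y z) = inn x y + inn x z"
    and inn_scale [simp]: "x \<in> S \<Longrightarrow> y \<in> S \<Longrightarrow> inn x (scale c y) = scaleC c (inn x y)"
    and inn_act [simp]: "x \<in> S \<Longrightarrow> y \<in> S \<Longrightarrow> inn x (act y b) = inn x y * b"
    and star_inn: "x \<in> S \<Longrightarrow> y \<in> S \<Longrightarrow> star (inn x y) = inn y x"
    and inn_positive: "x \<in> S \<Longrightarrow> positive (inn x x)"
begin

definition nrm :: "'v \<Rightarrow> real" where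
  "nrm x = sqrt (norm (inn x x))"

definition dst :: "'v \<Rightarrow> 'v \<Rightarrow> real" where
  "dst x y = nrm (add x (scale (- 1) y))"

lemma inn_add_left [simp]:
  assumes "x \<in> S" "y \<in> S" "z \<in> S"
  shows "inn (add x y) z = inn x z + inn y z"
proof -
  have "inn (add x y) z = star (inn z (add x y))" using assms by (simp only: star_inn add_closed)
  then show ?thesis using assms by (simp add: star_add star_inn)
qed

lemma inn_scale_left [simp]:
  assumes "x \<in> S" "y \<in> S"
  shows "inn (scale c x) y = scaleC (cnj c) (inn x y)"
proof -
  have "inn (scale c x) y = star (inn y (scale c x))" using assms by (simp only: star_inn scale_closed)
  then show ?thesis using assms by (simp add: star_scaleC star_inn)
qed

lemma inn_act_left [simp]:
  assumes "x \<in> S" "y \<in> S"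
  shows "inn (act x b) y = star b * inn x y"
proof -
  have "inn (act x b) y = star (inn y (act x b))" using assms by (simp only: star_inn act_closed)
  then show ?thesis using assms by (simp add: star_mult star_inn)
qed

lemma nrm_nonneg [simp]: "nrm x \<ge> 0"
  by (simp add: nrm_def)

lemma nrm_square: "(nrm x)\<^sup>2 = norm (inn x x)"
  by (simp add: nrm_def)

text \<open>Positivity is tested on \<open>t y - x c\<close> with \<open>c = inn x y\<close>. As
  \<open>star c * inn x x * c \<le> t star c * c\<close>, what remains is
  \<open>t star c * c \<le> t^2 inn y y\<close>. The strict inequality for \<open>t\<close> keeps it
  positive when \<open>inn x x = 0\<close>; letting \<open>t\<close> decrease gives the
  claim.\<close>

lemma norm_inn_le:
  assumes x: "x \<in> S" and y: "y \<in> S"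
  shows "norm (inn x y) \<le> nrm x * nrm y"
proof -
  define c where "c = inn x y"
  have le: "(norm c)\<^sup>2 \<le> t * norm (inn y y)" if t: "t > norm (inn x x)" for t
  proof -
    have t0: "t > 0" using t norm_ge_zero[of "inn x x"] by linarith
    let ?z = "add (scale (complex_of_real t) y) (scale (- 1) (act x c))"
    have cs: "inn y x = star c" using x y by (simp add: c_def star_inn)
    have "positive (inn ?z ?z)" using x y by (intro inn_positive) simp
    also have "inn ?z ?z = t\<^sup>2 *\<^sub>R inn y y - (t *\<^sub>R (star c * c) + t *\<^sub>R (star c * c)) + star c * inn x x * c"
      using x y by (simp add: cs flip: c_def) (simp add: algebra_simps scaleC_of_real power2_eq_square
        mult_scaleC_left mult_scaleC_right complex_vector.scale_minus_left scaleR_2)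
    finally have "positive (t\<^sup>2 *\<^sub>R inn y y - (t *\<^sub>R (star c * c) + t *\<^sub>R (star c * c)) + star c * inn x x * c)" .
    from positive_add[OF this positive_norm_conjugate_diff[OF inn_positive[OF x] less_imp_le[OF t], of c]]
    have "positive (t\<^sup>2 *\<^sub>R inn y y - t *\<^sub>R (star c * c))"
      by (simp add: algebra_simps)
    from positive_norm_mono[OF _ this] have "norm (t *\<^sub>R (star c * c)) \<le> norm (t\<^sup>2 *\<^sub>R inn y y)"
      using t0 by (simp add: positive_scaleR)
    then have "t * (norm c)\<^sup>2 \<le> t * (t * norm (inn y y))"
      using t0 by (simp add: c_star_identity power2_eq_square mult.assoc)
    then show ?thesis using t0 by simp
  qed
  have "(norm c)\<^sup>2 \<le> norm (inn x x) * norm (inn y y)"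
  proof (cases "inn y y = 0")
    case True
    with le[of "norm (inn x x) + 1"] show ?thesis by simp
  next
    case False
    have "(norm c)\<^sup>2 / norm (inn y y) \<le> norm (inn x x)"
      by (rule dense_ge) (use le False in \<open>simp add: field_simps\<close>)
    with False show ?thesis by (simp add: field_simps)
  qed
  from real_sqrt_le_mono[OF this] show ?thesis by (simp add: c_def nrm_def real_sqrt_mult)
qed

lemma nrm_add_le:
  assumes "x \<in> S" "y \<in> S"
  shows "nrm (add x y) \<le> nrm x + nrm y"
proof (rule power2_le_imp_le)
  have "(nrm (add x y))\<^sup>2 = norm (inn x x + inn x y + (inn y x + inn y y))"
    using assms by (simp add: nrm_square algebra_simps)
  also have "\<dots> \<le> (nrm x)\<^sup>2 + nrm x * nrm y + (nrm y * nrm x + (nrm y)\<^sup>2)"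
    using assms by (intro norm_triangle_le add_mono norm_inn_le) (simp_all add: nrm_square norm_inn_le)
  finally show "(nrm (add x y))\<^sup>2 \<le> (nrm x + nrm y)\<^sup>2"
    by (simp add: power2_eq_square algebra_simps)
qed simp

lemma nrm_scale: "x \<in> S \<Longrightarrow> nrm (scale c x) = cmod c * nrm x"
  by (simp add: nrm_def norm_scaleC scaleC_scaleC norm_mult real_sqrt_mult)

lemma nrm_act_le:
  assumes "x \<in> S"
  shows "nrm (act x b) \<le> nrm x * norm b"
proof (rule power2_le_imp_le)
  have "(nrm (act x b))\<^sup>2 = norm (star b * inn x x * b)"
    using assms by (simp add: nrm_square)
  also have "\<dots> \<le> norm (star b) * norm (inn x x) * norm b"
    by (meson norm_mult_ineq order_trans mult_right_mono norm_ge_zero)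
  finally show "(nrm (act x b))\<^sup>2 \<le> (nrm x * norm b)\<^sup>2"
    by (simp add: power_mult_distrib nrm_square) (simp add: power2_eq_square mult_ac)
qed simp

text \<open>The substitute for rearranging sums: vectors with equal inner products need not be
  equal, but have equal length.\<close>

lemma nrm_cong:
  assumes "x \<in> S" "y \<in> S" "\<And>z. z \<in> S \<Longrightarrow> inn z x = inn z y"
  shows "nrm x = nrm y"
proof -
  have "inn x x = star (inn y x)" using assms(3)[of x] assms(1,2) by (simp add: star_inn)
  also have "\<dots> = inn y y" using assms(3)[of y] assms(1,2) by (simp add: star_inn)
  finally show ?thesis by (simp add: nrm_def)
qed

lemma dst_self: "x \<in> S \<Longrightarrow> dst x x = 0"
  by (simp add: dst_def nrm_def complex_vector.scale_minus_left)

lemma dst_nonneg [simp]: "dst x y \<ge> 0"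
  by (simp add: dst_def)

lemma dst_commute:
  assumes "x \<in> S" "y \<in> S"
  shows "dst x y = dst y x"
proof -
  have "dst x y = nrm (scale (- 1) (add y (scale (- 1) x)))"
    unfolding dst_def using assms by (intro nrm_cong) (simp_all add: scaleC_add_right scaleC_scaleC)
  then show ?thesis using assms by (simp add: nrm_scale dst_def)
qed

lemma dst_triangle:
  assumes "x \<in> S" "y \<in> S" "z \<in> S"
  shows "dst x z \<le> dst x y + dst y z"
proof -
  have "dst x z = nrm (add (add x (scale (- 1) y)) (add y (scale (- 1) z)))"
    unfolding dst_def using assms by (intro nrm_cong) (simp_all add: complex_vector.scale_minus_left)
  also have "\<dots> \<le> dst x y + dst y z"
    unfolding dst_def using assms by (intro nrm_add_le) simp_all
  finally show ?thesis .
qed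

lemma nrm_le_dst:
  assumes "x \<in> S" "y \<in> S"
  shows "nrm x \<le> nrm y + dst x y"
proof -
  have "nrm x = nrm (add y (add x (scale (- 1) y)))"
    using assms by (intro nrm_cong) (simp_all add: complex_vector.scale_minus_left)
  also have "\<dots> \<le> nrm y + dst x y"
    unfolding dst_def using assms by (intro nrm_add_le) simp_all
  finally show ?thesis .
qed

lemma norm_inn_diff_le:
  assumes "x \<in> S" "y \<in> S" "x' \<in> S" "y' \<in> S"
  shows "norm (inn x y - inn x' y') \<le> dst x x' * nrm y + nrm x' * dst y y'"
proof -
  have "inn x y - inn x' y' = inn (add x (scale (- 1) x')) y + inn x' (add y (scale (- 1) y'))"
    using assms by (simp add: complex_vector.scale_minus_left)
  moreover have "norm (inn (add x (scale (- 1) x')) y + inn x' (add y (scale (- 1) y')))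
      \<le> dst x x' * nrm y + nrm x' * dst y y'"
    unfolding dst_def using assms by (intro norm_triangle_le add_mono norm_inn_le) simp_all
  ultimately show ?thesis by simp
qed

end

section \<open>Hilbert modules\<close>

sublocale hilbert_module \<subseteq> semi_inner "carrier M" "vadd M" "vscale M" "ract M" "ip M"
  rewrites nrm_eq: "semi_inner.nrm (ip M) = mnorm M"
    and dst_eq: "semi_inner.dst (vadd M) (vscale M) (ip M) = (\<lambda>x y. mnorm M (vdiff M x y))"
proof -
  interpret G: comm_group "\<lparr>carrier = carrier M, mult = vadd M, one = vzero M\<rparr>"
    by (rule add_group)
  show si: "semi_inner (carrier M) (vadd M) (vscale M) (ract M) (ip M)"
    by unfold_locales
      (use G.m_closed in \<open>auto intro: vscale_closed ract_closed simp: ip_add_right ip_vscale_right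
        ip_ract_right star_ip ip_positive\<close>)
  show "semi_inner.nrm (ip M) = mnorm M"
    by (auto simp: fun_eq_iff mnorm_def semi_inner.nrm_def[OF si])
  then show "semi_inner.dst (vadd M) (vscale M) (ip M) = (\<lambda>x y. mnorm M (vdiff M x y))"
    by (auto simp: fun_eq_iff vdiff_def semi_inner.dst_def[OF si])
qed

context hilbert_module
begin

lemma vzero_closed [simp]: "vzero M \<in> carrier M"
proof -
  interpret G: comm_group "\<lparr>carrier = carrier M, mult = vadd M, one = vzero M\<rparr>"
    by (rule add_group)
  show ?thesis using G.one_closed by simp
qed

lemma vdiff_closed [simp]: "x \<in> carrier M \<Longrightarrow> y \<in> carrier M \<Longrightarrow> vdiff M x y \<in> carrier M"
  by (simp add: vdiff_def)

lemma ip_vdiff [simp]: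
  "x \<in> carrier M \<Longrightarrow> y \<in> carrier M \<Longrightarrow> z \<in> carrier M \<Longrightarrow> ip M x (vdiff M y z) = ip M x y - ip M x z"
  "x \<in> carrier M \<Longrightarrow> y \<in> carrier M \<Longrightarrow> z \<in> carrier M \<Longrightarrow> ip M (vdiff M y z) x = ip M y x - ip M z x"
  by (simp_all add: vdiff_def complex_vector.scale_minus_left)

lemma vadd_vzero: "x \<in> carrier M \<Longrightarrow> vadd M (vzero M) x = x"
proof -
  interpret G: comm_group "\<lparr>carrier = carrier M, mult = vadd M, one = vzero M\<rparr>"
    by (rule add_group)
  show "x \<in> carrier M \<Longrightarrow> vadd M (vzero M) x = x" using G.l_one by simp
qed

lemma ip_vzero [simp]:
  assumes "x \<in> carrier M"
  shows "ip M x (vzero M) = 0" "ip M (vzero M) x = 0"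
proof -
  show 1: "ip M x (vzero M) = 0"
    using inn_add[OF assms vzero_closed vzero_closed] by (simp add: vadd_vzero)
  show "ip M (vzero M) x = 0" using 1 star_ip[OF assms vzero_closed] by simp
qed

lemma eq_iff_vdiff: "x \<in> carrier M \<Longrightarrow> y \<in> carrier M \<Longrightarrow> vdiff M x y = vzero M \<Longrightarrow> x = y"
proof -
  interpret G: comm_group "\<lparr>carrier = carrier M, mult = vadd M, one = vzero M\<rparr>"
    by (rule add_group)
  assume x: "x \<in> carrier M" and y: "y \<in> carrier M" and xy: "vdiff M x y = vzero M"
  let ?n = "vscale M (- 1) y"
  have "vadd M (vscale M 0 y) y = vadd M (vzero M) y"
    using vscale_add_left[OF y, of 0 1] y G.l_one[of y] by (simp add: vscale_one)
  then have "vscale M 0 y = vzero M" using G.right_cancel[of y "vscale M 0 y" "vzero M"] y by simp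
  then have "vadd M y ?n = vzero M"
    using vscale_add_left[OF y, of 1 "- 1"] y by (simp add: vscale_one)
  with xy show "x = y" using G.right_cancel[of ?n x y] x y by (simp add: vdiff_def)
qed

lemma module_eqI:
  assumes "x \<in> carrier M" "y \<in> carrier M" "\<And>z. z \<in> carrier M \<Longrightarrow> ip M z x = ip M z y"
  shows "x = y"
proof -
  have "ip M (vdiff M x y) (vdiff M x y) = 0"
    using assms(3)[of x] assms(3)[of y] assms(1,2) by simp
  then have "vdiff M x y = vzero M" using assms(1,2) by (intro ip_definite) simp_all
  then show ?thesis by (rule eq_iff_vdiff[OF assms(1,2)])
qed

lemma mnorm_vzero [simp]: "mnorm M (vzero M) = 0"
  by (simp add: mnorm_def)

lemma mnorm_eq_0: "x \<in> carrier M \<Longrightarrow> mnorm M x = 0 \<longleftrightarrow> x = vzero M"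
  by (auto simp: mnorm_def ip_definite)

lemma mnorm_dist_eq_0: "x \<in> carrier M \<Longrightarrow> y \<in> carrier M \<Longrightarrow> mnorm M (vdiff M x y) = 0 \<longleftrightarrow> x = y"
  by (metis eq_iff_vdiff mnorm_eq_0 vdiff_closed dst_self)

lemma vspan_closed: "x \<in> vspan M X \<Longrightarrow> X \<subseteq> carrier M \<Longrightarrow> x \<in> carrier M"
  by (induction rule: vspan.induct) auto

lemma closed_vspan_induct [consumes 2, case_names base zero add scale limit]:
  assumes "x \<in> closed_vspan M (mnorm M) X" and "X \<subseteq> carrier M"
    and base: "\<And>x. x \<in> X \<Longrightarrow> P x" and zero: "P (vzero M)"
    and add: "\<And>x y. x \<in> carrier M \<Longrightarrow> y \<in> carrier M \<Longrightarrow> P x \<Longrightarrow> P y \<Longrightarrow> P (vadd M x y)"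
    and scale: "\<And>c x. x \<in> carrier M \<Longrightarrow> P x \<Longrightarrow> P (vscale M c x)"
    and limit: "\<And>x. x \<in> carrier M \<Longrightarrow>
      (\<And>e. e > 0 \<Longrightarrow> \<exists>y\<in>carrier M. P y \<and> mnorm M (vdiff M x y) < e) \<Longrightarrow> P x"
  shows "P x"
proof -
  have "P y" if "y \<in> vspan M X" for y
    using that by induction (auto intro: base zero add scale vspan_closed[OF _ assms(2)])
  then show ?thesis
    using assms(1) unfolding closed_vspan_def
    by (intro limit) (use vspan_closed[OF _ assms(2)] in blast)+
qed

subsection \<open>Adjointable operators\<close>

lemma adjoint_closed: "is_adjoint M T S \<Longrightarrow> x \<in> carrier M \<Longrightarrow> T x \<in> carrier M"
  "is_adjoint M T S \<Longrightarrow> x \<in> carrier M \<Longrightarrow> S x \<in> carrier M"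
  by (auto simp: is_adjoint_def)

lemma adjoint_ip:
  assumes "is_adjoint M T S" "x \<in> carrier M" "y \<in> carrier M"
  shows "ip M (T x) y = ip M x (S y)" "ip M x (T y) = ip M (S x) y"
proof -
  show 1: "ip M (T x) y = ip M x (S y)" using assms by (auto simp: is_adjoint_def)
  have "ip M (T y) x = ip M y (S x)" using assms by (auto simp: is_adjoint_def)
  then show "ip M x (T y) = ip M (S x) y"
    using star_ip[of "T y" x] star_ip[of y "S x"] adjoint_closed[OF assms(1)] assms(2,3) by simp
qed

text \<open>Linearity is not part of \<open>is_adjoint\<close>. It follows because inner products
  separate the elements of the module.\<close>

lemma adjoint_linear:
  assumes "is_adjoint M T S" "x \<in> carrier M" "y \<in> carrier M"
  shows "T (vadd M x y) = vadd M (T x) (T y)" "T (vscale M c x) = vscale M c (T x)"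
    "T (ract M x b) = ract M (T x) b" "T (vzero M) = vzero M" "T (vdiff M x y) = vdiff M (T x) (T y)"
  by (rule module_eqI; simp add: assms(2,3) adjoint_closed[OF assms(1)] adjoint_ip(2)[OF assms(1)])+

text \<open>Uniform boundedness, by a gliding hump.\<close>

lemma adjoint_bounded:
  assumes T: "is_adjoint M T S"
  obtains B where "B \<ge> 0" "\<And>x. x \<in> carrier M \<Longrightarrow> mnorm M (T x) \<le> B * mnorm M x"
proof (rule ccontr)
  note [simp] = adjoint_closed[OF T]
  assume "\<not> thesis"
  with that have unb: "\<exists>x\<in>carrier M. mnorm M (T x) > B * mnorm M x" if "B \<ge> 0" for B
    using that not_le by blast
  have "\<exists>x\<in>carrier M. mnorm M x \<le> 1 \<and> mnorm M (T x) > 4 ^ n" for n :: nat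
  proof -
    obtain x where x: "x \<in> carrier M" "mnorm M (T x) > 4 ^ n * mnorm M x"
      using unb[of "4 ^ n"] by auto
    have "x \<noteq> vzero M" using x adjoint_linear(4)[OF T x(1) x(1)] by auto
    then have px: "mnorm M x > 0" using mnorm_eq_0[OF x(1)] nrm_nonneg[of x] by linarith
    let ?y = "vscale M (complex_of_real (inverse (mnorm M x))) x"
    have "mnorm M ?y \<le> 1" "mnorm M (T ?y) > 4 ^ n"
      using x px adjoint_linear(2)[OF T x(1) x(1)] by (simp_all add: nrm_scale norm_inverse pos_less_divide_eq divide_inverse[symmetric] mult.commute[of "inverse _"])
    then show ?thesis using x(1) scale_closed by blast
  qed
  then obtain x where x: "\<And>n. x n \<in> carrier M" "\<And>n. mnorm M (x n) \<le> 1" "\<And>n. mnorm M (T (x n)) > 4 ^ n"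
    by metis
  define N where "N n = mnorm M (T (x n))" for n
  have N: "N n > 4 ^ n" "N n > 0" for n
    using x(3)[of n] less_trans[OF _ x(3)[of n], of 0] by (simp_all add: N_def)
  have "\<exists>c. \<forall>n. c n \<in> carrier M \<and> (mnorm M (vdiff M (c n) (c (Suc n))) \<le> (1/3) ^ n \<and>
      norm (ip M (T (x n)) (c (Suc n))) \<ge> (1/3) ^ n * N n)"
  proof (rule dependent_nat_choice)
    fix c n assume c: "c \<in> carrier M"
    \<comment> \<open>The hump: \<open>?y\<close> has length \<open>(1/3) ^ n\<close> and the
      direction of \<open>T (x n)\<close>. The products of \<open>T (x n)\<close> with
      \<open>c + ?y\<close> and \<open>c - ?y\<close> differ by an element of norm
      \<open>2 * (1/3) ^ n * N n\<close>, so one of them has at least half of this norm.\<close>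
    let ?y = "vscale M (complex_of_real ((1/3) ^ n / N n)) (T (x n))"
    let ?a = "vadd M c ?y" let ?b = "vdiff M c ?y"
    have y: "mnorm M ?y = (1/3) ^ n" "norm (ip M (T (x n)) ?y) = (1/3) ^ n * N n"
      using N(2)[of n] x(1)[of n] nrm_square[of "T (x n)", symmetric]
      by (simp_all add: nrm_scale norm_scaleC norm_mult norm_divide norm_power power2_eq_square flip: N_def)
    have d: "mnorm M (vdiff M c ?a) = (1/3) ^ n" "mnorm M (vdiff M c ?b) = (1/3) ^ n"
    proof -
      have "mnorm M (vdiff M c ?a) = mnorm M (vscale M (- 1) ?y)"
        using c x(1)[of n] by (intro nrm_cong) (simp_all add: complex_vector.scale_minus_left)
      then show "mnorm M (vdiff M c ?a) = (1/3) ^ n"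
        using x(1)[of n] y by (subst (asm) nrm_scale) simp_all
      have "mnorm M (vdiff M c ?b) = mnorm M ?y"
        using c x(1)[of n] by (intro nrm_cong) simp_all
      then show "mnorm M (vdiff M c ?b) = (1/3) ^ n" using y by simp
    qed
    have "2 * norm (ip M (T (x n)) ?y) = norm (ip M (T (x n)) ?a - ip M (T (x n)) ?b)"
      using c x(1)[of n] by (simp del: inn_scale flip: scaleR_2)
    also have "\<dots> \<le> norm (ip M (T (x n)) ?a) + norm (ip M (T (x n)) ?b)" by (rule norm_triangle_ineq4)
    finally have "norm (ip M (T (x n)) ?a) \<ge> (1/3) ^ n * N n \<or> norm (ip M (T (x n)) ?b) \<ge> (1/3) ^ n * N n"
      unfolding y by linarith
    moreover have "?a \<in> carrier M" "?b \<in> carrier M" using c x(1)[of n] by simp_all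
    ultimately show "\<exists>y. y \<in> carrier M \<and> (mnorm M (vdiff M c y) \<le> (1/3) ^ n \<and>
        norm (ip M (T (x n)) y) \<ge> (1/3) ^ n * N n)"
      using d by (metis order_refl)
  qed (use vzero_closed in blast)
  then obtain c where c: "\<And>n. c n \<in> carrier M" "\<And>n. mnorm M (vdiff M (c n) (c (Suc n))) \<le> (1/3) ^ n"
      "\<And>n. norm (ip M (T (x n)) (c (Suc n))) \<ge> (1/3) ^ n * N n"
    by blast
  have dc: "mnorm M (vdiff M (c m) (c (m + k))) \<le> 3/2 * (1/3) ^ m * (1 - (1/3) ^ k)" for m k
  proof (induction k)
    case (Suc k)
    have "mnorm M (vdiff M (c m) (c (m + Suc k)))
        \<le> mnorm M (vdiff M (c m) (c (m + k))) + mnorm M (vdiff M (c (m + k)) (c (Suc (m + k))))"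
      using dst_triangle[OF c(1) c(1) c(1)] by simp
    also have "\<dots> \<le> 3/2 * (1/3) ^ m * (1 - (1/3) ^ k) + (1/3) ^ (m + k)"
      by (intro add_mono Suc c(2))
    also have "\<dots> = 3/2 * (1/3) ^ m * (1 - (1/3) ^ Suc k)"
      by (simp only: power_add power_Suc) algebra
    finally show ?case .
  qed (simp add: dst_self c(1))
  have dc': "mnorm M (vdiff M (c m) (c n)) \<le> 3/2 * (1/3) ^ m" if "m \<le> n" for m n
  proof -
    obtain k where k: "n = m + k" using le_Suc_ex[OF \<open>m \<le> n\<close>] by blast
    have "(1/3 :: real) ^ k \<ge> 0" "3/2 * (1/3 :: real) ^ m \<ge> 0" by simp_all
    then have "3/2 * (1/3) ^ m * (1 - (1/3) ^ k) \<le> 3/2 * (1/3 :: real) ^ m"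
      by (intro mult_left_le) linarith+
    from order_trans[OF dc[of m k] this] show ?thesis by (simp only: k)
  qed
  have "\<exists>x\<in>carrier M. (\<lambda>n. mnorm M (vdiff M (c n) x)) \<longlonglongrightarrow> 0"
  proof (rule complete)
    show "\<forall>e>0. \<exists>N. \<forall>m\<ge>N. \<forall>n\<ge>N. mnorm M (vdiff M (c m) (c n)) < e"
    proof (intro allI impI)
      fix e :: real assume "e > 0"
      have "(\<lambda>m. 3/2 * (1/3) ^ m :: real) \<longlonglongrightarrow> 3/2 * 0"
        by (intro tendsto_intros LIMSEQ_power_zero) simp
      with \<open>e > 0\<close> obtain N where N: "3/2 * (1/3) ^ m < e" if "m \<ge> N" for m
        using order_tendstoD(2)[of "\<lambda>m. 3/2 * (1/3) ^ m :: real" 0 sequentially e]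
        by (auto simp: eventually_sequentially)
      have "mnorm M (vdiff M (c m) (c n)) < e" if "m \<ge> N" "n \<ge> N" for m n
      proof (cases "m \<le> n")
        case True
        with dc'[OF True] N[OF that(1)] show ?thesis by linarith
      next
        case False
        with dc'[of n m] N[OF that(2)] dst_commute[OF c(1)[of m] c(1)[of n]] show ?thesis by simp
      qed
      then show "\<exists>N. \<forall>m\<ge>N. \<forall>n\<ge>N. mnorm M (vdiff M (c m) (c n)) < e" by blast
    qed
  qed (use c(1) in blast)
  then obtain z where z: "z \<in> carrier M" "(\<lambda>n. mnorm M (vdiff M (c n) z)) \<longlonglongrightarrow> 0" by blast
  have dz: "mnorm M (vdiff M (c m) z) \<le> 3/2 * (1/3) ^ m" for m
  proof -
    have "(\<lambda>n. 3/2 * (1/3) ^ m + mnorm M (vdiff M (c n) z)) \<longlonglongrightarrow> 3/2 * (1/3) ^ m + 0"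
      by (intro tendsto_intros z)
    moreover have "mnorm M (vdiff M (c m) z) \<le> 3/2 * (1/3) ^ m + mnorm M (vdiff M (c n) z)" if "n \<ge> m" for n
      using dst_triangle[OF c(1) c(1) z(1), of m n] dc'[OF that] by linarith
    ultimately show ?thesis using LIMSEQ_le_const by fastforce
  qed
  \<comment> \<open>All steps after \<open>c (Suc n)\<close> together have length at most
    \<open>3/2 * (1/3) ^ Suc n\<close>, half of \<open>(1/3) ^ n\<close>, so half of the hump
    survives in the product of \<open>T (x n)\<close> with \<open>z\<close>. That product is
    \<open>ip M (x n) (S z)\<close>, bounded by \<open>mnorm M (S z)\<close> independently of
    \<open>n\<close>, whereas \<open>N n > 4 ^ n\<close>.\<close>
  have "(4/3) ^ n \<le> 2 * mnorm M (S z)" for n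
  proof -
    have "(1/3) ^ n * N n \<le> norm (ip M (T (x n)) (c (Suc n)))" by (rule c(3))
    also have "ip M (T (x n)) (c (Suc n)) = ip M (T (x n)) (vdiff M (c (Suc n)) z) + ip M (x n) (S z)"
      using x(1)[of n] c(1)[of "Suc n"] z(1) by (simp add: adjoint_ip[OF T])
    also have "norm \<dots> \<le> N n * (3/2 * (1/3) ^ Suc n) + 1 * mnorm M (S z)"
    proof (intro norm_triangle_le add_mono)
      show "norm (ip M (T (x n)) (vdiff M (c (Suc n)) z)) \<le> N n * (3/2 * (1/3) ^ Suc n)"
        using x(1)[of n] c(1)[of "Suc n"] z(1) dz[of "Suc n"] N(2)[of n]
        by (intro order_trans[OF norm_inn_le] mult_mono) (auto simp: N_def)
      show "norm (ip M (x n) (S z)) \<le> 1 * mnorm M (S z)"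
        using x(1)[of n] x(2)[of n] z(1)
        by (intro order_trans[OF norm_inn_le] mult_mono) auto
    qed
    finally have "(1/3) ^ n * N n \<le> 2 * mnorm M (S z)" by (simp add: field_simps)
    moreover have "(4/3) ^ n \<le> (1/3) ^ n * N n"
      using mult_left_mono[OF less_imp_le[OF N(1)[of n]], of "(1/3) ^ n"] by (simp flip: power_mult_distrib)
    ultimately show ?thesis by linarith
  qed
  moreover obtain n where "(4/3 :: real) ^ n > 2 * mnorm M (S z)"
    using real_arch_pow[of "4/3"] by auto
  ultimately show False using not_le by blast
qed

end

lemma closure_span_induct [consumes 1, case_names zero base add scale limit]:
  fixes X :: "'a::c_star_algebra set"
  assumes "closure (complex_vector.span X) = UNIV"
    and zero: "P 0" and base: "\<And>x. x \<in> X \<Longrightarrow> P x" and add: "\<And>x y. P x \<Longrightarrow> P y \<Longrightarrow> P (x + y)"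
    and scale: "\<And>c x. P x \<Longrightarrow> P (scaleC c x)"
    and limit: "\<And>x. (\<And>e. e > 0 \<Longrightarrow> \<exists>y. P y \<and> norm (x - y) < e) \<Longrightarrow> P x"
  shows "P x"
proof (rule limit)
  have "P y" if "y \<in> complex_vector.span X" for y
    using that by (induction rule: complex_vector.span_induct_alt) (auto intro: zero base add scale)
  moreover fix e :: real assume "e > 0"
  moreover have "x \<in> closure (complex_vector.span X)" using assms(1) by simp
  ultimately show "\<exists>y. P y \<and> norm (x - y) < e"
    unfolding closure_approachable dist_norm by (metis norm_minus_commute)
qed

section \<open>Operator norm and compact operators\<close>

context hilbert_module
begin

lemma opnorm_le:
  assumes "\<And>x. x \<in> carrier M \<Longrightarrow> mnorm M (T x) \<le> B * mnorm M x" "B \<ge> 0"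
  shows "opnorm M T \<le> B"
  unfolding opnorm_def
proof (rule cSUP_least)
  show "{x \<in> carrier M. mnorm M x \<le> 1} \<noteq> {}"
    using vzero_closed by fastforce
  show "mnorm M (T x) \<le> B" if "x \<in> {x \<in> carrier M. mnorm M x \<le> 1}" for x
    using that assms(1)[of x] mult_left_mono[of "mnorm M x" 1 B] assms(2) by auto
qed

text \<open>The supremum in \<open>opnorm\<close> is meaningful only for a set bounded above, so
  \<open>adjoint_bounded\<close> enters here.\<close>

lemma le_opnorm:
  assumes T: "is_adjoint M T S" and x: "x \<in> carrier M"
  shows "mnorm M (T x) \<le> opnorm M T * mnorm M x"
proof (cases "x = vzero M")
  case True
  then show ?thesis using adjoint_linear(4)[OF T x x] by simp
next
  case False
  then have px: "mnorm M x > 0" using mnorm_eq_0[OF x] nrm_nonneg[of x] by linarith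
  obtain B where B: "B \<ge> 0" "\<And>x. x \<in> carrier M \<Longrightarrow> mnorm M (T x) \<le> B * mnorm M x"
    using adjoint_bounded[OF T] by blast
  define y where "y = vscale M (complex_of_real (1 / mnorm M x)) x"
  have y: "y \<in> carrier M" "mnorm M y = 1"
    using x px by (simp_all add: y_def nrm_scale norm_divide)
  have "bdd_above ((\<lambda>x. mnorm M (T x)) ` {x \<in> carrier M. mnorm M x \<le> 1})"
  proof (rule bdd_aboveI2)
    show "mnorm M (T x) \<le> B" if "x \<in> {x \<in> carrier M. mnorm M x \<le> 1}" for x
      using that B(2)[of x] mult_left_mono[of "mnorm M x" 1 B] B(1) by auto
  qed
  then have "mnorm M (T y) \<le> opnorm M T"
    unfolding opnorm_def by (rule cSUP_upper2[where x = y]) (use y in simp_all)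
  moreover have "T y = vscale M (complex_of_real (1 / mnorm M x)) (T x)"
    using adjoint_linear(2)[OF T x x] by (simp add: y_def)
  ultimately show ?thesis
    using px adjoint_closed(1)[OF T x] by (simp add: nrm_scale norm_divide field_simps)
qed

lemma adjointable_ops_apply [simp]:
  assumes "x \<in> carrier M"
  shows "vadd (adjointable_ops M) T T' x = vadd M (T x) (T' x)"
    "vscale (adjointable_ops M) c T x = vscale M c (T x)"
    "vzero (adjointable_ops M) x = vzero M"
    "vdiff (adjointable_ops M) T T' x = vdiff M (T x) (T' x)"
  using assms by (simp_all add: adjointable_ops_def vdiff_def)

lemma adjoint_extensional: "is_adjoint M T S \<Longrightarrow> T \<in> extensional (carrier M)"
  by (auto simp: is_adjoint_def PiE_def)

lemma adjoint_vzero: "is_adjoint M (vzero (adjointable_ops M)) (vzero (adjointable_ops M))"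
  by (auto simp: is_adjoint_def) (auto simp: adjointable_ops_def)

lemma adjoint_vadd:
  assumes "is_adjoint M T S" "is_adjoint M T' S'"
  shows "is_adjoint M (vadd (adjointable_ops M) T T') (vadd (adjointable_ops M) S S')"
proof -
  note [simp] = adjoint_closed[OF assms(1)] adjoint_closed[OF assms(2)]
  show ?thesis unfolding is_adjoint_def
    by (auto simp: adjoint_ip[OF assms(1)] adjoint_ip[OF assms(2)]) (auto simp: adjointable_ops_def)
qed

lemma adjoint_vscale:
  assumes "is_adjoint M T S"
  shows "is_adjoint M (vscale (adjointable_ops M) c T) (vscale (adjointable_ops M) (cnj c) S)"
proof -
  note [simp] = adjoint_closed[OF assms(1)]
  show ?thesis unfolding is_adjoint_def
    by (auto simp: adjoint_ip[OF assms(1)]) (auto simp: adjointable_ops_def)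
qed

lemma rank_one_apply [simp]: "z \<in> carrier M \<Longrightarrow> rank_one M x y z = ract M x (ip M y z)"
  by (simp add: rank_one_def)

lemma adjoint_rank_one:
  "x \<in> carrier M \<Longrightarrow> y \<in> carrier M \<Longrightarrow> is_adjoint M (rank_one M x y) (rank_one M y x)"
  by (auto simp: is_adjoint_def star_mult star_ip) (auto simp: rank_one_def)

lemma adjoint_vspan:
  assumes "T \<in> vspan (adjointable_ops M) X" "\<And>T. T \<in> X \<Longrightarrow> \<exists>S. is_adjoint M T S"
  shows "\<exists>S. is_adjoint M T S"
  using assms(1) by induction (use assms(2) adjoint_vzero adjoint_vadd adjoint_vscale in blast)+

abbreviation finite_rank_ops :: "('m \<Rightarrow> 'm) set" where
  "finite_rank_ops \<equiv> vspan (adjointable_ops M) {rank_one M x y | x y. x \<in> carrier M \<and> y \<in> carrier M}"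

text \<open>Replaces the operator norm by pointwise estimates, in which compactness is expressed
  from here on.\<close>

lemma mem_compact_ops_iff:
  "T \<in> compact_ops M \<longleftrightarrow> (\<exists>S. is_adjoint M T S) \<and>
    (\<forall>e>0. \<exists>W\<in>finite_rank_ops.
      \<forall>x\<in>carrier M. mnorm M (vdiff M (T x) (W x)) \<le> e * mnorm M x)"
  (is "_ \<longleftrightarrow> _ \<and> (\<forall>e>0. \<exists>W\<in>_. ?B e W)")
proof (intro iffI conjI allI impI)
  have adj: "\<exists>S. is_adjoint M W S" if "W \<in> finite_rank_ops" for W
    using adjoint_vspan[OF that] adjoint_rank_one by blast
  {
    assume T: "T \<in> compact_ops M"
    then show S: "\<exists>S. is_adjoint M T S"
      by (simp add: compact_ops_def closed_vspan_def adjointable_ops_def)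
    fix e :: real assume "e > 0"
    with T obtain W where W: "W \<in> finite_rank_ops" "opnorm M (vdiff (adjointable_ops M) T W) < e"
      by (auto simp: compact_ops_def closed_vspan_def)
    from S adj[OF W(1)] have "\<exists>R. is_adjoint M (vdiff (adjointable_ops M) T W) R"
      unfolding vdiff_def using adjoint_vadd adjoint_vscale by blast
    then obtain R where R: "is_adjoint M (vdiff (adjointable_ops M) T W) R" by blast
    have "?B e W"
    proof
      fix x assume x: "x \<in> carrier M"
      have "mnorm M (vdiff M (T x) (W x)) \<le> opnorm M (vdiff (adjointable_ops M) T W) * mnorm M x"
        using le_opnorm[OF R x] x by simp
      also have "\<dots> \<le> e * mnorm M x" using W(2) by (intro mult_right_mono) simp_all
      finally show "mnorm M (vdiff M (T x) (W x)) \<le> e * mnorm M x" .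
    qed
    with W show "\<exists>W\<in>finite_rank_ops. ?B e W" by blast
  }
  {
    assume T: "(\<exists>S. is_adjoint M T S) \<and> (\<forall>e>0. \<exists>W\<in>finite_rank_ops. ?B e W)"
    have "\<exists>W\<in>finite_rank_ops. opnorm M (vdiff (adjointable_ops M) T W) < e" if "e > 0" for e
    proof -
      have "e / 2 > 0" using that by simp
      then obtain W where W: "W \<in> finite_rank_ops" "?B (e/2) W" using T by meson
      have "opnorm M (vdiff (adjointable_ops M) T W) \<le> e / 2"
        by (rule opnorm_le) (use W that in auto)
      with W that show ?thesis by force
    qed
    with T show "T \<in> compact_ops M"
      by (simp add: compact_ops_def closed_vspan_def adjointable_ops_def)
  }
qed

lemma compact_ops_adjoint: "T \<in> compact_ops M \<Longrightarrow> \<exists>S. is_adjoint M T S"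
  by (simp add: mem_compact_ops_iff)

lemma vspan_rank_one_compact:
  assumes "T \<in> finite_rank_ops"
  shows "T \<in> compact_ops M"
proof -
  obtain S where S: "is_adjoint M T S" using adjoint_vspan[OF assms] adjoint_rank_one by blast
  have "mnorm M (vdiff M (T x) (T x)) \<le> e * mnorm M x" if "x \<in> carrier M" "e > 0" for x e
    using dst_self[OF adjoint_closed(1)[OF S that(1)]] that(2) by simp
  with assms S show ?thesis unfolding mem_compact_ops_iff by blast
qed

lemma rank_one_compact: "x \<in> carrier M \<Longrightarrow> y \<in> carrier M \<Longrightarrow> rank_one M x y \<in> compact_ops M"
  by (intro vspan_rank_one_compact vspan_base) blast

end

section \<open>Correspondences\<close>

context correspondence
begin

lemma left_mult_apply: "x \<in> carrier M \<Longrightarrow> left_mult M a x = lact M a x"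
  by (simp add: left_mult_def)

lemma adjoint_left_mult: "is_adjoint M (left_mult M a) (left_mult M (star a))"
  using representation by (simp add: star_representation_def)

lemma lact_closed [simp]: "x \<in> carrier M \<Longrightarrow> lact M a x \<in> carrier M"
  using adjoint_closed(1)[OF adjoint_left_mult] by (simp add: left_mult_apply)

lemma ip_lact: "x \<in> carrier M \<Longrightarrow> y \<in> carrier M \<Longrightarrow> ip M x (lact M a y) = ip M (lact M (star a) x) y"
  using adjoint_ip(2)[OF adjoint_left_mult] by (simp add: left_mult_apply)

lemma lact_simps [simp]:
  assumes "x \<in> carrier M"
  shows "lact M (a + a') x = vadd M (lact M a x) (lact M a' x)"
    "lact M (scaleC c a) x = vscale M c (lact M a x)"
    "lact M (a * a') x = lact M a (lact M a' x)"
proof -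
  from representation have "left_mult M (a + a') = vadd (adjointable_ops M) (left_mult M a) (left_mult M a')"
    "left_mult M (scaleC c a) = vscale (adjointable_ops M) c (left_mult M a)"
    "left_mult M (a * a') = compose (carrier M) (left_mult M a) (left_mult M a')"
    by (simp_all add: star_representation_def)
  from this[THEN fun_cong, of x] assms
  show "lact M (a + a') x = vadd M (lact M a x) (lact M a' x)"
    "lact M (scaleC c a) x = vscale M c (lact M a x)"
    "lact M (a * a') x = lact M a (lact M a' x)"
    by (simp_all add: left_mult_apply compose_eq)
qed

lemma lact_linear [simp]:
  "x \<in> carrier M \<Longrightarrow> y \<in> carrier M \<Longrightarrow> lact M a (vadd M x y) = vadd M (lact M a x) (lact M a y)"
  "x \<in> carrier M \<Longrightarrow> lact M a (vscale M c x) = vscale M c (lact M a x)"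
  "x \<in> carrier M \<Longrightarrow> lact M a (ract M x b) = ract M (lact M a x) b"
  "x \<in> carrier M \<Longrightarrow> y \<in> carrier M \<Longrightarrow> lact M a (vdiff M x y) = vdiff M (lact M a x) (lact M a y)"
  using adjoint_linear[OF adjoint_left_mult, of x y] adjoint_linear[OF adjoint_left_mult, of x x]
  by (simp_all add: left_mult_apply)

lemma lact_vzero [simp]: "lact M a (vzero M) = vzero M"
  using adjoint_linear(4)[OF adjoint_left_mult vzero_closed vzero_closed] by (simp add: left_mult_apply)

lemma lact_diff: "x \<in> carrier M \<Longrightarrow> lact M (a - a') x = vdiff M (lact M a x) (lact M a' x)"
proof -
  assume x: "x \<in> carrier M"
  have "lact M (a - a') x = lact M (a + scaleC (- 1) a') x"
    by (simp add: complex_vector.scale_minus_left)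
  then show ?thesis using x by (simp only: lact_simps vdiff_def)
qed

text \<open>The roots used in the estimates, such as that of \<open>t^2 - star a * a\<close>, lie
  only in the unitization, so the action is extended to it, the unit acting as the identity.\<close>

definition lactu :: "'a unitization \<Rightarrow> 'm \<Rightarrow> 'm" where
  "lactu c x = vadd M (lact M (base c) x) (vscale M (scal c) x)"

lemma lactu_closed [simp]: "x \<in> carrier M \<Longrightarrow> lactu c x \<in> carrier M"
  by (simp add: lactu_def)

lemma ip_lactu: "x \<in> carrier M \<Longrightarrow> y \<in> carrier M \<Longrightarrow> ip M x (lactu c y) = ip M (lactu (star c) x) y"
  by (simp add: lactu_def ip_lact)

lemma lactu_mult: "x \<in> carrier M \<Longrightarrow> lactu (c * d) x = lactu c (lactu d x)"
  by (rule module_eqI) (simp_all add: lactu_def scaleC_add_right scaleC_scaleC algebra_simps)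

lemma lactu_add: "x \<in> carrier M \<Longrightarrow> lactu (c + d) x = vadd M (lactu c x) (lactu d x)"
  by (rule module_eqI) (simp_all add: lactu_def scaleC_add_left algebra_simps)

lemma lactu_scaleC: "x \<in> carrier M \<Longrightarrow> lactu (scaleC t c) x = vscale M t (lactu c x)"
  by (rule module_eqI) (simp_all add: lactu_def scaleC_scaleC scaleC_add_right)

lemma lactu_emb [simp]: "x \<in> carrier M \<Longrightarrow> lactu (emb a) x = lact M a x"
  by (rule module_eqI) (simp_all add: lactu_def)

lemma lactu_of_real: "x \<in> carrier M \<Longrightarrow> lactu (of_real r) x = vscale M (of_real r) x"
proof (rule module_eqI)
  fix z assume "z \<in> carrier M" "x \<in> carrier M"
  moreover have "lact M 0 x = vscale M 0 (lact M 0 x)"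
    using lact_simps(2)[OF \<open>x \<in> carrier M\<close>, of 0 0] by simp
  then have "ip M z (lact M 0 x) = ip M z (vscale M 0 (lact M 0 x))" by (rule arg_cong)
  ultimately show "ip M z (lactu (of_real r) x) = ip M z (vscale M (of_real r) x)"
    by (simp add: lactu_def)
qed simp_all

lemma lactu_vzero [simp]: "lactu c (vzero M) = vzero M"
  by (rule module_eqI) (simp_all add: lactu_def)

lemma ip_lactu_add: "x \<in> carrier M \<Longrightarrow> y \<in> carrier M \<Longrightarrow>
    ip M x (lactu (c + d) y) = ip M x (lactu c y) + ip M x (lactu d y)"
  by (simp add: lactu_add)

lemma ip_lactu_scaleC: "x \<in> carrier M \<Longrightarrow> y \<in> carrier M \<Longrightarrow>
    ip M x (lactu (scaleC t c) y) = scaleC t (ip M x (lactu c y))"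
  by (simp add: lactu_scaleC)

lemma ip_lactu_scaleR: "x \<in> carrier M \<Longrightarrow> y \<in> carrier M \<Longrightarrow>
    ip M x (lactu (r *\<^sub>R c) y) = r *\<^sub>R ip M x (lactu c y)"
  using ip_lactu_scaleC[of x y "of_real r" c] by (simp add: scaleC_of_real)

lemma ip_lactu_minus: "x \<in> carrier M \<Longrightarrow> y \<in> carrier M \<Longrightarrow>
    ip M x (lactu (- c) y) = - ip M x (lactu c y)"
  using ip_lactu_scaleR[of x y "- 1" c] by simp

lemma ip_lactu_diff: "x \<in> carrier M \<Longrightarrow> y \<in> carrier M \<Longrightarrow>
    ip M x (lactu (c - d) y) = ip M x (lactu c y) - ip M x (lactu d y)"
  using ip_lactu_add[of x y c "- d"] by (simp add: ip_lactu_minus)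

text \<open>With \<open>s\<close> the root of \<open>(norm c)\<^sup>2 - star c * c\<close>, the
  positive element \<open>ip M (lactu s x) (lactu s x)\<close> is the difference of the two sides of
  the squared inequality, before norms are taken.\<close>

lemma mnorm_lactu_le:
  assumes x: "x \<in> carrier M"
  shows "mnorm M (lactu c x) \<le> norm c * mnorm M x"
proof -
  obtain s where s: "star s = s" "s * s = of_real ((norm c)\<^sup>2) - star c * c"
    using norm_square_diff_sqrt[of c "norm c"] by blast
  have "ip M (lactu s x) (lactu s x) = ip M x (lactu (s * s) x)"
    using x by (simp add: lactu_mult ip_lactu[of x] s(1))
  also have "\<dots> = (norm c)\<^sup>2 *\<^sub>R ip M x x - ip M (lactu c x) (lactu c x)"
    using x by (simp add: s(2) ip_lactu_diff lactu_of_real scaleC_of_real lactu_mult ip_lactu[of x]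
        del: of_real_power)
  finally have "positive ((norm c)\<^sup>2 *\<^sub>R ip M x x - ip M (lactu c x) (lactu c x))"
    using inn_positive[of "lactu s x"] x by simp
  from positive_norm_mono[OF _ this] have "(mnorm M (lactu c x))\<^sup>2 \<le> (norm c * mnorm M x)\<^sup>2"
    using x inn_positive[of "lactu c x"] by (simp add: power_mult_distrib nrm_square)
  then show ?thesis by (rule power2_le_imp_le) simp
qed

lemma mnorm_lact_le: "x \<in> carrier M \<Longrightarrow> mnorm M (lact M a x) \<le> norm a * mnorm M x"
  using mnorm_lactu_le[of x "emb a"] by simp

end

section \<open>Faithful actions\<close>

locale faithful_correspondence = correspondence +
  assumes faithful: "(\<And>x. x \<in> carrier M \<Longrightarrow> lact M a x = vzero M) \<Longrightarrow> a = 0"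
begin

text \<open>If \<open>'a\<close> has a unit \<open>e\<close>, then \<open>1 - emb e\<close> acts as
  zero, so faithfulness of the extended action can be claimed only for scalar part zero.\<close>

lemma faithful_lactu:
  assumes "\<And>x. x \<in> carrier M \<Longrightarrow> lactu c x = vzero M" "scal c = 0"
  shows "c = 0"
proof -
  have c: "emb (base c) = c" using assms(2) by (rule emb_of_scal_zero)
  have "base c = 0"
    by (rule faithful) (use assms(1) lactu_emb[of _ "base c"] c in simp)
  with c show ?thesis by simp
qed

text \<open>
  If \<open>\<parallel>a\<parallel>\<^sup>2 > \<tau> > r\<^sup>2\<close>, then \<open>p = a\<^sup>*a\<close> is invertible on the range of the positive part \<open>d\<close> of
  \<open>p - \<tau>\<close>, with inverse \<open>(\<tau> + d)\<^sup>-\<^sup>1\<close> of norm at most \<open>1/\<tau>\<close>; so \<open>d\<close> acts as zero.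
\<close>

lemma norm_le_if_action_bounded:
  assumes r: "r \<ge> 0" and bound: "\<And>x. x \<in> carrier M \<Longrightarrow> mnorm M (lact M a x) \<le> r * mnorm M x"
  shows "norm a \<le> r"
proof (rule ccontr)
  assume "\<not> norm a \<le> r"
  then have "r\<^sup>2 < (norm a)\<^sup>2" using r by (simp add: power_strict_mono)
  then obtain \<tau> where \<tau>: "r\<^sup>2 < \<tau>" "\<tau> < (norm a)\<^sup>2" using dense by blast
  have \<tau>0: "\<tau> > 0" using \<tau>(1) zero_le_power2[of r] by linarith
  define p where "p = emb (star a * a)"
  have p: "nonneg p" "norm p = (norm a)\<^sup>2" "scal p = 0"
    by (simp_all add: p_def nonneg_star_mult_self c_star_identity[of "emb a"])
  have "star (p - of_real \<tau>) = p - of_real \<tau>" using nonnegD[OF p(1)] by (simp add: star_diff)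
  then obtain d q where d: "nonneg d" and q: "nonneg q" and dq: "p - of_real \<tau> = d - q"
      and qd: "q * d = 0"
    by (metis pos_neg_parts)
  obtain g s where g: "g * g = d + of_real \<tau>" and s: "s * g = 1" and ns: "norm (s * s) \<le> 1 / \<tau>"
    using nonneg_inverse[OF d \<tau>0] by metis
  have "(p - of_real \<tau>) * d = (d - q) * d" by (simp only: dq)
  then have pd: "p * d = (d + of_real \<tau>) * d" by (simp add: algebra_simps qd)
  have "s * s * (p * d) = s * (s * g) * g * d" by (simp only: pd mult.assoc flip: g)
  then have sspd: "s * s * (p * d) = d" by (simp add: s)
  \<comment> \<open>\<open>p\<close> involves \<open>star a\<close> as well as \<open>a\<close>; the
    bound passes to the adjoint by the usual estimate of
    \<open>ip M y (a (star a y))\<close>.\<close>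
  have star_bound: "mnorm M (lact M (star a) y) \<le> r * mnorm M y" if y: "y \<in> carrier M" for y
  proof (cases "mnorm M (lact M (star a) y) = 0")
    case False
    let ?z = "lact M (star a) y"
    have "(mnorm M ?z)\<^sup>2 = norm (ip M y (lact M a ?z))"
      using y by (simp add: nrm_square ip_lact[of y])
    also have "\<dots> \<le> mnorm M y * (r * mnorm M ?z)"
      using y by (intro order_trans[OF norm_inn_le] mult_left_mono bound) simp_all
    finally show ?thesis using False nrm_nonneg[of ?z] by (simp add: power2_eq_square mult_ac)
  qed (use r in simp)
  have dy: "lactu d y = vzero M" if y: "y \<in> carrier M" for y
  proof (rule ccontr)
    assume "lactu d y \<noteq> vzero M"
    then have pos: "mnorm M (lactu d y) > 0"
      using mnorm_eq_0[of "lactu d y"] y by (simp add: less_le)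
    have "mnorm M (lactu d y) = mnorm M (lactu (s * s) (lactu p (lactu d y)))"
      using y arg_cong[OF sspd, of "\<lambda>c. lactu c y"] by (simp add: lactu_mult)
    also have "\<dots> \<le> norm (s * s) * mnorm M (lactu p (lactu d y))"
      using y by (intro mnorm_lactu_le) simp
    also have "mnorm M (lactu p (lactu d y)) \<le> r * (r * mnorm M (lactu d y))"
      using y r unfolding p_def lactu_emb[OF lactu_closed[OF y]]
      by (simp only: lact_simps lactu_closed)
        (intro order_trans[OF star_bound] mult_left_mono bound; simp)
    then have "norm (s * s) * mnorm M (lactu p (lactu d y)) \<le> (1 / \<tau>) * (r * (r * mnorm M (lactu d y)))"
      using ns \<tau>0 by (intro mult_mono) simp_all
    finally have "\<tau> * mnorm M (lactu d y) \<le> r\<^sup>2 * mnorm M (lactu d y)"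
      using \<tau>0 by (simp add: field_simps power2_eq_square)
    with pos \<tau>(1) show False by simp
  qed
  \<comment> \<open>The factor \<open>p\<close> supplies the vanishing scalar part that
    \<open>faithful_lactu\<close> asks for.\<close>
  have "d * p = 0"
    by (rule faithful_lactu) (simp_all add: lactu_mult dy p(3))
  then have "star (d * p) = 0" by simp
  then have "p * d = 0" using nonnegD[OF p(1)] nonnegD[OF d] by (simp add: star_mult)
  with sspd have "d = 0" by simp
  have "of_real \<tau> - p = - (p - of_real \<tau>)" by simp
  also have "\<dots> = q" using dq \<open>d = 0\<close> by simp
  finally have "nonneg (of_real \<tau> - p)" using q by simp
  from norm_le_if_nonneg[OF p(1) this] \<tau> \<tau>0 p(2) show False by simp
qed

text \<open>With \<open>a = p - q\<close> one has \<open>q a q = - s * s\<close>, where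
  \<open>s\<close> is a root of \<open>q * q * q\<close>. Positivity at the vectors
  \<open>q y\<close> therefore forces \<open>s\<close> to act as zero. Then
  \<open>s * s * a\<close>, which is \<open>- q ^ 4\<close>, vanishes by faithfulness, and
  \<open>q = 0\<close>.\<close>

lemma positive_if_action_positive:
  assumes sa: "star a = a" and pos: "\<And>y. y \<in> carrier M \<Longrightarrow> positive (ip M y (lact M a y))"
  shows "positive a"
proof -
  have "star (emb a) = emb a" by (simp add: sa flip: emb_simps(8))
  then obtain p q where p: "nonneg p" and q: "nonneg q" and a: "emb a = p - q" and qp: "q * p = 0"
    by (metis pos_neg_parts)
  have sq: "star q = q" by (rule nonnegD[OF q])
  obtain s where s: "star s = s" "s * s = q * q * q" using nonneg_cube[OF q] .
  have q3: "q * emb a * q = - (s * s)" by (simp add: a s algebra_simps qp)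
  have sy: "lactu s y = vzero M" if y: "y \<in> carrier M" for y
  proof -
    have "ip M (lactu q y) (lact M a (lactu q y)) = ip M y (lactu (q * emb a * q) y)"
      using y by (simp add: lactu_mult ip_lactu[of y] sq)
    also have "\<dots> = - ip M (lactu s y) (lactu s y)"
      using y by (simp add: q3 ip_lactu_minus lactu_mult ip_lactu[of y] s(1))
    finally have "positive (- ip M (lactu s y) (lactu s y))"
      using pos[of "lactu q y"] y by simp
    with inn_positive[of "lactu s y"] y have "ip M (lactu s y) (lactu s y) = 0"
      by (intro positive_antisym) simp_all
    then show ?thesis using y by (simp add: ip_definite)
  qed
  have "s * (s * emb a) = 0"
  proof (rule faithful_lactu)
    fix y assume y: "y \<in> carrier M"
    have "lactu (s * (s * emb a)) y = lactu s (lactu s (lactu (emb a) y))"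
      using y by (simp only: lactu_mult lactu_closed)
    with y sy show "lactu (s * (s * emb a)) y = vzero M" by simp
  qed simp
  then have "q * q * q * (p - q) = 0" by (simp only: a mult.assoc[symmetric] s(2))
  then have "(q * q) * (q * q) = 0" by (simp add: algebra_simps qp)
  then have "norm (q * q) = 0"
    using norm_mult_self[of "q * q"] sq by (simp add: star_mult)
  then have "norm q = 0" using norm_mult_self[OF sq] by simp
  with p a show ?thesis by (simp add: positive_iff_nonneg_emb)
qed

end

section \<open>Interior tensor products\<close>

lemma double_sum_insert:
  fixes F :: "'i \<Rightarrow> 'i \<Rightarrow> 'a::ab_group_add"
  assumes "finite I" "a \<notin> I"
  shows "(\<Sum>i\<in>insert a I. \<Sum>j\<in>insert a I. F i j) =
    F a a + (\<Sum>j\<in>I. F a j) + (\<Sum>i\<in>I. F i a) + (\<Sum>i\<in>I. \<Sum>j\<in>I. F i j)"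
  using assms by (simp add: sum.distrib algebra_simps)

lemma double_sum_insert_upd:
  fixes F :: "'i \<Rightarrow> 'i \<Rightarrow> 'b \<Rightarrow> 'b \<Rightarrow> 'a::ab_group_add"
  assumes "finite I" "a \<notin> I"
  shows "(\<Sum>i\<in>insert a I. \<Sum>j\<in>insert a I. F i j ((c(a := u)) i) ((c(a := u)) j)) =
    F a a u u + (\<Sum>j\<in>I. F a j u (c j)) + (\<Sum>i\<in>I. F i a (c i) u) + (\<Sum>i\<in>I. \<Sum>j\<in>I. F i j (c i) (c j))"
proof -
  have "i \<noteq> a" if "i \<in> I" for i using that assms(2) by blast
  then show ?thesis
    unfolding double_sum_insert[OF assms] by (intro arg_cong2[of _ _ _ _ "(+)"] sum.cong) auto
qed

text \<open>
  The entrywise pairing of a positive definite kernel \<open>k\<close> with a completely positive matrix \<open>\<theta>\<close> of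
  linear maps, by induction on the size: the Schur complement of \<open>k\<^sub>a\<^sub>a + e\<close> is again positive definite,
  and what is split off is the value of \<open>\<theta>\<close> at \<open>c\<^sub>i\<^sup>*c\<^sub>j\<close> for \<open>c\<^sub>a = (k\<^sub>a\<^sub>a + e)\<^sup>1\<^sup>/\<^sup>2\<close>,
  \<open>c\<^sub>j = (k\<^sub>a\<^sub>a + e)\<^sup>-\<^sup>1\<^sup>/\<^sup>2k\<^sub>a\<^sub>j\<close>.
\<close>

lemma kernel_pairing_positive:
  fixes k :: "'i \<Rightarrow> 'i \<Rightarrow> 'b::unital_c_star_algebra" and \<theta> :: "'i \<Rightarrow> 'i \<Rightarrow> 'b \<Rightarrow> 'c::c_star_algebra"
  assumes "finite I"
    and "\<And>i j. i \<in> I \<Longrightarrow> j \<in> I \<Longrightarrow> star (k i j) = k j i"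
    and "\<And>b. nonneg (\<Sum>i\<in>I. \<Sum>j\<in>I. star (b i) * k i j * b j)"
    and "\<And>i j x y. i \<in> I \<Longrightarrow> j \<in> I \<Longrightarrow> \<theta> i j (x + y) = \<theta> i j x + \<theta> i j y"
    and "\<And>i j r x. i \<in> I \<Longrightarrow> j \<in> I \<Longrightarrow> \<theta> i j (r *\<^sub>R x) = r *\<^sub>R \<theta> i j x"
    and "\<And>b. positive (\<Sum>i\<in>I. \<Sum>j\<in>I. \<theta> i j (star (b i) * b j))"
  shows "positive (\<Sum>i\<in>I. \<Sum>j\<in>I. \<theta> i j (k i j))"
  using assms
proof (induction I arbitrary: k rule: finite_induct)
  case (insert a I)
  note fin = insert.hyps(1) and aI = insert.hyps(2) and IH = insert.IH and herm = insert.prems(1)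
    and pd = insert.prems(2) and \<theta>_add = insert.prems(3) and \<theta>_scale = insert.prems(4)
    and cp = insert.prems(5)
  note split_pd = double_sum_insert_upd[OF fin aI, of "\<lambda>i j x y. star x * k i j * y"]
    and split_cp = double_sum_insert_upd[OF fin aI, of "\<lambda>i j x y. \<theta> i j (star x * y)"]
  have \<theta>_0: "\<theta> i j 0 = 0" if "i \<in> insert a I" "j \<in> insert a I" for i j
    using \<theta>_scale[OF that, of 0 0] by simp
  have \<theta>_diff: "\<theta> i j (x - y) = \<theta> i j x - \<theta> i j y" if "i \<in> insert a I" "j \<in> insert a I" for i j x y
    using \<theta>_add[OF that, of x "- 1 *\<^sub>R y"] \<theta>_scale[OF that, of "- 1" y] by simp
  have "nonneg (k a a)"
    using pd[of "(\<lambda>_. 0)(a := 1)"] unfolding split_pd by simp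
  let ?t = "\<Sum>i\<in>insert a I. \<Sum>j\<in>insert a I. \<theta> i j (k i j)"
  \<comment> \<open>Adding \<open>e\<close> makes the diagonal entry invertible. The perturbation
    shows up only in the term \<open>\<theta> a a 1\<close> and disappears in the limit.\<close>
  have approx: "positive (?t + e *\<^sub>R \<theta> a a 1)" if e: "e > 0" for e
  proof -
    obtain g s where g: "star g = g" "g * g = k a a + of_real e" and s: "star s = s" "s * g = 1" "g * s = 1"
      using nonneg_inverse[OF \<open>nonneg (k a a)\<close> e] by metis
    define r where "r = s * s"
    have sr: "star r = r" by (simp add: r_def star_mult s)
    have "r * (k a a + of_real e) * r = s * (s * g) * (g * s) * s"
      by (simp only: r_def mult.assoc flip: g(2))
    then have "r * (k a a + of_real e) * r = r" by (simp add: s r_def)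
    then have rkr: "r * k a a * r = r - e *\<^sub>R (r * r)"
      by (simp add: algebra_simps of_real_def)
    define k' where "k' i j = k i j - k i a * r * k a j" for i j
    have "positive (\<Sum>i\<in>I. \<Sum>j\<in>I. \<theta> i j (k' i j))"
    proof (rule IH)
      show "star (k' i j) = k' j i" if "i \<in> I" "j \<in> I" for i j
        using that by (simp add: k'_def star_diff star_mult herm sr mult.assoc)
      show "nonneg (\<Sum>i\<in>I. \<Sum>j\<in>I. star (c i) * k' i j * c j)" for c
      proof -
        \<comment> \<open>The entry \<open>- (r * w)\<close> at \<open>a\<close> completes the
          square in the form given by \<open>pd\<close>. Because \<open>r\<close> inverts
          \<open>k a a + e\<close> and not \<open>k a a\<close>, a term
          \<open>- e star (r * w) * (r * w)\<close> is left over; its sign allows it to be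
          dropped.\<close>
        define w where "w = (\<Sum>j\<in>I. k a j * c j)"
        have sw: "star w = (\<Sum>i\<in>I. star (c i) * k i a)"
          unfolding w_def star_sum by (intro sum.cong) (simp_all add: star_mult herm)
        define q where "q = (\<Sum>i\<in>I. \<Sum>j\<in>I. star (c i) * k i j * c j)"
        have "(\<Sum>j\<in>I. star (- (r * w)) * k a j * c j) = star (- (r * w)) * w"
          unfolding w_def sum_distrib_left by (intro sum.cong) (simp_all add: mult.assoc)
        moreover have "(\<Sum>i\<in>I. star (c i) * k i a * - (r * w)) = star w * - (r * w)"
          unfolding sw sum_distrib_right by (intro sum.cong) (simp_all add: mult.assoc)
        moreover have "star (- (r * w)) * k a a * - (r * w) = star w * (r * k a a * r) * w"
          by (simp add: star_mult sr mult.assoc)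
        ultimately have "nonneg (star w * (r * k a a * r) * w + star (- (r * w)) * w + star w * - (r * w) + q)"
          using pd[of "c(a := - (r * w))"] unfolding split_pd q_def[symmetric] by simp
        moreover have "r * (k a a * (r * w)) = r * w - e *\<^sub>R (r * (r * w))"
          using arg_cong[OF rkr, of "\<lambda>x. x * w"] by (simp add: algebra_simps)
        ultimately have "nonneg (q - star w * r * w - e *\<^sub>R (star (r * w) * (r * w)))"
          by (simp add: star_mult sr algebra_simps)
        from nonneg_add[OF this nonneg_scaleR[OF nonneg_star_mult_self[of "r * w"], of e]] e
        have "nonneg (q - star w * r * w)" by simp
        also have "star w * r * w = (\<Sum>i\<in>I. \<Sum>j\<in>I. star (c i) * (k i a * r * k a j) * c j)"
          unfolding sw unfolding w_def sum_distrib_right sum_distrib_left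
          by (subst sum.swap) (simp add: mult.assoc)
        finally show ?thesis
          by (simp add: q_def k'_def algebra_simps sum_subtractf)
      qed
      show "positive (\<Sum>i\<in>I. \<Sum>j\<in>I. \<theta> i j (star (b i) * b j))" for b
        using cp[of "b(a := 0)"] unfolding split_cp by (simp add: \<theta>_0)
    qed (use \<theta>_add \<theta>_scale in auto)
    moreover have "positive (\<theta> a a (k a a + of_real e) + (\<Sum>j\<in>I. \<theta> a j (k a j)) + (\<Sum>i\<in>I. \<theta> i a (k i a)) +
        (\<Sum>i\<in>I. \<Sum>j\<in>I. \<theta> i j (k i a * r * k a j)))"
    proof -
      have 1: "star g * (s * k a j) = k a j" for j
        by (simp add: g(1) s flip: mult.assoc)
      have 2: "star (s * k a i) * g = k i a" if "i \<in> I" for i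
        using that by (simp add: star_mult herm s mult.assoc)
      have 3: "star (s * k a i) * (s * k a j) = k i a * r * k a j" if "i \<in> I" for i j
        using that by (simp add: star_mult herm s mult.assoc r_def)
      show ?thesis
        using cp[of "(\<lambda>j. s * k a j)(a := g)"] unfolding split_cp by (simp add: 1 2 3) (simp add: g)
    qed
    ultimately have "positive ((\<Sum>i\<in>I. \<Sum>j\<in>I. \<theta> i j (k' i j)) +
      (\<theta> a a (k a a + of_real e) + (\<Sum>j\<in>I. \<theta> a j (k a j)) + (\<Sum>i\<in>I. \<theta> i a (k i a)) +
        (\<Sum>i\<in>I. \<Sum>j\<in>I. \<theta> i j (k i a * r * k a j))))" by (rule positive_add)
    also have "(\<Sum>i\<in>I. \<Sum>j\<in>I. \<theta> i j (k' i j)) =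
        (\<Sum>i\<in>I. \<Sum>j\<in>I. \<theta> i j (k i j)) - (\<Sum>i\<in>I. \<Sum>j\<in>I. \<theta> i j (k i a * r * k a j))"
      by (simp add: k'_def \<theta>_diff sum_subtractf)
    also have "\<theta> a a (k a a + of_real e) = \<theta> a a (k a a) + e *\<^sub>R \<theta> a a 1"
      by (simp add: \<theta>_add \<theta>_scale of_real_def)
    finally show ?thesis
      unfolding double_sum_insert[OF fin aI] by (simp add: algebra_simps)
  qed
  have "(\<lambda>n. ?t + inverse (real (Suc n)) *\<^sub>R \<theta> a a 1) \<longlonglongrightarrow> ?t + 0 *\<^sub>R \<theta> a a 1"
    by (intro tendsto_intros LIMSEQ_inverse_real_of_nat)
  then have "(\<lambda>n. ?t + inverse (real (Suc n)) *\<^sub>R \<theta> a a 1) \<longlonglongrightarrow> ?t" by simp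
  then show ?case
    by (rule positive_limit[rotated]) (simp add: approx del: sum.insert)
qed simp

context hilbert_module
begin

lemma double_sum_ip_positive:
  assumes "finite I" "\<And>i. i \<in> I \<Longrightarrow> z i \<in> carrier M"
  shows "positive (\<Sum>i\<in>I. \<Sum>j\<in>I. ip M (z i) (z j))"
proof -
  have "\<exists>w\<in>carrier M. \<forall>x\<in>carrier M. ip M x w = (\<Sum>i\<in>I. ip M x (z i))"
    using assms
  proof (induction I rule: finite_induct)
    case empty
    show ?case by (rule bexI[of _ "vzero M"]) simp_all
  next
    case (insert a I)
    then obtain w where "w \<in> carrier M" "\<forall>x\<in>carrier M. ip M x w = (\<Sum>i\<in>I. ip M x (z i))" by auto
    with insert show ?case by (intro bexI[of _ "vadd M (z a) w"]) simp_all
  qed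
  then obtain w where w: "w \<in> carrier M" "\<And>x. x \<in> carrier M \<Longrightarrow> ip M x w = (\<Sum>i\<in>I. ip M x (z i))" by blast
  have "(\<Sum>i\<in>I. \<Sum>j\<in>I. ip M (z i) (z j)) = (\<Sum>i\<in>I. star (ip M w (z i)))"
    using assms(2) w by (intro sum.cong) (simp_all add: star_ip flip: w(2))
  also have "\<dots> = ip M w w"
    using w star_ip[OF w(1) w(1)] by (simp flip: star_sum)
  finally show ?thesis using inn_positive[OF w(1)] by simp
qed

text \<open>The kernel lemma is about unital algebras, so its test coefficients range over the
  unitization.\<close>

definition ractu :: "'m \<Rightarrow> 'b unitization \<Rightarrow> 'm" where
  "ractu x c = vadd M (ract M x (base c)) (vscale M (scal c) x)"

lemma ractu_closed: "x \<in> carrier M \<Longrightarrow> ractu x c \<in> carrier M"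
  by (simp add: ractu_def)

lemma emb_ip_ractu:
  assumes "x \<in> carrier M" "y \<in> carrier M"
  shows "emb (ip M (ractu x c) (ractu y d)) = star c * emb (ip M x y) * d"
  using assms by (simp_all add: ractu_def unitization_eq_iff algebra_simps mult_scaleC_left
      mult_scaleC_right scaleC_scaleC scaleC_add_right)

end

locale correspondence_pair = E: correspondence E + F: correspondence F
  for E :: "('a::c_star_algebra, 'b::c_star_algebra, 'm) corresp"
    and F :: "('b, 'c::c_star_algebra, 'n) corresp"
begin

definition tensors :: "('m \<times> 'n) list set" where
  "tensors = {f. set f \<subseteq> carrier E \<times> carrier F}"

definition tensor_act :: "('m \<times> 'n) list \<Rightarrow> 'c \<Rightarrow> ('m \<times> 'n) list" where
  "tensor_act f d = map (\<lambda>(x, y). (x, ract F y d)) f"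

definition tensor_lact :: "'a \<Rightarrow> ('m \<times> 'n) list \<Rightarrow> ('m \<times> 'n) list" where
  "tensor_lact a f = map (\<lambda>(x, y). (lact E a x, y)) f"

lemma tensors_nth: "f \<in> tensors \<Longrightarrow> i < length f \<Longrightarrow> fst (f ! i) \<in> carrier E \<and> snd (f ! i) \<in> carrier F"
  unfolding tensors_def using nth_mem by fastforce

lemma tensor_ip_eq: "tensor_ip E F f g =
  (\<Sum>i<length f. \<Sum>j<length g. ip F (snd (f ! i)) (lact F (ip E (fst (f ! i)) (fst (g ! j))) (snd (g ! j))))"
  unfolding tensor_ip_def by (simp add: sum_list_sum_nth atLeast0LessThan split_def)

lemma tensor_ip_star:
  assumes "f \<in> tensors" "g \<in> tensors"
  shows "star (tensor_ip E F f g) = tensor_ip E F g f"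
  unfolding tensor_ip_eq star_sum using tensors_nth[OF assms(1)] tensors_nth[OF assms(2)]
  by (subst sum.swap) (intro sum.cong refl, simp add: F.star_ip F.ip_lact E.star_ip)

text \<open>The kernel is \<open>ip E (x i) (x j)\<close>, and the matrix of maps sends
  \<open>b\<close> to \<open>ip F (y i) (b y j)\<close>. The two positivity hypotheses are the
  squared lengths of the sums of the \<open>x i b i\<close> and of the
  \<open>b i y i\<close>.\<close>

lemma tensor_ip_positive:
  assumes f: "f \<in> tensors"
  shows "positive (tensor_ip E F f f)"
proof -
  let ?I = "{..<length f}"
  define x where "x i = fst (f ! i)" for i
  define y where "y i = snd (f ! i)" for i
  have xy [simp]: "x i \<in> carrier E" "y i \<in> carrier F" if "i < length f" for i
    using tensors_nth[OF f that] by (simp_all add: x_def y_def)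
  have "positive (\<Sum>i\<in>?I. \<Sum>j\<in>?I. ip F (y i) (F.lactu (emb (ip E (x i) (x j))) (y j)))"
  proof (rule kernel_pairing_positive)
    show "nonneg (\<Sum>i\<in>?I. \<Sum>j\<in>?I. star (b i) * emb (ip E (x i) (x j)) * b j)" for b
    proof -
      have "(\<Sum>i\<in>?I. \<Sum>j\<in>?I. star (b i) * emb (ip E (x i) (x j)) * b j) =
          emb (\<Sum>i\<in>?I. \<Sum>j\<in>?I. ip E (E.ractu (x i) (b i)) (E.ractu (x j) (b j)))"
        by (simp add: linear_sum[OF bounded_linear.linear[OF bounded_linear_emb]] E.emb_ip_ractu)
      then show ?thesis
        using E.double_sum_ip_positive[of ?I "\<lambda>i. E.ractu (x i) (b i)"]
        by (simp add: E.ractu_closed positive_iff_nonneg_emb)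
    qed
    show "positive (\<Sum>i\<in>?I. \<Sum>j\<in>?I. ip F (y i) (F.lactu (star (b i) * b j) (y j)))" for b
      using F.double_sum_ip_positive[of ?I "\<lambda>i. F.lactu (b i) (y i)"]
      by (simp add: F.lactu_mult F.ip_lactu)
  qed (simp_all add: E.star_ip F.ip_lactu_add F.ip_lactu_scaleR flip: emb_simps(8))
  then show ?thesis
    unfolding tensor_ip_eq by (simp add: x_def[symmetric] y_def[symmetric])
qed

lemma tensor_scale_nth: "i < length f \<Longrightarrow> tensor_scale E c f ! i = (vscale E c (fst (f ! i)), snd (f ! i))"
  "length (tensor_scale E c f) = length f"
  by (simp_all add: tensor_scale_def split_def)

lemma tensor_act_nth: "i < length f \<Longrightarrow> tensor_act f d ! i = (fst (f ! i), ract F (snd (f ! i)) d)"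
  "length (tensor_act f d) = length f"
  by (simp_all add: tensor_act_def split_def)

lemma tensor_lact_nth: "i < length f \<Longrightarrow> tensor_lact a f ! i = (lact E a (fst (f ! i)), snd (f ! i))"
  "length (tensor_lact a f) = length f"
  by (simp_all add: tensor_lact_def split_def)

lemma scaleC_sum: "scaleC c (sum f A) = (\<Sum>i\<in>A. scaleC c (f i :: 'd::c_star_algebra))"
  by (rule complex_vector.scale_sum_right)

end

sublocale correspondence_pair \<subseteq> T: semi_inner tensors "(@)" "tensor_scale E" tensor_act "tensor_ip E F"
  rewrites dst_eq: "semi_inner.dst (@) (tensor_scale E) (tensor_ip E F) = tensor_dist E F"
proof -
  show si: "semi_inner tensors (@) (tensor_scale E) tensor_act (tensor_ip E F)"
  proof
    fix f g h :: "('m \<times> 'n) list" and c d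
    assume f: "f \<in> tensors"
    show "positive (tensor_ip E F f f)" using f by (rule tensor_ip_positive)
    show "tensor_scale E c f \<in> tensors" "tensor_act f d \<in> tensors"
      using f by (auto simp: tensors_def tensor_scale_def tensor_act_def)
    assume g: "g \<in> tensors"
    show "f @ g \<in> tensors" using f g by (auto simp: tensors_def)
    show "star (tensor_ip E F f g) = tensor_ip E F g f" using f g by (rule tensor_ip_star)
    show "tensor_ip E F f (g @ h) = tensor_ip E F f g + tensor_ip E F f h"
      by (simp add: tensor_ip_def split_def sum_list_addf)
    show "tensor_ip E F f (tensor_scale E c g) = scaleC c (tensor_ip E F f g)"
      unfolding tensor_ip_eq tensor_scale_nth(2) scaleC_sum
      using tensors_nth[OF f] tensors_nth[OF g]
      by (intro sum.cong refl) (simp add: tensor_scale_nth)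
    show "tensor_ip E F f (tensor_act g d) = tensor_ip E F f g * d"
      unfolding tensor_ip_eq tensor_act_nth(2) sum_distrib_right
      using tensors_nth[OF f] tensors_nth[OF g]
      by (intro sum.cong refl) (simp add: tensor_act_nth)
  qed
  show "semi_inner.dst (@) (tensor_scale E) (tensor_ip E F) = tensor_dist E F"
    by (simp add: fun_eq_iff semi_inner.dst_def[OF si] semi_inner.nrm_def[OF si] tensor_dist_def Let_def)
qed

context semi_inner
begin

text \<open>Preservation of inner products already forces linearity: when
  \<open>star (d - e) * (d - e)\<close> is expanded for the two sides \<open>d\<close> and
  \<open>e\<close>, all terms are inner products and cancel.\<close>

lemma isometry_linear:
  assumes V: "\<And>x y. x \<in> S \<Longrightarrow> y \<in> S \<Longrightarrow> star (V x) * V y = inn x y"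
  shows "x \<in> S \<Longrightarrow> y \<in> S \<Longrightarrow> V (add x y) = V x + V y"
    and "x \<in> S \<Longrightarrow> V (scale c x) = scaleC c (V x)"
    and "x \<in> S \<Longrightarrow> V (act x b) = V x * b"
    and "x \<in> S \<Longrightarrow> y \<in> S \<Longrightarrow> norm (V x - V y) = dst x y"
proof -
  have eq: "d = e" if "star (d - e) * (d - e) = 0" for d e :: 'b
    using c_star_identity[of "d - e"] that by simp
  show add: "V (add x y) = V x + V y" if "x \<in> S" "y \<in> S" for x y
    by (rule eq) (use that in \<open>simp add: star_diff star_add algebra_simps V\<close>)
  show scale: "V (scale c x) = scaleC c (V x)" if "x \<in> S" for c x
    by (rule eq) (use that in \<open>simp add: star_diff star_scaleC algebra_simps V mult_scaleC_left mult_scaleC_right\<close>)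
  show "V (act x b) = V x * b" if "x \<in> S"
  proof (rule eq)
    have 1: "star (V x) * (V x * b) = inn x x * b" "star (V (act x b)) * (V x * b) = inn (act x b) x * b"
      using that by (simp_all add: V flip: mult.assoc)
    then show "star (V (act x b) - V x * b) * (V (act x b) - V x * b) = 0"
      using that by (simp add: star_diff star_mult algebra_simps V)
  qed
  show "norm (V x - V y) = dst x y" if "x \<in> S" "y \<in> S"
  proof (rule power2_eq_imp_eq)
    have "V x - V y = V (add x (scale (- 1) y))"
      using that by (simp add: add scale complex_vector.scale_minus_left)
    then show "(norm (V x - V y))\<^sup>2 = (dst x y)\<^sup>2"
      using that by (simp add: dst_def nrm_square V flip: c_star_identity)
  qed simp_all
qed

end

lemma (in correspondence) ip_lact_scaleR:
  "x \<in> carrier M \<Longrightarrow> y \<in> carrier M \<Longrightarrow> ip M x (lact M (r *\<^sub>R a) y) = r *\<^sub>R ip M x (lact M a y)"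
  using ip_lactu_scaleR[of x y r "emb a"] by (simp flip: emb_simps(7))

section \<open>The completed quotient\<close>

context correspondence_pair
begin

definition cls :: "(nat \<Rightarrow> ('m \<times> 'n) list) \<Rightarrow> (nat \<Rightarrow> ('m \<times> 'n) list) set" where
  "cls s = tensor_rel E F `` {s}"

lemma tensor_cauchy_iff: "s \<in> tensor_cauchy E F \<longleftrightarrow> (\<forall>n. s n \<in> tensors) \<and>
    (\<forall>e>0. \<exists>N. \<forall>m\<ge>N. \<forall>n\<ge>N. tensor_dist E F (s m) (s n) < e)"
  by (simp add: tensor_cauchy_def tensors_def)

lemma tensor_cauchy_closed: "s \<in> tensor_cauchy E F \<Longrightarrow> s n \<in> tensors"
  by (simp add: tensor_cauchy_iff)

lemma tensor_cauchy_const: "f \<in> tensors \<Longrightarrow> (\<lambda>_. f) \<in> tensor_cauchy E F"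
  by (simp add: tensor_cauchy_iff T.dst_self)

lemma tensor_rel_iff: "(s, t) \<in> tensor_rel E F \<longleftrightarrow> s \<in> tensor_cauchy E F \<and> t \<in> tensor_cauchy E F \<and>
    (\<lambda>n. tensor_dist E F (s n) (t n)) \<longlonglongrightarrow> 0"
  by (simp add: tensor_rel_def)

lemma equiv_tensor_rel: "equiv (tensor_cauchy E F) (tensor_rel E F)"
proof (rule equivI)
  show "tensor_rel E F \<subseteq> tensor_cauchy E F \<times> tensor_cauchy E F" by (auto simp: tensor_rel_iff)
  show "refl_on (tensor_cauchy E F) (tensor_rel E F)"
    by (auto simp: refl_on_def tensor_rel_iff T.dst_self tensor_cauchy_closed)
  show "sym (tensor_rel E F)"
    by (auto simp: sym_def tensor_rel_iff T.dst_commute tensor_cauchy_closed)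
  show "trans (tensor_rel E F)"
  proof (rule transI)
    fix s t r assume st: "(s, t) \<in> tensor_rel E F" and tr: "(t, r) \<in> tensor_rel E F"
    have "(\<lambda>n. tensor_dist E F (s n) (t n) + tensor_dist E F (t n) (r n)) \<longlonglongrightarrow> 0 + 0"
      using st tr by (intro tendsto_add) (auto simp: tensor_rel_iff)
    then have sum0: "(\<lambda>n. tensor_dist E F (s n) (t n) + tensor_dist E F (t n) (r n)) \<longlonglongrightarrow> 0" by simp
    have "(\<lambda>n. tensor_dist E F (s n) (r n)) \<longlonglongrightarrow> 0"
    proof (rule Lim_null_comparison[OF always_eventually sum0], rule allI)
      fix n
      have "s n \<in> tensors" "t n \<in> tensors" "r n \<in> tensors"
        using st tr by (simp_all add: tensor_rel_iff tensor_cauchy_iff)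
      then show "norm (tensor_dist E F (s n) (r n)) \<le> tensor_dist E F (s n) (t n) + tensor_dist E F (t n) (r n)"
        using T.dst_triangle[of "s n" "t n" "r n"] by simp
    qed
    with st tr show "(s, r) \<in> tensor_rel E F" by (simp add: tensor_rel_iff)
  qed
qed

lemma mem_cls: "t \<in> cls s \<longleftrightarrow> (s, t) \<in> tensor_rel E F"
  by (simp add: cls_def)

lemma cls_self: "s \<in> tensor_cauchy E F \<Longrightarrow> s \<in> cls s"
  by (simp add: mem_cls tensor_rel_iff T.dst_self tensor_cauchy_closed)

lemma cls_eq: "(s, t) \<in> tensor_rel E F \<Longrightarrow> cls s = cls t"
  unfolding cls_def by (rule equiv_class_eq[OF equiv_tensor_rel])

lemma carrier_interior_tensor:
  "X \<in> carrier (E \<odot> F) \<longleftrightarrow> (\<exists>s\<in>tensor_cauchy E F. X = cls s)"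
  by (auto simp: interior_tensor_def cls_def quotient_def)

lemma UN_cls:
  assumes "s \<in> tensor_cauchy E F" "\<And>s'. s' \<in> cls s \<Longrightarrow> cls (G s') = X"
  shows "(\<Union>s'\<in>cls s. cls (G s')) = X"
  using assms cls_self by blast

lemma UN_cls2:
  assumes "s \<in> tensor_cauchy E F" "t \<in> tensor_cauchy E F"
    "\<And>s' t'. s' \<in> cls s \<Longrightarrow> t' \<in> cls t \<Longrightarrow> cls (G s' t') = X"
  shows "(\<Union>s'\<in>cls s. \<Union>t'\<in>cls t. cls (G s' t')) = X"
  using assms cls_self by blast

text \<open>Constant sequences are all that is required to read off how a pairing transforms under
  the left action. Independence of the representative rests on \<open>dist\<close>: letting a root
  of \<open>(norm a)\<^sup>2 - star a * a\<close> act on the first factors yields a formal sum whose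
  positive square is the difference of the squared lengths.\<close>

lemma lact_cls_const:
  assumes f: "f \<in> tensors"
  shows "lact (E \<odot> F) a (cls (\<lambda>_. f)) = cls (\<lambda>_. tensor_lact a f)"
proof -
  have closed: "tensor_lact a f \<in> tensors" if "f \<in> tensors" for f a
    using that by (auto simp: tensors_def tensor_lact_def)
  have dist: "tensor_dist E F (tensor_lact a f) (tensor_lact a g) \<le> norm a * tensor_dist E F f g"
    if f: "f \<in> tensors" and g: "g \<in> tensors" for f g
  proof -
    define h where "h = f @ tensor_scale E (- 1) g"
    have h: "h \<in> tensors" using f g by (simp add: h_def)
    have "tensor_lact a (tensor_scale E (- 1) g) = tensor_scale E (- 1) (tensor_lact a g)"
      using g by (auto simp: tensor_lact_def tensor_scale_def tensors_def)
    then have ah: "tensor_lact a h = tensor_lact a f @ tensor_scale E (- 1) (tensor_lact a g)"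
      by (simp add: h_def) (simp add: tensor_lact_def)
    obtain s where s: "star s = s" "s * s = of_real ((norm (emb a))\<^sup>2) - star (emb a) * emb a"
      using norm_square_diff_sqrt[of "emb a" "norm (emb a)"] by blast
    define sh where "sh = map (\<lambda>(x, y). (E.lactu s x, y)) h"
    have sh: "sh \<in> tensors" using h by (auto simp: sh_def tensors_def)
    have ip: "ip E (E.lactu s x) (E.lactu s x') =
        (norm a)\<^sup>2 *\<^sub>R ip E x x' - ip E (lact E a x) (lact E a x')"
      if "x \<in> carrier E" "x' \<in> carrier E" for x x'
    proof -
      have "ip E (E.lactu s x) (E.lactu s x') = ip E x (E.lactu (s * s) x')"
        using that by (simp add: E.lactu_mult E.ip_lactu[of x] s(1))
      also have "\<dots> = (norm a)\<^sup>2 *\<^sub>R ip E x x' - ip E x (E.lactu (star (emb a) * emb a) x')"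
        using that by (simp add: s(2) E.ip_lactu_diff E.lactu_of_real scaleC_of_real del: of_real_power)
      also have "ip E x (E.lactu (star (emb a) * emb a) x') = ip E (lact E a x) (lact E a x')"
        using that by (simp add: E.lactu_mult E.ip_lactu[of x])
      finally show ?thesis .
    qed
    have "tensor_ip E F sh sh = (norm a)\<^sup>2 *\<^sub>R tensor_ip E F h h - tensor_ip E F (tensor_lact a h) (tensor_lact a h)"
    proof -
      have "ip F y (lact F (ip E (E.lactu s x) (E.lactu s x')) y') =
          (norm a)\<^sup>2 *\<^sub>R ip F y (lact F (ip E x x') y') - ip F y (lact F (ip E (lact E a x) (lact E a x')) y')"
        if "x \<in> carrier E" "x' \<in> carrier E" "y \<in> carrier F" "y' \<in> carrier F" for x x' y y'
        using that by (simp add: ip F.lact_diff F.ip_lact_scaleR)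
      then show ?thesis
        unfolding tensor_ip_eq tensor_lact_nth(2) scaleR_right.sum sum_subtractf[symmetric]
        using tensors_nth[OF h] by (intro sum.cong) (auto simp: sh_def tensor_lact_nth split_def)
    qed
    with tensor_ip_positive[OF sh] have "positive ((norm a)\<^sup>2 *\<^sub>R tensor_ip E F h h -
        tensor_ip E F (tensor_lact a h) (tensor_lact a h))" by simp
    from positive_norm_mono[OF tensor_ip_positive[OF closed[OF h]] this]
    have "norm (tensor_ip E F (tensor_lact a h) (tensor_lact a h)) \<le> (norm a)\<^sup>2 * norm (tensor_ip E F h h)"
      by simp
    from real_sqrt_le_mono[OF this] show ?thesis
      by (simp add: tensor_dist_def Let_def h_def[symmetric] ah[symmetric] real_sqrt_mult)
  qed
  have "cls (\<lambda>n. tensor_lact a (s n)) = cls (\<lambda>_. tensor_lact a f)" if s: "s \<in> cls (\<lambda>_. f)" for s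
  proof (rule cls_eq[symmetric])
    from s have sC: "s \<in> tensor_cauchy E F" and lim: "(\<lambda>n. tensor_dist E F f (s n)) \<longlonglongrightarrow> 0"
      by (simp_all add: mem_cls tensor_rel_iff)
    note sT = tensor_cauchy_closed[OF sC]
    have "(\<lambda>n. tensor_lact a (s n)) \<in> tensor_cauchy E F"
      unfolding tensor_cauchy_iff
    proof (intro conjI allI impI)
      fix e :: real assume "e > 0"
      then have "e / (norm a + 1) > 0" by (simp add: add_nonneg_pos)
      with sC obtain N where N: "\<And>m n. m \<ge> N \<Longrightarrow> n \<ge> N \<Longrightarrow> tensor_dist E F (s m) (s n) < e / (norm a + 1)"
        unfolding tensor_cauchy_iff by metis
      have "tensor_dist E F (tensor_lact a (s m)) (tensor_lact a (s n)) < e" if "m \<ge> N" "n \<ge> N" for m n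
      proof -
        have "tensor_dist E F (tensor_lact a (s m)) (tensor_lact a (s n)) \<le> norm a * tensor_dist E F (s m) (s n)"
          by (rule dist[OF sT sT])
        also have "\<dots> \<le> (norm a + 1) * tensor_dist E F (s m) (s n)"
          using T.dst_nonneg by (intro mult_right_mono) auto
        also have "\<dots> < e"
          using N[OF that] norm_ge_zero[of a] by (simp add: pos_less_divide_eq mult.commute)
        finally show ?thesis .
      qed
      then show "\<exists>N. \<forall>m\<ge>N. \<forall>n\<ge>N. tensor_dist E F (tensor_lact a (s m)) (tensor_lact a (s n)) < e" by blast
    qed (rule closed[OF sT])
    moreover have "(\<lambda>n. tensor_dist E F (tensor_lact a f) (tensor_lact a (s n))) \<longlonglongrightarrow> 0"
    proof (rule Lim_null_comparison)
      show "\<forall>\<^sub>F n in sequentially. norm (tensor_dist E F (tensor_lact a f) (tensor_lact a (s n)))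
          \<le> norm a * tensor_dist E F f (s n)"
        using dist[OF f sT] T.dst_nonneg by (intro always_eventually) auto
      show "(\<lambda>n. norm a * tensor_dist E F f (s n)) \<longlonglongrightarrow> 0"
        using tendsto_mult_right_zero[OF lim] .
    qed
    ultimately show "((\<lambda>_. tensor_lact a f), \<lambda>n. tensor_lact a (s n)) \<in> tensor_rel E F"
      using tensor_cauchy_const[OF closed[OF f]] by (simp add: tensor_rel_iff)
  qed
  from UN_cls[OF tensor_cauchy_const[OF f], of "\<lambda>s n. tensor_lact a (s n)", OF this]
  show ?thesis
    by (simp add: interior_tensor_def cls_def tensor_lact_def)
qed

text \<open>The inner product is a definite description over all pairs of representatives, so the
  limit must be shown not to depend on them. Seminorms along a Cauchy sequence are bounded, and
  \<open>norm_inn_diff_le\<close> does the rest.\<close>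

lemma ip_cls:
  assumes s: "s \<in> tensor_cauchy E F" and t: "t \<in> tensor_cauchy E F"
    and lim: "(\<lambda>n. tensor_ip E F (s n) (t n)) \<longlonglongrightarrow> d"
  shows "ip (E \<odot> F) (cls s) (cls t) = d"
proof -
  have bdd: "\<exists>B. \<forall>n. T.nrm (r n) \<le> B" if r: "r \<in> tensor_cauchy E F" for r
  proof -
    have "Cauchy (\<lambda>n. T.nrm (r n))"
    proof (rule CauchyI)
      fix e :: real assume "e > 0"
      with r obtain N where N: "\<And>m n. m \<ge> N \<Longrightarrow> n \<ge> N \<Longrightarrow> tensor_dist E F (r m) (r n) < e"
        unfolding tensor_cauchy_iff by metis
      have "norm (T.nrm (r m) - T.nrm (r n)) < e" if "m \<ge> N" "n \<ge> N" for m n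
        using N[OF that] N[OF that(2,1)]
          T.nrm_le_dst[OF tensor_cauchy_closed[OF r] tensor_cauchy_closed[OF r], of m n]
          T.nrm_le_dst[OF tensor_cauchy_closed[OF r] tensor_cauchy_closed[OF r], of n m] by simp
      then show "\<exists>N. \<forall>m\<ge>N. \<forall>n\<ge>N. norm (T.nrm (r m) - T.nrm (r n)) < e" by blast
    qed
    then have "Bseq (\<lambda>n. T.nrm (r n))" by (rule Cauchy_Bseq)
    then show ?thesis unfolding Bseq_def by fastforce
  qed
  have uniq: "d' = d" if s': "s' \<in> cls s" and t': "t' \<in> cls t"
    and lim': "(\<lambda>n. tensor_ip E F (s' n) (t' n)) \<longlonglongrightarrow> d'" for s' t' d'
  proof -
    from s' t' have s'C: "s' \<in> tensor_cauchy E F" and t'C: "t' \<in> tensor_cauchy E F"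
      and ss: "(\<lambda>n. tensor_dist E F (s n) (s' n)) \<longlonglongrightarrow> 0" and tt: "(\<lambda>n. tensor_dist E F (t n) (t' n)) \<longlonglongrightarrow> 0"
      by (simp_all add: mem_cls tensor_rel_iff)
    obtain A B where AB: "\<And>n. T.nrm (t n) \<le> A" "\<And>n. T.nrm (s' n) \<le> B"
      using bdd[OF t] bdd[OF s'C] by blast
    note cl = tensor_cauchy_closed[OF s] tensor_cauchy_closed[OF t]
      tensor_cauchy_closed[OF s'C] tensor_cauchy_closed[OF t'C]
    have "(\<lambda>n. tensor_ip E F (s n) (t n) - tensor_ip E F (s' n) (t' n)) \<longlonglongrightarrow> 0"
    proof (rule Lim_null_comparison)
      show "\<forall>\<^sub>F n in sequentially. norm (tensor_ip E F (s n) (t n) - tensor_ip E F (s' n) (t' n))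
          \<le> tensor_dist E F (s n) (s' n) * A + B * tensor_dist E F (t n) (t' n)"
      proof (intro always_eventually allI)
        fix n
        have "norm (tensor_ip E F (s n) (t n) - tensor_ip E F (s' n) (t' n))
            \<le> tensor_dist E F (s n) (s' n) * T.nrm (t n) + T.nrm (s' n) * tensor_dist E F (t n) (t' n)"
          by (intro T.norm_inn_diff_le cl)
        also have "\<dots> \<le> tensor_dist E F (s n) (s' n) * A + B * tensor_dist E F (t n) (t' n)"
          using T.dst_nonneg by (intro add_mono mult_left_mono mult_right_mono AB)
        finally show "norm (tensor_ip E F (s n) (t n) - tensor_ip E F (s' n) (t' n))
          \<le> tensor_dist E F (s n) (s' n) * A + B * tensor_dist E F (t n) (t' n)" .
      qed
      show "(\<lambda>n. tensor_dist E F (s n) (s' n) * A + B * tensor_dist E F (t n) (t' n)) \<longlonglongrightarrow> 0"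
        using tendsto_add[OF tendsto_mult_left_zero[OF ss] tendsto_mult_right_zero[OF tt]] by simp
    qed
    moreover have "(\<lambda>n. tensor_ip E F (s n) (t n) - tensor_ip E F (s' n) (t' n)) \<longlonglongrightarrow> d - d'"
      by (intro tendsto_diff lim lim')
    ultimately have "d - d' = 0" by (rule LIMSEQ_unique[rotated])
    then show ?thesis by simp
  qed
  have "(THE d. \<exists>s'\<in>cls s. \<exists>t'\<in>cls t. (\<lambda>n. tensor_ip E F (s' n) (t' n)) \<longlonglongrightarrow> d) = d"
    using lim cls_self[OF s] cls_self[OF t] uniq by (intro the_equality) blast+
  then show ?thesis by (simp add: interior_tensor_def)
qed

end

section \<open>Unitaries onto the algebra as pairings\<close>

lemma self_corresp_simps [simp]:
  "carrier self_corresp = UNIV" "vzero self_corresp = 0" "vadd self_corresp = (+)"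
  "vscale self_corresp = scaleC" "ract self_corresp = (*)" "ip self_corresp = (\<lambda>b b'. star b * b')"
  "lact self_corresp = (*)"
  by (simp_all add: self_corresp_def)

text \<open>
  These are the maps for which \<open>x \<odot> y \<mapsto> w x y\<close> extends to a bilinear unitary onto the algebra:
  additivity and right linearity are forced by the inner product formula.
\<close>

definition tensor_realization ::
  "('a::c_star_algebra, 'b::c_star_algebra, 'm) corresp \<Rightarrow> ('b, 'a, 'n) corresp \<Rightarrow>
    ('m \<Rightarrow> 'n \<Rightarrow> 'a) \<Rightarrow> bool" where
  "tensor_realization E F w \<longleftrightarrow>
    (\<forall>x\<in>carrier E. \<forall>y\<in>carrier F. \<forall>x'\<in>carrier E. \<forall>y'\<in>carrier F.
      star (w x y) * w x' y' = ip F y (lact F (ip E x x') y')) \<and>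
    (\<forall>a. \<forall>x\<in>carrier E. \<forall>y\<in>carrier F. w (lact E a x) y = a * w x y) \<and>
    closure (complex_vector.span {w x y | x y. x \<in> carrier E \<and> y \<in> carrier F}) = UNIV"

lemma tensor_realizationD:
  assumes "tensor_realization E F w"
  shows "x \<in> carrier E \<Longrightarrow> y \<in> carrier F \<Longrightarrow> x' \<in> carrier E \<Longrightarrow> y' \<in> carrier F \<Longrightarrow>
      star (w x y) * w x' y' = ip F y (lact F (ip E x x') y')"
    and "x \<in> carrier E \<Longrightarrow> y \<in> carrier F \<Longrightarrow> w (lact E a x) y = a * w x y"
    and "closure (complex_vector.span {w x y | x y. x \<in> carrier E \<and> y \<in> carrier F}) = UNIV"
  using assms by (simp_all add: tensor_realization_def)

lemma tensor_iso_selfD: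
  fixes E :: "('a::c_star_algebra, 'b::c_star_algebra, 'm) corresp" and F :: "('b, 'a, 'n) corresp"
  assumes "correspondence E" "correspondence F" and iso: "corresp_iso (E \<odot> F) self_corresp"
  obtains w where "tensor_realization E F w"
proof -
  interpret E: correspondence E by fact
  interpret F: correspondence F by fact
  interpret correspondence_pair E F ..
  from iso obtain u where u: "bilinear_unitary (E \<odot> F) self_corresp u" by (auto simp: corresp_iso_def)
  define V where "V f = u (cls (\<lambda>_. f))" for f
  define w where "w x y = V [(x, y)]" for x y
  have mem: "cls s \<in> carrier (E \<odot> F)" if "s \<in> tensor_cauchy E F" for s
    using that unfolding carrier_interior_tensor by blast
  have ipu: "star (u X) * u Y = ip (E \<odot> F) X Y" if "X \<in> carrier (E \<odot> F)" "Y \<in> carrier (E \<odot> F)" for X Y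
    using u that by (simp add: bilinear_unitary_def)
  have V: "star (V f) * V g = tensor_ip E F f g" if "f \<in> tensors" "g \<in> tensors" for f g
    using that by (simp add: V_def ipu mem tensor_cauchy_const ip_cls[OF _ _ tendsto_const])
  have V_linear: "f \<in> tensors \<Longrightarrow> g \<in> tensors \<Longrightarrow> V (f @ g) = V f + V g"
    "f \<in> tensors \<Longrightarrow> V (tensor_scale E c f) = scaleC c (V f)"
    "f \<in> tensors \<Longrightarrow> V (tensor_act f d) = V f * d"
    "f \<in> tensors \<Longrightarrow> g \<in> tensors \<Longrightarrow> norm (V f - V g) = tensor_dist E F f g" for f g c d
    using T.isometry_linear[of V] V by blast+
  have single: "[(x, y)] \<in> tensors" if "x \<in> carrier E" "y \<in> carrier F" for x y
    using that by (simp add: tensors_def)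
  have "tensor_realization E F w"
    unfolding tensor_realization_def
  proof (intro conjI ballI allI)
    fix x y x' y' assume *: "x \<in> carrier E" "y \<in> carrier F" "x' \<in> carrier E" "y' \<in> carrier F"
    then show "star (w x y) * w x' y' = ip F y (lact F (ip E x x') y')"
      by (simp add: w_def V single tensor_ip_def)
  next
    fix a x y assume *: "x \<in> carrier E" "y \<in> carrier F"
    have "V [(lact E a x, y)] = u (lact (E \<odot> F) a (cls (\<lambda>_. [(x, y)])))"
      using * by (simp add: V_def lact_cls_const single tensor_lact_def)
    also have "\<dots> = a * V [(x, y)]"
      using u mem[OF tensor_cauchy_const[OF single[OF *]]] by (simp add: bilinear_unitary_def V_def)
    finally show "w (lact E a x) y = a * w x y" by (simp add: w_def)
  next
    let ?S = "complex_vector.span {w x y | x y. x \<in> carrier E \<and> y \<in> carrier F}"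
    have V0: "V [] = 0"
      using V[of "[]" "[]"] c_star_identity[of "V []"] by (simp add: tensors_def tensor_ip_def)
    have span: "V f \<in> ?S" if "f \<in> tensors" for f
      using that
    proof (induction f)
      case Nil
      show ?case by (simp add: V0 complex_vector.span_zero)
    next
      case (Cons p f)
      obtain x y where p: "p = (x, y)" "x \<in> carrier E" "y \<in> carrier F" "f \<in> tensors"
        using Cons.prems by (auto simp: tensors_def)
      have "V (p # f) = w x y + V f"
        using V_linear(1)[OF single[OF p(2,3)] p(4)] by (simp add: p(1) w_def)
      moreover have "w x y \<in> ?S" using p by (intro complex_vector.span_base) blast
      ultimately show ?case using Cons.IH[OF p(4)] by (simp add: complex_vector.span_add)
    qed
    have "c \<in> closure ?S" for c
    proof -
      from u have "bij_betw u (carrier (E \<odot> F)) UNIV" by (simp add: bilinear_unitary_def)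
      then obtain X where X: "X \<in> carrier (E \<odot> F)" "u X = c" by (metis UNIV_I bij_betw_def imageE)
      then obtain s where s: "s \<in> tensor_cauchy E F" "X = cls s" unfolding carrier_interior_tensor by blast
      note sT = tensor_cauchy_closed[OF s(1)]
      have "Cauchy (\<lambda>n. V (s n))"
        using s(1) by (intro CauchyI) (simp add: V_linear(4)[OF sT sT] tensor_cauchy_iff)
      then obtain v where v: "(\<lambda>n. V (s n)) \<longlonglongrightarrow> v" by (auto simp: Cauchy_convergent_iff convergent_def)
      have "(\<lambda>n. tensor_ip E F (s n) (s n)) \<longlonglongrightarrow> star v * v"
        unfolding V[OF sT sT, symmetric] by (intro tendsto_intros v)
      \<comment> \<open>The value \<open>c\<close> of the unitary is identified with the limit
        \<open>v\<close> through products alone: \<open>star c * c\<close>,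
        \<open>star c * v\<close> and \<open>star v * c\<close> all equal \<open>star v * v\<close>,
        whence \<open>star (c - v) * (c - v) = 0\<close>.\<close>
      then have cc: "star c * c = star v * v"
        using ipu[OF X(1) X(1)] ip_cls[OF s(1) s(1)] by (simp add: X(2) s(2)[symmetric])
      have cV: "star c * V (s m) = star v * V (s m)" for m
      proof -
        have "(\<lambda>n. tensor_ip E F (s n) (s m)) \<longlonglongrightarrow> star v * V (s m)"
          unfolding V[OF sT sT, symmetric] by (intro tendsto_intros v)
        from ip_cls[OF s(1) tensor_cauchy_const[OF sT] this]
        show ?thesis
          using ipu[OF X(1) mem[OF tensor_cauchy_const[OF sT]], of m] by (simp add: X(2) s(2)[symmetric] V_def)
      qed
      have "(\<lambda>m. star c * V (s m)) \<longlonglongrightarrow> star c * v" "(\<lambda>m. star v * V (s m)) \<longlonglongrightarrow> star v * v"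
        by (intro tendsto_intros v)+
      then have cv: "star c * v = star v * v"
        unfolding cV by (rule LIMSEQ_unique)
      from arg_cong[OF cv, of star] have vc: "star v * c = star v * v"
        by (simp add: star_mult)
      have "star (c - v) * (c - v) = 0"
        by (simp add: star_diff algebra_simps cc cv vc)
      then have "c = v" using c_star_identity[of "c - v"] by simp
      with v show ?thesis
        unfolding closure_sequential using span[OF sT] by (intro exI[of _ "\<lambda>n. V (s n)"]) simp
    qed
    then show "closure ?S = UNIV" by blast
  qed
  then show ?thesis by (rule that)
qed

text \<open>As the target is complete, formal sums are Cauchy exactly when their images under
  \<open>V\<close> converge, and the classes are the fibres of the limit map \<open>L\<close>. Every
  operation on classes can therefore be compared through \<open>L\<close>; density of the span gives
  surjectivity.\<close>

lemma tensor_iso_selfI: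
  fixes E :: "('a::c_star_algebra, 'b::c_star_algebra, 'm) corresp" and F :: "('b, 'a, 'n) corresp"
  assumes "correspondence E" "correspondence F"
    and real: "tensor_realization E F w"
  shows "corresp_iso (E \<odot> F) self_corresp"
proof -
  interpret E: correspondence E by fact
  interpret F: correspondence F by fact
  interpret correspondence_pair E F ..
  note w = tensor_realizationD(1)[OF real] and w_lact = tensor_realizationD(2)[OF real]
    and dense = tensor_realizationD(3)[OF real]
  define V where "V f = (\<Sum>i<length f. w (fst (f ! i)) (snd (f ! i)))" for f
  have V: "star (V f) * V g = tensor_ip E F f g" if "f \<in> tensors" "g \<in> tensors" for f g
    unfolding V_def tensor_ip_eq star_sum sum_product
    using tensors_nth[OF that(1)] tensors_nth[OF that(2)] by (intro sum.cong refl) (simp add: w)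
  have V_linear: "f \<in> tensors \<Longrightarrow> g \<in> tensors \<Longrightarrow> V (f @ g) = V f + V g"
    "f \<in> tensors \<Longrightarrow> V (tensor_scale E c f) = scaleC c (V f)"
    "f \<in> tensors \<Longrightarrow> V (tensor_act f d) = V f * d"
    "f \<in> tensors \<Longrightarrow> g \<in> tensors \<Longrightarrow> norm (V f - V g) = tensor_dist E F f g" for f g c d
    using T.isometry_linear[of V] V by blast+
  have V_lact: "V (tensor_lact a f) = a * V f" if "f \<in> tensors" for a f
    unfolding V_def tensor_lact_nth(2) sum_distrib_left
    using tensors_nth[OF that] by (intro sum.cong refl) (simp add: tensor_lact_nth w_lact)
  have cauchy: "s \<in> tensor_cauchy E F \<longleftrightarrow> (\<forall>n. s n \<in> tensors) \<and> convergent (\<lambda>n. V (s n))" for s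
  proof (cases "\<forall>n. s n \<in> tensors")
    case True
    then have "norm (V (s m) - V (s n)) = tensor_dist E F (s m) (s n)" for m n
      by (simp add: V_linear(4))
    with True show ?thesis
      by (simp add: tensor_cauchy_iff Cauchy_convergent_iff[symmetric] Cauchy_iff)
  qed (auto simp: tensor_cauchy_iff)
  define L where "L s = lim (\<lambda>n. V (s n))" for s
  have L: "(\<lambda>n. V (s n)) \<longlonglongrightarrow> L s" if "s \<in> tensor_cauchy E F" for s
    using that by (simp add: cauchy L_def convergent_LIMSEQ_iff)
  have LI: "s \<in> tensor_cauchy E F \<and> L s = d" if "\<And>n. s n \<in> tensors" "(\<lambda>n. V (s n)) \<longlonglongrightarrow> d" for s d
    using that by (auto simp: cauchy convergent_def L_def limI)
  have rel: "(s, t) \<in> tensor_rel E F \<longleftrightarrow> L s = L t" if s: "s \<in> tensor_cauchy E F" and t: "t \<in> tensor_cauchy E F" for s t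
  proof -
    have lim: "(\<lambda>n. V (s n) - V (t n)) \<longlonglongrightarrow> L s - L t" by (intro tendsto_diff L s t)
    have "(s, t) \<in> tensor_rel E F \<longleftrightarrow> (\<lambda>n. norm (V (s n) - V (t n))) \<longlonglongrightarrow> 0"
      using s t by (simp add: tensor_rel_iff V_linear(4) tensor_cauchy_closed)
    also have "\<dots> \<longleftrightarrow> (\<lambda>n. V (s n) - V (t n)) \<longlonglongrightarrow> 0" by (rule tendsto_norm_zero_iff)
    also have "\<dots> \<longleftrightarrow> L s - L t = 0" using lim LIMSEQ_unique[OF lim, of 0] by auto
    finally show ?thesis by simp
  qed
  have Lcls: "s' \<in> tensor_cauchy E F \<and> L s' = L s" if "s' \<in> cls s" for s s'
    using that rel[of s s'] by (auto simp: mem_cls tensor_rel_iff)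
  define u where "u X = L (SOME s. s \<in> X)" for X
  have u: "u (cls s) = L s" if "s \<in> tensor_cauchy E F" for s
    unfolding u_def using someI[of "\<lambda>t. t \<in> cls s", OF cls_self[OF that]] Lcls by blast
  have cls_eq': "cls s = cls t" if "s \<in> tensor_cauchy E F" "t \<in> tensor_cauchy E F" "L s = L t" for s t
    using rel[OF that(1,2)] that(3) cls_eq by blast
  have "bilinear_unitary (E \<odot> F) self_corresp u"
    unfolding bilinear_unitary_def
  proof (intro conjI ballI allI)
    have inj: "inj_on u (carrier (E \<odot> F))"
    proof (rule inj_onI)
      fix X Y assume "X \<in> carrier (E \<odot> F)" "Y \<in> carrier (E \<odot> F)" "u X = u Y"
      then show "X = Y" unfolding carrier_interior_tensor using u cls_eq' by metis
    qed
    have surj: "\<exists>X\<in>carrier (E \<odot> F). u X = c" for c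
    proof -
      have span: "\<exists>f\<in>tensors. V f = d"
        if "d \<in> complex_vector.span {w x y | x y. x \<in> carrier E \<and> y \<in> carrier F}" for d
        using that
      proof (induction rule: complex_vector.span_induct_alt)
        case base
        show ?case by (rule bexI[of _ "[]"]) (simp_all add: V_def tensors_def)
      next
        case (step c d e)
        then obtain x y f where d: "d = w x y" "x \<in> carrier E" "y \<in> carrier F" and f: "f \<in> tensors" "V f = e"
          by blast
        have xy: "[(x, y)] \<in> tensors" using d by (simp add: tensors_def)
        have "V (tensor_scale E c [(x, y)] @ f) = scaleC c (V [(x, y)]) + V f"
          using xy f by (simp add: V_linear)
        also have "\<dots> = scaleC c d + e" by (simp add: f d(1)) (simp add: V_def)
        finally show ?case
          using xy f by (intro bexI[of _ "tensor_scale E c [(x, y)] @ f"]) simp_all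
      qed
      have "c \<in> closure (complex_vector.span {w x y | x y. x \<in> carrier E \<and> y \<in> carrier F})"
        using dense by simp
      then obtain d where d: "\<forall>n. d n \<in> complex_vector.span {w x y | x y. x \<in> carrier E \<and> y \<in> carrier F}"
          "d \<longlonglongrightarrow> c"
        unfolding closure_sequential by (elim exE conjE)
      have "\<forall>n. \<exists>f. f \<in> tensors \<and> V f = d n" using span[OF d(1)[rule_format]] by blast
      from choice[OF this] obtain s where s: "\<And>n. s n \<in> tensors" "\<And>n. V (s n) = d n" by blast
      with LI[of s c] d(2) have "s \<in> tensor_cauchy E F" "L s = c" by simp_all
      moreover from this(1) have "cls s \<in> carrier (E \<odot> F)" unfolding carrier_interior_tensor by (intro bexI[of _ s] refl)
      ultimately show ?thesis using u by (intro bexI[of _ "cls s"]) simp_all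
    qed
    have "u ` carrier (E \<odot> F) = UNIV"
    proof (rule sym, rule UNIV_eq_I)
      show "c \<in> u ` carrier (E \<odot> F)" for c
        using surj[of c] by (elim bexE) (rule image_eqI[OF sym])
    qed
    with inj show "bij_betw u (carrier (E \<odot> F)) (carrier self_corresp)"
      by (simp add: bij_betw_def)
  next
    fix X Y assume "X \<in> carrier (E \<odot> F)" "Y \<in> carrier (E \<odot> F)"
    then obtain s t where s: "s \<in> tensor_cauchy E F" "X = cls s" and t: "t \<in> tensor_cauchy E F" "Y = cls t"
      unfolding carrier_interior_tensor by blast
    have app: "(\<lambda>n. s' n @ t' n) \<in> tensor_cauchy E F \<and> L (\<lambda>n. s' n @ t' n) = L s' + L t'"
      if "s' \<in> tensor_cauchy E F" "t' \<in> tensor_cauchy E F" for s' t'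
    proof (rule LI)
      show "s' n @ t' n \<in> tensors" for n using that by (simp add: tensor_cauchy_closed)
      have "(\<lambda>n. V (s' n) + V (t' n)) \<longlonglongrightarrow> L s' + L t'" by (intro tendsto_add L that)
      then show "(\<lambda>n. V (s' n @ t' n)) \<longlonglongrightarrow> L s' + L t'"
        using that by (simp add: V_linear(1) tensor_cauchy_closed)
    qed
    have "(\<Union>s'\<in>cls s. \<Union>t'\<in>cls t. cls (\<lambda>n. s' n @ t' n)) = cls (\<lambda>n. s n @ t n)"
    proof (rule UN_cls2[OF s(1) t(1)])
      fix s' t' assume "s' \<in> cls s" "t' \<in> cls t"
      then show "cls (\<lambda>n. s' n @ t' n) = cls (\<lambda>n. s n @ t n)"
        using app[of s' t'] app[OF s(1) t(1)] Lcls by (intro cls_eq') simp_all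
    qed
    then have "vadd (E \<odot> F) X Y = cls (\<lambda>n. s n @ t n)"
      by (simp add: interior_tensor_def s(2) t(2) cls_def)
    then show "u (vadd (E \<odot> F) X Y) = vadd self_corresp (u X) (u Y)"
      using app[OF s(1) t(1)] s t by (simp add: u)
    have "(\<lambda>n. star (V (s n)) * V (t n)) \<longlonglongrightarrow> star (L s) * L t"
      by (intro tendsto_intros L s t)
    then have "(\<lambda>n. tensor_ip E F (s n) (t n)) \<longlonglongrightarrow> star (L s) * L t"
      using s t by (simp add: V tensor_cauchy_closed)
    then show "ip self_corresp (u X) (u Y) = ip (E \<odot> F) X Y"
      using s t by (simp add: u ip_cls)
  next
    fix X c d a assume "X \<in> carrier (E \<odot> F)"
    then obtain s where s: "s \<in> tensor_cauchy E F" "X = cls s"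
      unfolding carrier_interior_tensor by blast
    have op: "u (\<Union>s'\<in>cls s. cls (\<lambda>n. G (s' n))) = g (L s)"
      if G: "\<And>f. f \<in> tensors \<Longrightarrow> G f \<in> tensors" "\<And>f. f \<in> tensors \<Longrightarrow> V (G f) = g (V f)"
        and g: "bounded_linear g" for G g
    proof -
      have *: "(\<lambda>n. G (s' n)) \<in> tensor_cauchy E F \<and> L (\<lambda>n. G (s' n)) = g (L s')"
        if s': "s' \<in> tensor_cauchy E F" for s'
      proof (rule LI)
        show "G (s' n) \<in> tensors" for n using s' by (simp add: G tensor_cauchy_closed)
        have "(\<lambda>n. g (V (s' n))) \<longlonglongrightarrow> g (L s')" by (intro bounded_linear.tendsto[OF g] L s')
        then show "(\<lambda>n. V (G (s' n))) \<longlonglongrightarrow> g (L s')" using s' by (simp add: G tensor_cauchy_closed)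
      qed
      have "(\<Union>s'\<in>cls s. cls (\<lambda>n. G (s' n))) = cls (\<lambda>n. G (s n))"
      proof (rule UN_cls[OF s(1)])
        fix s' assume "s' \<in> cls s"
        then show "cls (\<lambda>n. G (s' n)) = cls (\<lambda>n. G (s n))"
          using *[of s'] *[OF s(1)] Lcls by (intro cls_eq') simp_all
      qed
      with *[OF s(1)] show ?thesis by (simp add: u)
    qed
    show "u (vscale (E \<odot> F) c X) = vscale self_corresp c (u X)"
      using op[of "tensor_scale E c" "scaleC c"] s
      by (simp add: interior_tensor_def cls_def V_linear(2) bounded_linear_scaleC u[unfolded cls_def])
    show "u (ract (E \<odot> F) X d) = ract self_corresp (u X) d"
      using op[of "\<lambda>f. tensor_act f d" "\<lambda>c. c * d"] s
      by (simp add: interior_tensor_def cls_def V_linear(3) bounded_linear_mult_left u[unfolded cls_def]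
          flip: tensor_act_def)
    have "tensor_lact a f \<in> tensors" if "f \<in> tensors" for f
      using that by (auto simp: tensors_def tensor_lact_def)
    then show "u (lact (E \<odot> F) a X) = lact self_corresp a (u X)"
      using op[of "tensor_lact a" "\<lambda>c. a * c"] s
      by (simp add: interior_tensor_def cls_def V_lact bounded_linear_mult_right u[unfolded cls_def]
          flip: tensor_lact_def)
  qed
  then show ?thesis by (auto simp: corresp_iso_def)
qed

section \<open>Morita equivalences\<close>

definition closed_subspace :: "'a::c_star_algebra set \<Rightarrow> bool" where
  "closed_subspace D \<longleftrightarrow> closed D \<and> complex_vector.subspace D"

text \<open>The scalar \<open>c'\<close> admits conjugate-linear maps, such as
  \<open>star d * e\<close> as a function of \<open>d\<close>.\<close>

lemma closed_subspace_dense_span: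
  fixes X :: "'a::c_star_algebra set" and D :: "'b::c_star_algebra set"
  assumes X: "closure (complex_vector.span X) = UNIV" and D: "closed_subspace D"
    and f: "bounded_linear f" "\<And>c x. \<exists>c'. f (scaleC c x) = scaleC c' (f x)" "\<And>x. x \<in> X \<Longrightarrow> f x \<in> D"
  shows "f x \<in> D"
proof -
  interpret f: bounded_linear f by fact
  note sub = D[unfolded closed_subspace_def, THEN conjunct2]
  have "f y \<in> D" if "y \<in> complex_vector.span X" for y
    using that
  proof (induction rule: complex_vector.span_induct_alt)
    case base
    show ?case using complex_vector.subspace_0[OF sub] by (simp add: f.zero)
  next
    case (step c y z)
    obtain c' where "f (scaleC c y) = scaleC c' (f y)" using f(2) by blast
    with step f(3) show ?case
      by (simp add: f.add complex_vector.subspace_add[OF sub] complex_vector.subspace_scale[OF sub])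
  qed
  then have "complex_vector.span X \<subseteq> f -` D" by blast
  moreover have "closed (f -` D)"
    using D linear_continuous_at[OF f(1)] by (intro continuous_closed_vimage) (auto simp: closed_subspace_def)
  ultimately have "closure (complex_vector.span X) \<subseteq> f -` D" by (rule closure_minimal)
  with X show ?thesis by blast
qed

lemma closureI_LIMSEQ:
  fixes l :: "'a::metric_space"
  shows "(\<And>n. f n \<in> S) \<Longrightarrow> f \<longlonglongrightarrow> l \<Longrightarrow> l \<in> closure S"
  unfolding closure_sequential by (intro exI[of _ f] conjI allI)

lemma closed_subspace_closure_span: "closed_subspace (closure (complex_vector.span X))"
  for X :: "'a::c_star_algebra set"
  unfolding closed_subspace_def
proof (intro conjI complex_vector.subspaceI)
  let ?S = "complex_vector.span X"
  show "0 \<in> closure ?S" using closure_subset complex_vector.span_zero by blast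
  fix c and x y :: 'a assume "x \<in> closure ?S"
  then obtain f where f: "\<And>n. f n \<in> ?S" "f \<longlonglongrightarrow> x" unfolding closure_sequential by blast
  have "(\<lambda>n. scaleC c (f n)) \<longlonglongrightarrow> scaleC c x"
    by (intro bounded_linear.tendsto[OF bounded_linear_scaleC] f)
  then show "scaleC c x \<in> closure ?S"
    by (rule closureI_LIMSEQ[rotated]) (intro complex_vector.span_scale f)
  assume "y \<in> closure ?S"
  then obtain g where g: "\<And>n. g n \<in> ?S" "g \<longlonglongrightarrow> y" unfolding closure_sequential by blast
  have "(\<lambda>n. f n + g n) \<longlonglongrightarrow> x + y" by (intro tendsto_add f g)
  then show "x + y \<in> closure ?S"
    by (rule closureI_LIMSEQ[rotated]) (intro complex_vector.span_add f g)
qed simp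

text \<open>Density, used in one factor after the other, puts every \<open>star d * e\<close> into
  \<open>D\<close>. The case \<open>d = e\<close> gives all positive elements, and these span the
  algebra.\<close>

lemma full_if_tensor_iso:
  fixes E :: "('a::c_star_algebra, 'b::c_star_algebra, 'm) corresp" and F :: "('b, 'a, 'n) corresp"
  assumes "correspondence E" "correspondence F" "corresp_iso (E \<odot> F) self_corresp"
  shows "full F"
proof -
  interpret E: correspondence E by fact
  interpret F: correspondence F by fact
  obtain w where real: "tensor_realization E F w"
    by (rule tensor_iso_selfD[OF assms])
  note w = tensor_realizationD(1)[OF real] and dense = tensor_realizationD(3)[OF real]
  define D where "D = closure (complex_vector.span {ip F x y | x y. x \<in> carrier F \<and> y \<in> carrier F})"
  have D: "closed_subspace D" unfolding D_def by (rule closed_subspace_closure_span)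
  have base: "star (w x y) * d \<in> D" if "x \<in> carrier E" "y \<in> carrier F" for x y d
  proof (rule closed_subspace_dense_span[OF dense D, of "\<lambda>d. star (w x y) * d"])
    fix d assume "d \<in> {w x y | x y. x \<in> carrier E \<and> y \<in> carrier F}"
    then obtain x' y' where d: "d = w x' y'" "x' \<in> carrier E" "y' \<in> carrier F" by blast
    have "star (w x y) * d = ip F y (lact F (ip E x x') y')" using d that by (simp add: w)
    also have "\<dots> \<in> complex_vector.span {ip F x y | x y. x \<in> carrier F \<and> y \<in> carrier F}"
      using d that F.lact_closed by (intro complex_vector.span_base) blast
    finally show "star (w x y) * d \<in> D" unfolding D_def using closure_subset by blast
  qed (auto simp: bounded_linear_mult_right mult_scaleC_right)
  have "star d * e \<in> D" for d e
  proof (rule closed_subspace_dense_span[OF dense D, of "\<lambda>d. star d * e"])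
    show "bounded_linear (\<lambda>d. star d * e)"
      by (rule bounded_linear_compose[OF bounded_linear_mult_left bounded_linear_star])
    show "\<exists>c'. star (scaleC c d) * e = scaleC c' (star d * e)" for c d
      by (auto simp: star_scaleC mult_scaleC_left)
  qed (use base in blast)
  then have "{a. positive a} \<subseteq> D" by (auto simp: positive_def)
  then have "complex_vector.span {a. positive a} \<subseteq> D"
    using D by (intro complex_vector.span_minimal) (simp_all add: closed_subspace_def)
  then show ?thesis by (auto simp: full_def D_def span_positive)
qed

section \<open>Density arguments in a correspondence\<close>

context correspondence
begin

lemma lact_zero [simp]: "x \<in> carrier M \<Longrightarrow> lact M 0 x = vzero M"
  using lact_diff[of x 0 0] mnorm_dist_eq_0[of "lact M 0 x" "lact M 0 x"] mnorm_eq_0[of "lact M 0 x"]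
  by (auto intro!: module_eqI simp: ip_lact)

lemma left_mult_eqI:
  assumes "T \<in> extensional (carrier M)" "\<And>x. x \<in> carrier M \<Longrightarrow> lact M a x = T x"
  shows "left_mult M a = T"
  using assms by (auto simp: left_mult_def extensional_def)

lemma left_mult_compact:
  assumes "a \<in> closure (complex_vector.span
    {a. \<exists>x\<in>carrier M. \<exists>y\<in>carrier M. left_mult M a = rank_one M x y})" (is "_ \<in> closure (complex_vector.span ?X)")
  shows "left_mult M a \<in> compact_ops M"
proof -
  have V: "left_mult M b \<in> finite_rank_ops" if "b \<in> complex_vector.span ?X" for b
    using that
  proof (induction rule: complex_vector.span_induct_alt)
    case base
    have "left_mult M 0 = vzero (adjointable_ops M)"
      by (rule left_mult_eqI) (use adjoint_extensional[OF adjoint_vzero] in simp_all)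
    then show ?case by (simp add: vspan_zero)
  next
    case (step c b b')
    then obtain x y where "x \<in> carrier M" "y \<in> carrier M" "left_mult M b = rank_one M x y" by blast
    then have "left_mult M b \<in> finite_rank_ops" by (intro vspan_base) blast
    moreover have "left_mult M (scaleC c b + b') =
        vadd (adjointable_ops M) (vscale (adjointable_ops M) c (left_mult M b)) (left_mult M b')"
      using representation by (simp add: star_representation_def)
    ultimately show ?case using step.IH by (simp only: vspan_add vspan_scale)
  qed
  show ?thesis
    unfolding mem_compact_ops_iff
  proof (intro conjI allI impI)
    fix e :: real assume "e > 0"
    then obtain b where b: "b \<in> complex_vector.span ?X" "dist b a < e"
      using assms[unfolded closure_approachable] by blast
    have "mnorm M (vdiff M (left_mult M a x) (left_mult M b x)) \<le> e * mnorm M x" if x: "x \<in> carrier M" for x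
    proof -
      have "mnorm M (lact M (a - b) x) \<le> norm (a - b) * mnorm M x" by (rule mnorm_lact_le[OF x])
      also have "\<dots> \<le> e * mnorm M x"
        using b(2) by (intro mult_right_mono) (simp_all add: dist_norm norm_minus_commute)
      finally show ?thesis using x by (simp add: lact_diff left_mult_apply)
    qed
    with V[OF b(1)] show "\<exists>W\<in>finite_rank_ops. \<forall>x\<in>carrier M. mnorm M (vdiff M (left_mult M a x) (W x)) \<le> e * mnorm M x"
      by blast
  qed (use adjoint_left_mult in blast)
qed

lemma bounded_linear_ip_lact:
  assumes "x \<in> carrier M" "y \<in> carrier M"
  shows "bounded_linear (\<lambda>a. ip M x (lact M a y))"
proof (rule bounded_linear_intro)
  show "norm (ip M x (lact M a y)) \<le> norm a * (mnorm M x * mnorm M y)" for a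
    using norm_inn_le[of x "lact M a y"] mult_left_mono[OF mnorm_lact_le[of y a] nrm_nonneg[of x]] assms
    by (simp add: mult_ac)
qed (use assms in \<open>simp_all add: ip_lact_scaleR\<close>)

lemma ip_mem_closed_subspace:
  assumes D: "closed_subspace D" and x: "x \<in> carrier M"
    and base: "\<And>a y. y \<in> carrier M \<Longrightarrow> ip M x (lact M a y) \<in> D" and y: "y \<in> carrier M"
  shows "ip M x y \<in> D"
proof -
  note sub = D[unfolded closed_subspace_def, THEN conjunct2]
  have "y \<in> closed_vspan M (mnorm M) {lact M a x | a x. x \<in> carrier M}" using y nondegenerate by simp
  moreover have "{lact M a x | a x. x \<in> carrier M} \<subseteq> carrier M" by auto
  ultimately show ?thesis
  proof (induction rule: closed_vspan_induct)
    case zero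
    then show ?case using x complex_vector.subspace_0[OF sub] by simp
  next
    case (limit y)
    have "ip M x y \<in> closure D"
      unfolding closure_approachable
    proof (intro allI impI)
      fix e :: real assume "e > 0"
      then have "e / (mnorm M x + 1) > 0" by (simp add: add_nonneg_pos)
      from limit(2)[OF this] obtain z where z: "z \<in> carrier M" "ip M x z \<in> D"
        "mnorm M (vdiff M y z) < e / (mnorm M x + 1)" by blast
      have "norm (ip M x (vdiff M y z)) \<le> mnorm M x * mnorm M (vdiff M y z)"
        using x z limit(1) by (intro norm_inn_le) simp_all
      also have "\<dots> \<le> (mnorm M x + 1) * mnorm M (vdiff M y z)" by (intro mult_right_mono) simp_all
      also have "\<dots> < e" using z(3) nrm_nonneg[of x]
        by (simp add: pos_less_divide_eq add_nonneg_pos mult.commute)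
      finally have "dist (ip M x z) (ip M x y) < e"
        using x z limit(1) by (simp add: dist_norm norm_minus_commute)
      with z(2) show "\<exists>d\<in>D. dist d (ip M x y) < e" by blast
    qed
    then show ?case using D by (simp add: closed_subspace_def)
  qed (use x base in \<open>auto simp: complex_vector.subspace_add[OF sub] complex_vector.subspace_scale[OF sub]\<close>)
qed

text \<open>Combines nondegeneracy with density in the algebra: the vectors \<open>a y\<close> with
  \<open>a\<close> in a densely spanning set \<open>X\<close> span the module densely.\<close>

lemma module_dense_induct:
  assumes X: "closure (complex_vector.span X) = UNIV" and x: "x \<in> carrier M"
    and base: "\<And>a y. a \<in> X \<Longrightarrow> y \<in> carrier M \<Longrightarrow> P (lact M a y)" and zero: "P (vzero M)"
    and add: "\<And>x y. x \<in> carrier M \<Longrightarrow> y \<in> carrier M \<Longrightarrow> P x \<Longrightarrow> P y \<Longrightarrow> P (vadd M x y)"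
    and scale: "\<And>c x. x \<in> carrier M \<Longrightarrow> P x \<Longrightarrow> P (vscale M c x)"
    and limit: "\<And>x. x \<in> carrier M \<Longrightarrow>
      (\<And>e. e > 0 \<Longrightarrow> \<exists>y\<in>carrier M. P y \<and> mnorm M (vdiff M x y) < e) \<Longrightarrow> P x"
  shows "P x"
proof -
  have "P (lact M a y)" if y: "y \<in> carrier M" for a y
    using X
  proof (induction a rule: closure_span_induct)
    case (limit a)
    show ?case
    proof (rule assms(7))
      fix e :: real assume "e > 0"
      then have "e / (mnorm M y + 1) > 0" by (simp add: add_nonneg_pos)
      from limit[OF this] obtain a' where a': "P (lact M a' y)" "norm (a - a') < e / (mnorm M y + 1)" by blast
      have "mnorm M (vdiff M (lact M a y) (lact M a' y)) \<le> norm (a - a') * mnorm M y"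
        using mnorm_lact_le[OF y, of "a - a'"] y by (simp add: lact_diff)
      also have "\<dots> \<le> norm (a - a') * (mnorm M y + 1)" by (intro mult_left_mono) simp_all
      also have "\<dots> < e" using a'(2) nrm_nonneg[of y] by (simp add: pos_less_divide_eq add_nonneg_pos)
      finally show "\<exists>z\<in>carrier M. P z \<and> mnorm M (vdiff M (lact M a y) z) < e"
        using a'(1) y lact_closed by blast
    qed (simp add: y)
  qed (use y base zero add scale in simp_all)
  note lact = this
  have "x \<in> closed_vspan M (mnorm M) {lact M a x | a x. x \<in> carrier M}" using x nondegenerate by simp
  moreover have "{lact M a x | a x. x \<in> carrier M} \<subseteq> carrier M" by auto
  ultimately show ?thesis
    by (induction rule: closed_vspan_induct) (use lact zero add scale limit in \<open>blast+\<close>)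
qed

end

section \<open>The range of a faithful action\<close>

context faithful_correspondence
begin

lemma action_eqI:
  assumes "\<And>x. x \<in> carrier M \<Longrightarrow> lact M a x = lact M a' x"
  shows "a = a'"
proof -
  have "a - a' = 0"
    by (rule faithful) (use assms in \<open>auto intro!: module_eqI simp: lact_diff\<close>)
  then show ?thesis by simp
qed

lemma inj_left_mult: "inj (left_mult M)"
proof (rule injI)
  fix a a' assume "left_mult M a = left_mult M a'"
  then have "lact M a x = lact M a' x" if "x \<in> carrier M" for x
    using left_mult_apply[OF that] by metis
  then show "a = a'" by (rule action_eqI)
qed

text \<open>The range of a faithful action is closed in norm:
  \<open>norm_le_if_action_bounded\<close> makes elements whose actions approximate an operator a
  Cauchy sequence in the algebra.\<close>

lemma range_left_mult_limit:
  assumes T: "is_adjoint M T S"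
    and approx: "\<And>e. e > 0 \<Longrightarrow> \<exists>a. \<forall>x\<in>carrier M. mnorm M (vdiff M (T x) (lact M a x)) \<le> e * mnorm M x"
  shows "T \<in> range (left_mult M)"
proof -
  note [simp] = adjoint_closed(1)[OF T]
  have "\<forall>n. \<exists>a. \<forall>x\<in>carrier M. mnorm M (vdiff M (T x) (lact M a x)) \<le> inverse (real (Suc n)) * mnorm M x"
    using approx by simp
  then obtain a where a: "\<And>n x. x \<in> carrier M \<Longrightarrow>
      mnorm M (vdiff M (T x) (lact M (a n) x)) \<le> inverse (real (Suc n)) * mnorm M x" by metis
  have na: "norm (a m - a n) \<le> inverse (real (Suc m)) + inverse (real (Suc n))" for m n
  proof (rule norm_le_if_action_bounded)
    fix x assume x: "x \<in> carrier M"
    have "mnorm M (lact M (a m - a n) x) = mnorm M (vdiff M (lact M (a m) x) (lact M (a n) x))"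
      using x by (simp add: lact_diff)
    also have "\<dots> \<le> mnorm M (vdiff M (lact M (a m) x) (T x)) + mnorm M (vdiff M (T x) (lact M (a n) x))"
      using x by (intro dst_triangle) simp_all
    also have "mnorm M (vdiff M (lact M (a m) x) (T x)) = mnorm M (vdiff M (T x) (lact M (a m) x))"
      using x by (intro dst_commute) simp_all
    finally show "mnorm M (lact M (a m - a n) x) \<le> (inverse (real (Suc m)) + inverse (real (Suc n))) * mnorm M x"
      using a[OF x, of m] a[OF x, of n] by (simp add: algebra_simps)
  qed simp
  have "Cauchy a"
  proof (rule CauchyI)
    fix e :: real assume "e > 0"
    then have "e / 2 > 0" by simp
    then obtain N where N: "inverse (real (Suc N)) < e / 2" using reals_Archimedean by blast
    have "norm (a m - a n) < e" if "m \<ge> N" "n \<ge> N" for m n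
    proof -
      have "inverse (real (Suc m)) \<le> inverse (real (Suc N))" "inverse (real (Suc n)) \<le> inverse (real (Suc N))"
        using that by (simp_all add: le_imp_inverse_le)
      with na[of m n] N show ?thesis by linarith
    qed
    then show "\<exists>N. \<forall>m\<ge>N. \<forall>n\<ge>N. norm (a m - a n) < e" by blast
  qed
  then obtain b where b: "a \<longlonglongrightarrow> b" by (auto simp: Cauchy_convergent_iff convergent_def)
  have "left_mult M b = T"
  proof (rule left_mult_eqI[OF adjoint_extensional[OF T]])
    fix x assume x: "x \<in> carrier M"
    have "(\<lambda>n. inverse (real (Suc n)) * mnorm M x + norm (a n - b) * mnorm M x) \<longlonglongrightarrow> 0 * mnorm M x + 0 * mnorm M x"
      by (intro tendsto_intros LIMSEQ_inverse_real_of_nat tendsto_norm_zero LIM_zero b)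
    moreover have "mnorm M (vdiff M (T x) (lact M b x))
        \<le> inverse (real (Suc n)) * mnorm M x + norm (a n - b) * mnorm M x" for n
    proof -
      have "mnorm M (vdiff M (T x) (lact M b x))
          \<le> mnorm M (vdiff M (T x) (lact M (a n) x)) + mnorm M (vdiff M (lact M (a n) x) (lact M b x))"
        using x by (intro dst_triangle) simp_all
      with a[OF x, of n] mnorm_lact_le[OF x, of "a n - b"] x show ?thesis by (simp add: lact_diff)
    qed
    ultimately have "mnorm M (vdiff M (T x) (lact M b x)) \<le> 0"
      by (intro LIMSEQ_le_const) auto
    then have "mnorm M (vdiff M (T x) (lact M b x)) = 0" using nrm_nonneg by (intro antisym)
    then show "lact M b x = T x" using x by (simp add: mnorm_dist_eq_0)
  qed
  then show ?thesis by blast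
qed

lemma range_left_mult_star:
  assumes "x \<in> carrier M" "y \<in> carrier M" "rank_one M x y \<in> range (left_mult M)"
  shows "rank_one M y x \<in> range (left_mult M)"
proof -
  obtain a where a: "left_mult M a = rank_one M x y" using assms(3) by (auto simp: image_iff)
  have "left_mult M (star a) = rank_one M y x"
  proof (rule left_mult_eqI)
    show "rank_one M y x \<in> extensional (carrier M)" by (simp add: rank_one_def)
    fix z assume z: "z \<in> carrier M"
    show "lact M (star a) z = rank_one M y x z"
    proof (rule module_eqI)
      fix t assume t: "t \<in> carrier M"
      have "ip M t (lact M (star a) z) = ip M (left_mult M a t) z"
        using t z by (simp add: ip_lact left_mult_apply)
      then show "ip M t (lact M (star a) z) = ip M t (rank_one M y x z)"
        using t z assms(1,2) by (simp add: a star_mult star_ip)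
    qed (use z assms in simp_all)
  qed
  then show ?thesis by (metis rangeI)
qed

lemma range_left_mult_dense:
  assumes X: "closure (complex_vector.span X) = UNIV" and y: "y \<in> carrier M"
    and base: "\<And>a z. a \<in> X \<Longrightarrow> z \<in> carrier M \<Longrightarrow> rank_one M (lact M a z) y \<in> range (left_mult M)"
    and x: "x \<in> carrier M"
  shows "rank_one M x y \<in> range (left_mult M)"
  using X x
proof (rule module_dense_induct)
  have ext: "rank_one M x y \<in> extensional (carrier M)" for x by (simp add: rank_one_def)
  show "rank_one M (lact M a z) y \<in> range (left_mult M)" if "a \<in> X" "z \<in> carrier M" for a z
    using base that .
  have "left_mult M 0 = rank_one M (vzero M) y"
    by (rule left_mult_eqI[OF ext]) (rule module_eqI; simp add: y)
  then show "rank_one M (vzero M) y \<in> range (left_mult M)" by (metis rangeI)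
  fix x assume x: "x \<in> carrier M"
  {
    fix c assume "rank_one M x y \<in> range (left_mult M)"
    then obtain a where a: "left_mult M a = rank_one M x y" by (auto simp: image_iff)
    have a': "lact M a z = ract M x (ip M y z)" if "z \<in> carrier M" for z
      using left_mult_apply[OF that, of a] that by (simp add: a)
    have "left_mult M (scaleC c a) = rank_one M (vscale M c x) y"
      by (rule left_mult_eqI[OF ext]) (rule module_eqI; simp add: x y a' mult_scaleC_left)
    then show "rank_one M (vscale M c x) y \<in> range (left_mult M)" by (metis rangeI)
  }
  {
    fix x' assume x': "x' \<in> carrier M"
      and "rank_one M x y \<in> range (left_mult M)" "rank_one M x' y \<in> range (left_mult M)"
    then obtain a b where a: "left_mult M a = rank_one M x y" "left_mult M b = rank_one M x' y"
      by (auto simp: image_iff)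
    have a': "lact M a z = ract M x (ip M y z)" "lact M b z = ract M x' (ip M y z)" if "z \<in> carrier M" for z
      using left_mult_apply[OF that, of a] left_mult_apply[OF that, of b] that by (simp_all add: a)
    have "left_mult M (a + b) = rank_one M (vadd M x x') y"
      by (rule left_mult_eqI[OF ext]) (rule module_eqI; simp add: x x' y a' algebra_simps)
    then show "rank_one M (vadd M x x') y \<in> range (left_mult M)" by (metis rangeI)
  }
  assume lim: "\<And>e. e > 0 \<Longrightarrow>
    \<exists>x'\<in>carrier M. rank_one M x' y \<in> range (left_mult M) \<and> mnorm M (vdiff M x x') < e"
  show "rank_one M x y \<in> range (left_mult M)"
  proof (rule range_left_mult_limit[OF adjoint_rank_one[OF x y]])
    fix e :: real assume "e > 0"
    then have "e / (mnorm M y + 1) > 0" by (simp add: add_nonneg_pos)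
    from lim[OF this] obtain x' a where x': "x' \<in> carrier M" "rank_one M x' y = left_mult M a"
      "mnorm M (vdiff M x x') < e / (mnorm M y + 1)" by blast
    have "mnorm M (vdiff M (rank_one M x y z) (lact M a z)) \<le> e * mnorm M z" if z: "z \<in> carrier M" for z
    proof -
      have "lact M a z = ract M x' (ip M y z)"
        using left_mult_apply[OF z, of a] z by (simp flip: x'(2))
      then have "mnorm M (vdiff M (rank_one M x y z) (lact M a z)) = mnorm M (ract M (vdiff M x x') (ip M y z))"
        using x x' y z by (intro nrm_cong) (simp_all add: algebra_simps)
      also have "\<dots> \<le> mnorm M (vdiff M x x') * norm (ip M y z)"
        using x x' by (intro nrm_act_le) simp
      also have "\<dots> \<le> mnorm M (vdiff M x x') * (mnorm M y * mnorm M z)"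
        using y z by (intro mult_left_mono norm_inn_le) simp_all
      also have "\<dots> = mnorm M (vdiff M x x') * mnorm M y * mnorm M z" by simp
      also have "\<dots> \<le> mnorm M (vdiff M x x') * (mnorm M y + 1) * mnorm M z"
        by (intro mult_right_mono mult_left_mono) simp_all
      also have "\<dots> \<le> e * mnorm M z"
        using x'(3) nrm_nonneg[of y] by (intro mult_right_mono) (simp_all add: pos_less_divide_eq add_nonneg_pos less_imp_le)
      finally show ?thesis .
    qed
    then show "\<exists>a. \<forall>z\<in>carrier M. mnorm M (vdiff M (rank_one M x y z) (lact M a z)) \<le> e * mnorm M z"
      by blast
  qed
qed

lemma compact_ops_subset_range:
  assumes "\<And>x y. x \<in> carrier M \<Longrightarrow> y \<in> carrier M \<Longrightarrow> rank_one M x y \<in> range (left_mult M)"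
  shows "compact_ops M \<subseteq> range (left_mult M)"
proof
  fix T assume T: "T \<in> compact_ops M"
  have V: "\<exists>a. W = left_mult M a" if "W \<in> finite_rank_ops" for W
    using that
  proof induction
    case vspan_zero
    have "vzero (adjointable_ops M) = left_mult M 0"
      by (rule left_mult_eqI[symmetric]) (use adjoint_extensional[OF adjoint_vzero] in simp_all)
    then show ?case by blast
  next
    case (vspan_base W)
    with assms show ?case by blast
  next
    case (vspan_add W W')
    with representation show ?case unfolding star_representation_def by metis
  next
    case (vspan_scale W c)
    with representation show ?case unfolding star_representation_def by metis
  qed
  obtain S where "is_adjoint M T S" using compact_ops_adjoint[OF T] by blast
  then show "T \<in> range (left_mult M)"
  proof (rule range_left_mult_limit)
    fix e :: real assume "e > 0"
    with T obtain W where W: "W \<in> finite_rank_ops" "\<And>x. x \<in> carrier M \<Longrightarrow> mnorm M (vdiff M (T x) (W x)) \<le> e * mnorm M x"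
      unfolding mem_compact_ops_iff by meson
    obtain a where "W = left_mult M a" using V[OF W(1)] by blast
    with W(2) show "\<exists>a. \<forall>x\<in>carrier M. mnorm M (vdiff M (T x) (lact M a x)) \<le> e * mnorm M x"
      by (metis left_mult_apply)
  qed
qed

end

section \<open>From an inverse to fullness and compact operators\<close>

lemma morita_imp_full_compacts:
  fixes M :: "('a::c_star_algebra, 'b::c_star_algebra, 'm) corresp" and N :: "('b, 'a, 'n) corresp"
  assumes M: "correspondence M" and N: "correspondence N"
    and NM: "corresp_iso (N \<odot> M) self_corresp" and MN: "corresp_iso (M \<odot> N) self_corresp"
  shows "full M \<and> left_action_iso_compacts M"
proof
  interpret N: correspondence N by fact
  show "full M" by (rule full_if_tensor_iso[OF N M NM])
  have fullN: "closure (complex_vector.span {ip N x y | x y. x \<in> carrier N \<and> y \<in> carrier N}) = UNIV"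
    using full_if_tensor_iso[OF M N MN] by (simp add: full_def)
  obtain v where real: "tensor_realization M N v"
    by (rule tensor_iso_selfD[OF M N MN])
  note v = tensor_realizationD(1)[OF real] and v_lact = tensor_realizationD(2)[OF real]
    and v_dense = tensor_realizationD(3)[OF real]
  \<comment> \<open>If \<open>a\<close> kills \<open>M\<close>, then
    \<open>a * v x y = v (lact M a x) y = 0\<close>. The values of \<open>v\<close> span densely, so
    \<open>a * star a = 0\<close>.\<close>
  have "faithful_correspondence M"
  proof (rule faithful_correspondence.intro[OF M], unfold_locales)
    interpret M: correspondence M by fact
    fix a assume a: "\<And>x. x \<in> carrier M \<Longrightarrow> lact M a x = vzero M"
    have zero: "v (vzero M) y = 0" if "y \<in> carrier N" for y
      using v[OF _ that _ that, of "vzero M" "vzero M"] c_star_identity[of "v (vzero M) y"] that by simp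
    have "closed_subspace {0 :: 'a}"
      by (simp add: closed_subspace_def complex_vector.subspace_single_0)
    then have "a * d \<in> {0}" for d
    proof (rule closed_subspace_dense_span[OF v_dense, of _ "\<lambda>d. a * d"])
      fix d assume "d \<in> {v x y | x y. x \<in> carrier M \<and> y \<in> carrier N}"
      then obtain x y where d: "d = v x y" "x \<in> carrier M" "y \<in> carrier N" by blast
      show "a * d \<in> {0}" using v_lact[OF d(2,3), of a] a[OF d(2)] zero[OF d(3)] by (simp add: d(1))
    qed (auto simp: bounded_linear_mult_right mult_scaleC_right)
    from this[of "star a"] show "a = 0" using c_star_identity[of "star a"] by simp
  qed
  then interpret M: faithful_correspondence M .
  obtain w where real': "tensor_realization N M w"
    by (rule tensor_iso_selfD[OF N M NM])
  note w = tensor_realizationD(1)[OF real'] and w_lact = tensor_realizationD(2)[OF real']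
    and w_dense = tensor_realizationD(3)[OF real']
  text \<open>The functional \<open>w (bn, _)\<close> on \<open>M\<close> is an inner product when \<open>b\<^sup>* = w n' m\<close>.\<close>
  have rank: "left_mult M (ip N (lact N (star (w n1' m1)) n1) (lact N (star (w n2' m2)) n2)) =
      rank_one M (lact M (ip N n1 n1') m1) (lact M (ip N n2 n2') m2)"
    if "n1 \<in> carrier N" "n1' \<in> carrier N" "m1 \<in> carrier M" "n2 \<in> carrier N" "n2' \<in> carrier N" "m2 \<in> carrier M"
    for n1 n1' m1 n2 n2' m2
  proof (rule M.left_mult_eqI)
    let ?u1 = "lact M (ip N n1 n1') m1" and ?u2 = "lact M (ip N n2 n2') m2"
    have u: "w (lact N (star (w n' m)) n) z = ip M (lact M (ip N n n') m) z"
      if "n \<in> carrier N" "n' \<in> carrier N" "m \<in> carrier M" "z \<in> carrier M" for n n' m z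
      using that by (simp add: w_lact w M.ip_lact N.star_ip)
    show "rank_one M ?u1 ?u2 \<in> extensional (carrier M)" by (simp add: rank_one_def)
    fix z assume z: "z \<in> carrier M"
    show "lact M (ip N (lact N (star (w n1' m1)) n1) (lact N (star (w n2' m2)) n2)) z = rank_one M ?u1 ?u2 z"
    proof (rule M.module_eqI)
      fix x assume x: "x \<in> carrier M"
      have "ip M x (lact M (ip N (lact N (star (w n1' m1)) n1) (lact N (star (w n2' m2)) n2)) z) =
          star (w (lact N (star (w n1' m1)) n1) x) * w (lact N (star (w n2' m2)) n2) z"
        using that x z by (simp add: w)
      also have "\<dots> = star (ip M ?u1 x) * ip M ?u2 z" using that x z by (simp only: u)
      also have "\<dots> = ip M x (rank_one M ?u1 ?u2 z)" using that x z by (simp add: M.star_ip)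
      finally show "ip M x (lact M (ip N (lact N (star (w n1' m1)) n1) (lact N (star (w n2' m2)) n2)) z) =
          ip M x (rank_one M ?u1 ?u2 z)" .
    qed (use that z in simp_all)
  qed
  have "left_mult M a \<in> compact_ops M" for a
  proof -
    define D where "D = closure (complex_vector.span
      {a. \<exists>x\<in>carrier M. \<exists>y\<in>carrier M. left_mult M a = rank_one M x y})"
    have D: "closed_subspace D" unfolding D_def by (rule closed_subspace_closure_span)
    have rank_D: "a \<in> D" if "x \<in> carrier M" "y \<in> carrier M" "left_mult M a = rank_one M x y" for a x y
      unfolding D_def using that
      by (intro subsetD[OF closure_subset] complex_vector.span_base) blast
    \<comment> \<open>\<open>rank\<close> needs coefficients of the form \<open>star (w _ _)\<close>
      in both entries. They are made arbitrary one after the other by density, and then removed by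
      nondegeneracy; fullness of \<open>N\<close> finally covers all of \<open>'a\<close>.\<close>
    have "ip N (lact N (star (w n' m)) n) (lact N (star d) k) \<in> D"
      if "n \<in> carrier N" "n' \<in> carrier N" "m \<in> carrier M" "k \<in> carrier N" for n n' m k d
    proof (rule closed_subspace_dense_span[OF w_dense D, of "\<lambda>d. ip N (lact N (star (w n' m)) n) (lact N (star d) k)"])
      show "bounded_linear (\<lambda>d. ip N (lact N (star (w n' m)) n) (lact N (star d) k))"
        using bounded_linear_compose[OF N.bounded_linear_ip_lact bounded_linear_star] that by simp
      show "\<exists>c'. ip N (lact N (star (w n' m)) n) (lact N (star (scaleC c d)) k) =
          scaleC c' (ip N (lact N (star (w n' m)) n) (lact N (star d) k))" for c d
        using that by (auto simp: star_scaleC)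
      show "ip N (lact N (star (w n' m)) n) (lact N (star d) k) \<in> D"
        if "d \<in> {w x y | x y. x \<in> carrier N \<and> y \<in> carrier M}" for d
      proof -
        from that obtain n2 m2 where "d = w n2 m2" "n2 \<in> carrier N" "m2 \<in> carrier M" by blast
        then show ?thesis
          using \<open>n \<in> carrier N\<close> \<open>n' \<in> carrier N\<close> \<open>m \<in> carrier M\<close> \<open>k \<in> carrier N\<close>
          by (simp only:) (rule rank_D[OF _ _ rank]; simp)
      qed
    qed
    from this[where d = "star _"] have step1: "ip N (lact N (star (w n' m)) n) (lact N d k) \<in> D"
      if "n \<in> carrier N" "n' \<in> carrier N" "m \<in> carrier M" "k \<in> carrier N" for n n' m k d
      using that by simp
    \<comment> \<open>A coefficient \<open>e = w n' m\<close> moves from the second entry to the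
      first as \<open>star (w n' m)\<close>, the form that \<open>step1\<close> handles.\<close>
    have step2: "ip N n (lact N e (lact N d k)) \<in> D"
      if "n \<in> carrier N" "k \<in> carrier N" for n k d e
    proof (rule closed_subspace_dense_span[OF w_dense D, of "\<lambda>e. ip N n (lact N e (lact N d k))"])
      show "bounded_linear (\<lambda>e. ip N n (lact N e (lact N d k)))"
        using that by (intro N.bounded_linear_ip_lact) simp_all
      show "\<exists>c'. ip N n (lact N (scaleC c e) (lact N d k)) = scaleC c' (ip N n (lact N e (lact N d k)))" for c e
        using that by auto
      fix e assume "e \<in> {w x y | x y. x \<in> carrier N \<and> y \<in> carrier M}"
      then obtain n' m where e: "e = w n' m" "n' \<in> carrier N" "m \<in> carrier M" by blast
      show "ip N n (lact N e (lact N d k)) \<in> D"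
        using step1[of n n' m k d] that e N.ip_lact[of n "lact N d k" e] by simp
    qed
    have step3: "ip N n (lact N e k) \<in> D" if "n \<in> carrier N" "k \<in> carrier N" for n k e
      using N.ip_mem_closed_subspace[OF D, of "lact N (star e) n" k] step2[of n _ e] that by (simp add: N.ip_lact)
    have step4: "ip N n k \<in> D" if "n \<in> carrier N" "k \<in> carrier N" for n k
      by (rule N.ip_mem_closed_subspace[OF D that(1) _ that(2)]) (rule step3[OF that(1)])
    have "a \<in> D"
      by (rule closed_subspace_dense_span[OF fullN D, of "\<lambda>a. a"]) (use step4 in auto)
    then show ?thesis unfolding D_def by (rule M.left_mult_compact)
  qed
  moreover have "compact_ops M \<subseteq> range (left_mult M)"
  proof (rule M.compact_ops_subset_range)
    let ?X = "{ip N x y | x y. x \<in> carrier N \<and> y \<in> carrier N}"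
    have 0: "rank_one M (lact M a x) (lact M b y) \<in> range (left_mult M)"
      if "a \<in> ?X" "b \<in> ?X" "x \<in> carrier M" "y \<in> carrier M" for a b x y
    proof -
      from that(1,2) obtain n n' k k' where "a = ip N n n'" "b = ip N k k'"
        "n \<in> carrier N" "n' \<in> carrier N" "k \<in> carrier N" "k' \<in> carrier N" by blast
      then show ?thesis using rank[of n n' x k k' y] that(3,4) by (metis rangeI)
    qed
    have 1: "rank_one M x (lact M b y) \<in> range (left_mult M)"
      if b: "b \<in> ?X" and x: "x \<in> carrier M" and y: "y \<in> carrier M" for b x y
    proof (rule M.range_left_mult_dense[OF fullN M.lact_closed[OF y] _ x])
      show "rank_one M (lact M a z) (lact M b y) \<in> range (left_mult M)" if "a \<in> ?X" "z \<in> carrier M" for a z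
        by (rule 0[OF that(1) b that(2) y])
    qed
    fix x y assume x: "x \<in> carrier M" and y: "y \<in> carrier M"
    \<comment> \<open>\<open>range_left_mult_dense\<close> frees only the first entry. Adjoints
      exchange the entries, so the second one is freed between two exchanges.\<close>
    have "rank_one M y x \<in> range (left_mult M)"
    proof (rule M.range_left_mult_dense[OF fullN x _ y])
      fix b z assume "b \<in> ?X" "z \<in> carrier M"
      then show "rank_one M (lact M b z) x \<in> range (left_mult M)"
        by (intro M.range_left_mult_star[OF x M.lact_closed] 1 x)
    qed
    then show "rank_one M x y \<in> range (left_mult M)" by (rule M.range_left_mult_star[OF y x])
  qed
  ultimately show "left_action_iso_compacts M"
    unfolding left_action_iso_compacts_def bij_betw_def
    using M.representation M.inj_left_mult by auto
qed

section \<open>The conjugate module as an inverse\<close>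

context hilbert_module
begin

lemma closed_vspan_base: "x \<in> vspan M X \<Longrightarrow> X \<subseteq> carrier M \<Longrightarrow> x \<in> closed_vspan M (mnorm M) X"
  using vspan_closed[of x X] dst_self[of x] by (auto simp: closed_vspan_def intro!: bexI[of _ x])

lemma closed_vspan_limit:
  assumes X: "X \<subseteq> carrier M" and x: "x \<in> carrier M"
    and "\<And>e. e > 0 \<Longrightarrow> \<exists>y\<in>closed_vspan M (mnorm M) X. mnorm M (vdiff M x y) < e"
  shows "x \<in> closed_vspan M (mnorm M) X"
  unfolding closed_vspan_def
proof (intro CollectI conjI allI impI x)
  fix e :: real assume "e > 0"
  then have e: "e / 2 > 0" by simp
  from assms(3)[OF e] obtain y where y: "y \<in> closed_vspan M (mnorm M) X" "mnorm M (vdiff M x y) < e / 2" by blast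
  from y(1) e obtain z where z: "z \<in> vspan M X" "mnorm M (vdiff M y z) < e / 2" and yc: "y \<in> carrier M"
    unfolding closed_vspan_def by blast
  have "mnorm M (vdiff M x z) \<le> mnorm M (vdiff M x y) + mnorm M (vdiff M y z)"
    using x yc vspan_closed[OF z(1) X] by (rule dst_triangle)
  with y z show "\<exists>z\<in>vspan M X. mnorm M (vdiff M x z) < e" by force
qed

lemma closed_vspan_vadd:
  assumes X: "X \<subseteq> carrier M" and xy: "x \<in> closed_vspan M (mnorm M) X" "y \<in> closed_vspan M (mnorm M) X"
  shows "vadd M x y \<in> closed_vspan M (mnorm M) X"
proof -
  have c: "x \<in> carrier M" "y \<in> carrier M" using xy by (simp_all add: closed_vspan_def)
  have "\<exists>z\<in>vspan M X. mnorm M (vdiff M (vadd M x y) z) < e" if "e > 0" for e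
  proof -
    from that have e: "e / 2 > 0" by simp
    from xy(1) e obtain x' where x': "x' \<in> vspan M X" "mnorm M (vdiff M x x') < e / 2"
      unfolding closed_vspan_def by blast
    from xy(2) e obtain y' where y': "y' \<in> vspan M X" "mnorm M (vdiff M y y') < e / 2"
      unfolding closed_vspan_def by blast
    note c' = vspan_closed[OF x'(1) X] vspan_closed[OF y'(1) X]
    have "mnorm M (vdiff M (vadd M x y) (vadd M x' y')) = mnorm M (vadd M (vdiff M x x') (vdiff M y y'))"
      using c c' by (intro nrm_cong) simp_all
    also have "\<dots> \<le> mnorm M (vdiff M x x') + mnorm M (vdiff M y y')"
      using c c' by (intro nrm_add_le) simp_all
    finally have "mnorm M (vdiff M (vadd M x y) (vadd M x' y')) < e" using x' y' by simp
    with vspan_add[OF x'(1) y'(1)] show ?thesis by blast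
  qed
  with c show ?thesis by (simp add: closed_vspan_def)
qed

lemma closed_vspan_vscale:
  assumes X: "X \<subseteq> carrier M" and x: "x \<in> closed_vspan M (mnorm M) X"
  shows "vscale M c x \<in> closed_vspan M (mnorm M) X"
proof -
  have xc: "x \<in> carrier M" using x by (simp add: closed_vspan_def)
  have "\<exists>z\<in>vspan M X. mnorm M (vdiff M (vscale M c x) z) < e" if "e > 0" for e
  proof -
    have c: "cmod c + 1 > 0" using norm_ge_zero[of c] by linarith
    with that have e: "e / (cmod c + 1) > 0" by simp
    from x e obtain x' where x': "x' \<in> vspan M X" "mnorm M (vdiff M x x') < e / (cmod c + 1)"
      unfolding closed_vspan_def by blast
    note c' = vspan_closed[OF x'(1) X]
    have "mnorm M (vdiff M (vscale M c x) (vscale M c x')) = mnorm M (vscale M c (vdiff M x x'))"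
      using xc c' by (intro nrm_cong) (simp_all add: complex_vector.scale_right_diff_distrib)
    also have "\<dots> = cmod c * mnorm M (vdiff M x x')" using xc c' by (simp add: nrm_scale)
    also have "\<dots> \<le> (cmod c + 1) * mnorm M (vdiff M x x')" by (intro mult_right_mono) simp_all
    also have "\<dots> < e" using x'(2) c by (simp add: pos_less_divide_eq mult.commute)
    finally show ?thesis using vspan_scale[OF x'(1)] by blast
  qed
  with xc show ?thesis by (simp add: closed_vspan_def)
qed

end

lemma norm_cube:
  fixes b :: "'a::c_star_algebra"
  assumes "star b = b"
  shows "norm (b * b * b) = norm b ^ 3"
proof (rule antisym)
  show "norm (b * b * b) \<le> norm b ^ 3"
    using norm_mult_ineq[of "b * b" b] mult_right_mono[OF norm_mult_ineq[of b b] norm_ge_zero[of b]]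
    by (simp add: power3_eq_cube)
  show "norm b ^ 3 \<le> norm (b * b * b)"
  proof (cases "b = 0")
    case False
    have "norm b ^ 3 * norm b = norm (b * b * b * b)"
      using norm_mult_self[of "b * b"] norm_mult_self[OF assms] assms
      by (simp add: star_mult mult.assoc power2_eq_square power3_eq_cube)
    also have "\<dots> \<le> norm (b * b * b) * norm b" by (rule norm_mult_ineq)
    finally show ?thesis using False by simp
  qed simp
qed

text \<open>
  The inverse of \<open>M\<close> is the conjugate module \<open>M\<^sup>*\<close>: its element \<open>x\<^sup>*\<close> is represented by \<open>x\<close>, and
  \<open>\<langle>x\<^sup>*, y\<^sup>*\<rangle>\<close> is the element of \<open>\<A>\<close> acting as \<open>xy\<^sup>*\<close>.
\<close>

locale morita_module = faithful_correspondence M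
  for M :: "('a::c_star_algebra, 'b::c_star_algebra, 'm) corresp" +
  assumes compacts: "left_action_iso_compacts M"
begin

definition theta :: "'m \<Rightarrow> 'm \<Rightarrow> 'a" where
  "theta x y = inv_into UNIV (left_mult M) (rank_one M x y)"

definition conj_module :: "('b, 'a, 'm) corresp" where
  "conj_module = \<lparr>carrier = carrier M, vzero = vzero M, vadd = vadd M,
     vscale = (\<lambda>c. vscale M (cnj c)), ract = (\<lambda>x a. lact M (star a) x), ip = theta,
     lact = (\<lambda>b x. ract M x (star b))\<rparr>"

lemma conj_module_simps [simp]:
  "carrier conj_module = carrier M" "vzero conj_module = vzero M" "vadd conj_module = vadd M"
  "vscale conj_module = (\<lambda>c. vscale M (cnj c))" "ract conj_module = (\<lambda>x a. lact M (star a) x)"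
  "ip conj_module = theta" "lact conj_module = (\<lambda>b x. ract M x (star b))"
  by (simp_all add: conj_module_def)

lemma lact_theta [simp]:
  assumes "x \<in> carrier M" "y \<in> carrier M" "z \<in> carrier M"
  shows "lact M (theta x y) z = ract M x (ip M y z)"
proof -
  have "rank_one M x y \<in> range (left_mult M)"
    using compacts rank_one_compact[OF assms(1,2)]
    by (simp add: left_action_iso_compacts_def bij_betw_def)
  then have "left_mult M (theta x y) = rank_one M x y" unfolding theta_def by (rule f_inv_into_f)
  then show ?thesis using assms(3) left_mult_apply by (metis rank_one_apply)
qed

lemma theta_eqI:
  assumes "\<And>z t. z \<in> carrier M \<Longrightarrow> t \<in> carrier M \<Longrightarrow> ip M t (lact M a z) = ip M t (lact M a' z)"
  shows "a = a'"
  by (rule action_eqI, rule module_eqI) (simp_all add: assms)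

lemma theta_simps:
  "x \<in> carrier M \<Longrightarrow> y \<in> carrier M \<Longrightarrow> z \<in> carrier M \<Longrightarrow> theta x (vadd M y z) = theta x y + theta x z"
  "x \<in> carrier M \<Longrightarrow> y \<in> carrier M \<Longrightarrow> theta x (vscale M (cnj c) y) = scaleC c (theta x y)"
  "x \<in> carrier M \<Longrightarrow> y \<in> carrier M \<Longrightarrow> theta x (lact M (star a) y) = theta x y * a"
  "x \<in> carrier M \<Longrightarrow> y \<in> carrier M \<Longrightarrow> star (theta x y) = theta y x"
  "x \<in> carrier M \<Longrightarrow> y \<in> carrier M \<Longrightarrow> theta (lact M a x) y = a * theta x y"
  "x \<in> carrier M \<Longrightarrow> y \<in> carrier M \<Longrightarrow> theta (ract M x (star b)) y = theta x (ract M y b)"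
  by (rule theta_eqI; simp add: algebra_simps ip_lact star_ip mult_scaleC_left mult_scaleC_right)+

text \<open>In this form it is the inner product formula of a \<open>tensor_realization\<close> of
  \<open>M \<odot> conj_module\<close>.\<close>

lemma theta_mult:
  assumes "x \<in> carrier M" "y \<in> carrier M" "x' \<in> carrier M" "y' \<in> carrier M"
  shows "theta y x * theta x' y' = theta y (ract M y' (star (ip M x x')))"
  by (rule theta_eqI) (use assms in \<open>simp add: mult.assoc\<close>)

text \<open>Each \<open>a\<close> acts as a compact operator, which finite rank operators
  approximate. These are actions of sums of \<open>theta\<close> values, and faithfulness carries
  the approximation back to norms in \<open>'a\<close>.\<close>

lemma theta_dense: "closure (complex_vector.span {theta x y | x y. x \<in> carrier M \<and> y \<in> carrier M}) = UNIV"
proof -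
  let ?S = "complex_vector.span {theta x y | x y. x \<in> carrier M \<and> y \<in> carrier M}"
  have V: "\<exists>a\<in>?S. \<forall>z\<in>carrier M. W z = lact M a z" if "W \<in> finite_rank_ops" for W
    using that
  proof induction
    case vspan_zero
    show ?case by (rule bexI[of _ 0]) (simp_all add: complex_vector.span_zero)
  next
    case (vspan_base W)
    then obtain x y where W: "W = rank_one M x y" "x \<in> carrier M" "y \<in> carrier M" by blast
    then show ?case
      by (intro bexI[of _ "theta x y"]) (auto intro: complex_vector.span_base)
  next
    case (vspan_add W W')
    then obtain a a' where "a \<in> ?S" "\<forall>z\<in>carrier M. W z = lact M a z" "a' \<in> ?S"
      "\<forall>z\<in>carrier M. W' z = lact M a' z" by blast
    then show ?case by (intro bexI[of _ "a + a'"]) (simp_all add: complex_vector.span_add)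
  next
    case (vspan_scale W c)
    then obtain a where "a \<in> ?S" "\<forall>z\<in>carrier M. W z = lact M a z" by blast
    then show ?case by (intro bexI[of _ "scaleC c a"]) (simp_all add: complex_vector.span_scale)
  qed
  have "a \<in> closure ?S" for a
    unfolding closure_approachable
  proof (intro allI impI)
    fix e :: real assume "e > 0"
    then have e: "e / 2 > 0" by simp
    have "left_mult M a \<in> compact_ops M"
      using compacts by (auto simp: left_action_iso_compacts_def bij_betw_def)
    with e obtain W where W: "W \<in> finite_rank_ops"
        "\<And>z. z \<in> carrier M \<Longrightarrow> mnorm M (vdiff M (left_mult M a z) (W z)) \<le> e / 2 * mnorm M z"
      unfolding mem_compact_ops_iff by meson
    obtain a' where a': "a' \<in> ?S" "\<forall>z\<in>carrier M. W z = lact M a' z" using V[OF W(1)] by blast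
    have "norm (a - a') \<le> e / 2"
    proof (rule norm_le_if_action_bounded)
      show "mnorm M (lact M (a - a') z) \<le> e / 2 * mnorm M z" if "z \<in> carrier M" for z
        using W(2)[OF that] a'(2) that by (simp add: lact_diff left_mult_apply)
    qed (use e in simp)
    with \<open>e > 0\<close> have "dist a' a < e" by (simp add: dist_norm norm_minus_commute)
    with a'(1) show "\<exists>a'\<in>?S. dist a' a < e" by blast
  qed
  then show ?thesis by blast
qed

text \<open>The two norms on the common carrier agree, which transfers completeness to
  \<open>conj_module\<close>. For the lower bound \<open>theta x x\<close> is applied to
  \<open>x\<close> itself: with \<open>b = ip M x x\<close> the result is \<open>x b\<close>, of
  squared length \<open>norm b ^ 3\<close>.\<close>

lemma norm_theta: 
  assumes x: "x \<in> carrier M"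
  shows "norm (theta x x) = (mnorm M x)\<^sup>2"
proof (rule antisym)
  show "norm (theta x x) \<le> (mnorm M x)\<^sup>2"
  proof (rule norm_le_if_action_bounded)
    fix z assume z: "z \<in> carrier M"
    have "mnorm M (lact M (theta x x) z) \<le> mnorm M x * norm (ip M x z)"
      using x z by (simp add: nrm_act_le)
    also have "\<dots> \<le> mnorm M x * (mnorm M x * mnorm M z)"
      using x z by (intro mult_left_mono norm_inn_le) simp_all
    finally show "mnorm M (lact M (theta x x) z) \<le> (mnorm M x)\<^sup>2 * mnorm M z"
      by (simp add: power2_eq_square mult.assoc)
  qed simp
  show "(mnorm M x)\<^sup>2 \<le> norm (theta x x)"
  proof (cases "ip M x x = 0")
    case False
    let ?b = "ip M x x"
    have "norm ?b ^ 3 = (mnorm M (ract M x ?b))\<^sup>2"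
      using x by (simp add: nrm_square star_ip norm_cube flip: norm_cube)
    also have "\<dots> = (mnorm M (lact M (theta x x) x))\<^sup>2" using x by simp
    also have "\<dots> \<le> (norm (theta x x) * mnorm M x)\<^sup>2"
      using x by (intro power_mono mnorm_lact_le) simp_all
    also have "\<dots> = (norm (theta x x))\<^sup>2 * norm ?b" by (simp add: power_mult_distrib nrm_square)
    finally have "(norm ?b)\<^sup>2 \<le> (norm (theta x x))\<^sup>2"
      using False by (simp add: power2_eq_square power3_eq_cube)
    from power2_le_imp_le[OF this norm_ge_zero] show ?thesis by (simp add: nrm_square)
  qed (simp add: nrm_square)
qed

lemma mnorm_conj_module: "x \<in> carrier M \<Longrightarrow> mnorm conj_module x = mnorm M x"
  by (simp add: mnorm_def[of conj_module] norm_theta)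

lemma vdiff_conj_module: "vdiff conj_module x y = vdiff M x y"
  by (simp add: vdiff_def)

lemma hilbert_module_conj: "hilbert_module conj_module"
proof (intro hilbert_module.intro hilbert_module_axioms.intro complex_space.intro)
  show "comm_group \<lparr>carrier = carrier conj_module, mult = vadd conj_module, one = vzero conj_module\<rparr>"
    using add_group by simp
  fix x y z and c d :: complex and a a' :: 'a and s
  show "x \<in> carrier conj_module \<Longrightarrow> ract conj_module x (a + a') =
      vadd conj_module (ract conj_module x a) (ract conj_module x a')"
    by (simp add: star_add)
  show "x \<in> carrier conj_module \<Longrightarrow> ract conj_module (ract conj_module x a) a' = ract conj_module x (a * a')"
    by (simp add: star_mult)
  show "x \<in> carrier conj_module \<Longrightarrow> ract conj_module x (scaleC c a) = vscale conj_module c (ract conj_module x a)"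
    by (simp add: star_scaleC)
  show "x \<in> carrier conj_module \<Longrightarrow> positive (ip conj_module x x)"
  proof -
    assume "x \<in> carrier conj_module"
    then have x: "x \<in> carrier M" by simp
    \<comment> \<open>A root in \<open>'a\<close> is not at hand, so positivity is recognised from
      the action, where \<open>ip M y (theta x x y)\<close> is visibly a square.\<close>
    have "positive (theta x x)"
    proof (rule positive_if_action_positive)
      show "star (theta x x) = theta x x" using x by (simp add: theta_simps)
      show "positive (ip M y (lact M (theta x x) y))" if "y \<in> carrier M" for y
      proof -
        have "ip M y (lact M (theta x x) y) = star (ip M x y) * ip M x y"
          using x that by (simp add: star_ip)
        then show ?thesis by simp
      qed
    qed
    then show ?thesis by simp
  qed
  show "x \<in> carrier conj_module \<Longrightarrow> ip conj_module x x = 0 \<Longrightarrow> x = vzero conj_module"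
    using norm_theta[of x] by (simp add: mnorm_eq_0)
  show "\<exists>x\<in>carrier conj_module. (\<lambda>n. mnorm conj_module (vdiff conj_module (s n) x)) \<longlonglongrightarrow> 0"
    if s: "\<forall>n. s n \<in> carrier conj_module"
      and cauchy: "\<forall>e>0. \<exists>N. \<forall>m\<ge>N. \<forall>n\<ge>N. mnorm conj_module (vdiff conj_module (s m) (s n)) < e"
  proof -
    have s': "\<forall>n. s n \<in> carrier M" using s by simp
    moreover have "\<forall>e>0. \<exists>N. \<forall>m\<ge>N. \<forall>n\<ge>N. mnorm M (vdiff M (s m) (s n)) < e"
      using cauchy s' by (simp add: vdiff_conj_module mnorm_conj_module)
    ultimately have "\<exists>x\<in>carrier M. (\<lambda>n. mnorm M (vdiff M (s n) x)) \<longlonglongrightarrow> 0" by (rule complete)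
    then show ?thesis using s' by (auto simp: vdiff_conj_module mnorm_conj_module)
  qed
qed (simp_all add: theta_simps vscale_add_right vscale_add_left vscale_vscale vscale_one)

lemma correspondence_conj: "correspondence conj_module"
proof -
  interpret N: hilbert_module conj_module by (rule hilbert_module_conj)
  have rep: "star_representation conj_module (left_mult conj_module)"
    unfolding star_representation_def
  proof (intro conjI allI)
    fix b b' :: 'b and c
    show "is_adjoint conj_module (left_mult conj_module b) (left_mult conj_module (star b))"
      by (auto simp: is_adjoint_def left_mult_def theta_simps)
    show "left_mult conj_module (b + b') =
        vadd (adjointable_ops conj_module) (left_mult conj_module b) (left_mult conj_module b')"
      by (auto simp: adjointable_ops_def left_mult_def fun_eq_iff star_add ract_add_right)
    show "left_mult conj_module (scaleC c b) = vscale (adjointable_ops conj_module) c (left_mult conj_module b)"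
      by (auto simp: adjointable_ops_def left_mult_def fun_eq_iff star_scaleC ract_scaleC)
    show "left_mult conj_module (b * b') =
        compose (carrier conj_module) (left_mult conj_module b) (left_mult conj_module b')"
      by (auto simp: left_mult_def compose_def fun_eq_iff star_mult ract_ract)
  qed
  define Y where "Y = {lact conj_module b x | b x. x \<in> carrier conj_module}"
  let ?C = "closed_vspan conj_module (mnorm conj_module) Y"
  have X: "Y \<subseteq> carrier conj_module" by (auto simp: Y_def)
  have zero: "vzero M \<in> ?C"
    using N.closed_vspan_base[OF vspan_zero X] by simp
  have add: "vadd M x y \<in> ?C" if "x \<in> ?C" "y \<in> ?C" for x y
    using N.closed_vspan_vadd[OF X that] by simp
  have scale: "vscale M c x \<in> ?C" if "x \<in> ?C" for c x
    using N.closed_vspan_vscale[OF X that, of "cnj c"] by simp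
  have limit: "x \<in> ?C" if x: "x \<in> carrier M"
    and "\<And>e. e > 0 \<Longrightarrow> \<exists>y\<in>carrier M. y \<in> ?C \<and> mnorm M (vdiff M x y) < e" for x
  proof (rule N.closed_vspan_limit[OF X])
    fix e :: real assume "e > 0"
    from that(2)[OF this] obtain y where "y \<in> carrier M" "y \<in> ?C" "mnorm M (vdiff M x y) < e" by blast
    with x show "\<exists>y\<in>?C. mnorm conj_module (vdiff conj_module x y) < e"
      by (intro bexI[of _ y]) (simp_all add: vdiff_conj_module mnorm_conj_module)
  qed (use x in simp)
  \<comment> \<open>Nondegeneracy is inherited from \<open>M\<close>: \<open>theta u v\<close>
    applied to \<open>y\<close> is \<open>ract M u (ip M v y)\<close>, which in the conjugate module
    is a left action on \<open>u\<close>. By \<open>theta_dense\<close> such vectors span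
    \<open>M\<close> densely.\<close>
  have "x \<in> ?C" if "x \<in> carrier M" for x
    using theta_dense that
  proof (rule module_dense_induct)
    fix a y assume "a \<in> {theta x y | x y. x \<in> carrier M \<and> y \<in> carrier M}" and y: "y \<in> carrier M"
    then obtain u v where a: "a = theta u v" "u \<in> carrier M" "v \<in> carrier M" by blast
    then have "lact M a y = lact conj_module (star (ip M v y)) u" using y by simp
    moreover have "u \<in> carrier conj_module" using a by simp
    ultimately have "lact M a y \<in> Y" unfolding Y_def by blast
    then have "lact M a y \<in> vspan conj_module Y" by (rule vspan.vspan_base)
    then show "lact M a y \<in> ?C" by (rule N.closed_vspan_base[OF _ X])
  qed (use zero add scale limit in blast)+
  then have nondeg: "?C = carrier conj_module" by (auto simp: closed_vspan_def)
  show ?thesis by unfold_locales (fact rep, fact nondeg[unfolded Y_def])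
qed

lemma morita_equivalence_if_full:
  assumes "full M"
  shows "morita_equivalence TYPE('m) M"
proof -
  have "tensor_realization conj_module M (ip M)"
    using assms by (auto simp: tensor_realization_def full_def star_ip)
  then have "corresp_iso (conj_module \<odot> M) self_corresp"
    by (rule tensor_iso_selfI[OF correspondence_conj correspondence_axioms])
  moreover have "tensor_realization M conj_module theta"
    using theta_dense by (auto simp: tensor_realization_def theta_simps theta_mult)
  then have "corresp_iso (M \<odot> conj_module) self_corresp"
    by (rule tensor_iso_selfI[OF correspondence_axioms correspondence_conj])
  ultimately show ?thesis
    unfolding morita_equivalence_def using correspondence_axioms correspondence_conj by blast
qed

end

lemma full_compacts_if_morita_equivalence:
  fixes M :: "('a::c_star_algebra, 'b::c_star_algebra, 'm) corresp"
  assumes "morita_equivalence TYPE('n) M"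
  shows "full M \<and> left_action_iso_compacts M"
  using assms unfolding morita_equivalence_def by (elim conjE exE) (rule morita_imp_full_compacts)

text \<open>The inverse constructed for the converse is the conjugate module on the carrier of
  \<open>M\<close>, hence the type \<open>'m\<close> in the equivalence. The second conjunct covers
  inverses whose carrier lies in any other type.\<close>

theorem theorem2p7:
  fixes M :: "('a::c_star_algebra, 'b::c_star_algebra, 'm) corresp"
  assumes "correspondence M"
  shows "(morita_equivalence TYPE('m) M \<longleftrightarrow> full M \<and> left_action_iso_compacts M) \<and>
    (morita_equivalence TYPE('n) M \<longrightarrow> full M \<and> left_action_iso_compacts M)"
proof -
  have conv: "morita_equivalence TYPE('m) M" if full: "full M" and iso: "left_action_iso_compacts M"
  proof -
    interpret correspondence M by fact
    have "faithful_correspondence M"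
    proof (rule faithful_correspondence.intro[OF assms], unfold_locales)
      fix a assume "\<And>x. x \<in> carrier M \<Longrightarrow> lact M a x = vzero M"
      then have "left_mult M a = left_mult M 0" by (auto simp: left_mult_def fun_eq_iff)
      then show "a = 0" using iso by (auto simp: left_action_iso_compacts_def bij_betw_def dest: injD)
    qed
    then have "morita_module M" using iso by (intro morita_module.intro morita_module_axioms.intro)
    then show ?thesis using full by (rule morita_module.morita_equivalence_if_full)
  qed
  show ?thesis
    using conv full_compacts_if_morita_equivalence[of M, where 'n = 'm]
      full_compacts_if_morita_equivalence[of M, where 'n = 'n] by blast
qed

end
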